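(* Let $\mathbb{K}$ be a field and let $\mathcal{G}$ be the class of all connected graphs $H$ with $\operatorname{reg}(S/I(H))=\operatorname{match}(H)$. Let $\mathcal{H}$ be a subset of $\mathcal{G}$ with $K_2\in\mathcal{H}$. Then for every graph $G$ we have $$\operatorname{ind-match}_{\mathcal{H}}(G)\leq \operatorname{reg}(S/I(G)).$$ In particular, $\operatorname{ind-match}_{\{K_2,C_5\}}(G)\leq \operatorname{reg}(S/I(G))$ for every graph $G$.
   Context: All graphs are finite and simple. For a graph $G$ with vertex set $\{v_1,\dots,v_n\}$, $S=\mathbb{K}[x_1,\dots,x_n]$ is the polynomial ring over $\mathbb{K}$ with one variable per vertex of the graph under consideration, and $I(G)=(x_ix_j : v_iv_j\in E(G))\subseteq S$ is the edge ideal. For a finitely generated graded $S$-module $M$ with graded Betti numbers $\beta_{i,j}(M)$, the Castelnuovo--Mumford regularity is $\operatorname{reg}(M)=\max\{j-i : \beta_{i,j}(M)\neq 0\}$. $K_2$ is the complete graph on two vertices and $C_k$ the cycle on $k$ vertices. A matching of $G$ is a set of pairwise disjoint edges; $\operatorname{match}(G)$ is the largest cardinality of a matching of $G$. Let $\mathcal{H}$ be a collection of connected graphs with $K_2\in\mathcal{H}$. For a graph $G$ with at least one edge, an $\mathcal{H}$-subgraph of $G$ is a (nonempty) subgraph of $G$ each of whose connected components belongs to $\mathcal{H}$ (up to isomorphism); it is an induced $\mathcal{H}$-subgraph if moreover it is an induced subgraph of $G$. The induced $\mathcal{H}$-matching number is $$\operatorname{ind-match}_{\mathcal{H}}(G)=\max\{\operatorname{match}(H)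 : H \text{ is an induced } \mathcal{H}\text{-subgraph of } G\},$$ and $\operatorname{ind-match}_{\mathcal{H}}(G)=0$ if $G$ has no edge. *)

theory Defs
  imports Complex_Main "HOL-Library.Poly_Mapping"
begin

section \<open>Finite simple graphs\<close>

type_synonym 'v graph = "'v set \<times> 'v set set"

abbreviation verts :: "'v graph \<Rightarrow> 'v set" where "verts G \<equiv> fst G"
abbreviation edges :: "'v graph \<Rightarrow> 'v set set" where "edges G \<equiv> snd G"

definition simple_graph :: "'v graph \<Rightarrow> bool" where
  "simple_graph G \<longleftrightarrow> finite (verts G) \<and> (\<forall>e \<in> edges G. e \<subseteq> verts G \<and> card e = 2)"

definition graph_iso :: "'a graph \<Rightarrow> 'b graph \<Rightarrow> bool" where
  "graph_iso G H \<longleftrightarrow>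
     (\<exists>f. bij_betw f (verts G) (verts H) \<and> edges H = (\<lambda>e. f ` e) ` edges G)"

definition subgraph_of :: "'v graph \<Rightarrow> 'v graph \<Rightarrow> bool" where
  "subgraph_of H G \<longleftrightarrow> simple_graph H \<and> verts H \<subseteq> verts G \<and> edges H \<subseteq> edges G"

definition induced :: "'v graph \<Rightarrow> 'v set \<Rightarrow> 'v graph" where
  "induced G W = (W, {e \<in> edges G. e \<subseteq> W})"

definition reach :: "'v graph \<Rightarrow> ('v \<times> 'v) set" where
  "reach G = {(u, v). {u, v} \<in> edges G}\<^sup>* \<inter> (verts G \<times> verts G)"

text \<open>The graph without vertices is not connected.\<close>

definition connected_graph :: "'v graph \<Rightarrow> bool" where
  "connected_graph G \<longleftrightarrow> verts G \<noteq> {} \<and> (\<forall>u \<in> verts G. \<forall>v \<in> verts G. (u, v) \<in> reach G)"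

definition components :: "'v graph \<Rightarrow> 'v graph set" where
  "components G = induced G ` (verts G // reach G)"

definition complete_graph :: "nat \<Rightarrow> nat graph" where
  "complete_graph n = ({..<n}, {{i, j} | i j. i < n \<and> j < n \<and> i \<noteq> j})"

definition cycle_graph :: "nat \<Rightarrow> nat graph" where
  "cycle_graph k = ({..<k}, {{i, Suc i mod k} | i. i < k})"

definition matching :: "'v graph \<Rightarrow> 'v set set \<Rightarrow> bool" where
  "matching G M \<longleftrightarrow> M \<subseteq> edges G \<and> pairwise disjnt M"

definition match :: "'v graph \<Rightarrow> nat" where
  "match G = Max (card ` {M. matching G M})"

text \<open>
  A collection of finite graphs is represented by a set of graphs with natural numbers as
  vertices (every finite graph is isomorphic to one of these), and membership in it is
  understood up to isomorphism.
\<close>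

definition iso_mem :: "'v graph \<Rightarrow> nat graph set \<Rightarrow> bool" where
  "iso_mem G \<H> \<longleftrightarrow> (\<exists>H \<in> \<H>. graph_iso G H)"

definition H_subgraph :: "nat graph set \<Rightarrow> 'v graph \<Rightarrow> 'v graph \<Rightarrow> bool" where
  "H_subgraph \<H> H G \<longleftrightarrow>
     subgraph_of H G \<and> verts H \<noteq> {} \<and> (\<forall>C \<in> components H. iso_mem C \<H>)"

definition induced_H_subgraph :: "nat graph set \<Rightarrow> 'v graph \<Rightarrow> 'v graph \<Rightarrow> bool" where
  "induced_H_subgraph \<H> H G \<longleftrightarrow> H_subgraph \<H> H G \<and> H = induced G (verts H)"

definition ind_match :: "nat graph set \<Rightarrow> 'v graph \<Rightarrow> nat" where
  "ind_match \<H> G =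
     (if edges G = {} then 0 else Max {match H | H. induced_H_subgraph \<H> H G})"


section \<open>Polynomials and edge ideals\<close>

text \<open>
  A monomial is a finitely supported exponent vector. The ring \<open>\<bbbK>[x\<^sub>v : v \<in> V]\<close> is the set
  \<open>polys V\<close> of those polynomials in which only variables from \<open>V\<close> occur.
\<close>

type_synonym ('v, 'k) mpoly = "('v \<Rightarrow>\<^sub>0 nat) \<Rightarrow>\<^sub>0 'k"

definition polys :: "'v set \<Rightarrow> ('v, 'k::zero) mpoly set" where
  "polys V = {p. \<forall>m \<in> Poly_Mapping.keys p. Poly_Mapping.keys m \<subseteq> V}"

definition var :: "'v \<Rightarrow> ('v, 'k::comm_ring_1) mpoly" where
  "var v = Poly_Mapping.single (Poly_Mapping.single v 1) 1"

definition mdeg :: "('v \<Rightarrow>\<^sub>0 nat) \<Rightarrow> nat" where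
  "mdeg m = (\<Sum>v \<in> Poly_Mapping.keys m. Poly_Mapping.lookup m v)"

text \<open>In particular, only 0 is homogeneous of a negative degree.\<close>

definition homogeneous :: "int \<Rightarrow> ('v, 'k::zero) mpoly \<Rightarrow> bool" where
  "homogeneous d p \<longleftrightarrow> (\<forall>m \<in> Poly_Mapping.keys p. int (mdeg m) = d)"

definition ideal_generated :: "'v set \<Rightarrow> ('v, 'k::comm_ring_1) mpoly set \<Rightarrow> ('v, 'k) mpoly set" where
  "ideal_generated V B =
     {\<Sum>b \<in> A. f b * b | A f. finite A \<and> A \<subseteq> B \<and> (\<forall>b \<in> A. f b \<in> polys V)}"

definition edge_ideal :: "'v graph \<Rightarrow> ('v, 'k::comm_ring_1) mpoly set" where
  "edge_ideal G = ideal_generated (verts G) {var u * var v | u v. {u, v} \<in> edges G}"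


section \<open>Graded Betti numbers and regularity of \<open>S/I\<close>\<close>

text \<open>Elements of the free module \<open>S\<^sup>n\<close> are functions vanishing from index \<open>n\<close> on.\<close>

definition free_module :: "'v set \<Rightarrow> nat \<Rightarrow> (nat \<Rightarrow> ('v, 'k::zero) mpoly) set" where
  "free_module V n = {f. (\<forall>a < n. f a \<in> polys V) \<and> (\<forall>a \<ge> n. f a = 0)}"

definition mat_apply ::
    "nat \<Rightarrow> nat \<Rightarrow> (nat \<Rightarrow> nat \<Rightarrow> ('v, 'k::comm_ring_1) mpoly) \<Rightarrow>
     (nat \<Rightarrow> ('v, 'k) mpoly) \<Rightarrow> nat \<Rightarrow> ('v, 'k) mpoly" where
  "mat_apply m n A f = (\<lambda>a. if a < m then \<Sum>b<n. A a b * f b else 0)"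

text \<open>
  A minimal graded free resolution
  \<open>\<dots> \<rightarrow> F\<^sub>2 \<rightarrow> F\<^sub>1 \<rightarrow> F\<^sub>0 \<rightarrow> S/I \<rightarrow> 0\<close>, where \<open>S = \<bbbK>[x\<^sub>v : v \<in> V]\<close>, is given by

  \<^item> the ranks \<open>r i\<close> and the degrees \<open>d i a\<close> of the basis elements, that is,
    \<open>F\<^sub>i\<close> is the direct sum of the modules \<open>S(- d i a)\<close> for \<open>a < r i\<close>;
  \<^item> homogeneous polynomials \<open>\<epsilon> a\<close> representing the images in \<open>S/I\<close> of the basis elements
    of \<open>F\<^sub>0\<close>;
  \<^item> the matrices \<open>\<phi> i\<close> of the degree-preserving maps from \<open>F\<^sub>i\<^sub>+\<^sub>1\<close> to \<open>F\<^sub>i\<close>.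

  The conditions say, in this order: the augmentation and the maps are graded; the sequence is
  exact at \<open>S/I\<close>, at \<open>F\<^sub>0\<close> and at \<open>F\<^sub>i\<^sub>+\<^sub>1\<close>; and the image of \<open>\<phi> i\<close> is contained in
  \<open>(x\<^sub>v : v \<in> V) F\<^sub>i\<close>, that is, the matrix entries have constant coefficient 0.
\<close>

definition minimal_graded_free_resolution ::
    "'v set \<Rightarrow> ('v, 'k::comm_ring_1) mpoly set \<Rightarrow> (nat \<Rightarrow> nat) \<Rightarrow> (nat \<Rightarrow> nat \<Rightarrow> int) \<Rightarrow>
     (nat \<Rightarrow> ('v, 'k) mpoly) \<Rightarrow> (nat \<Rightarrow> nat \<Rightarrow> nat \<Rightarrow> ('v, 'k) mpoly) \<Rightarrow> bool" where
  "minimal_graded_free_resolution V I r d \<epsilon> \<phi> \<longleftrightarrow>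
     (\<forall>a < r 0. \<epsilon> a \<in> polys V \<and> homogeneous (d 0 a) (\<epsilon> a)) \<and>
     (\<forall>i. \<forall>a < r i. \<forall>b < r (Suc i).
        \<phi> i a b \<in> polys V \<and> homogeneous (d (Suc i) b - d i a) (\<phi> i a b)) \<and>
     (\<forall>p \<in> polys V. \<exists>f \<in> free_module V (r 0). p - (\<Sum>a < r 0. \<epsilon> a * f a) \<in> I) \<and>
     {f \<in> free_module V (r 0). (\<Sum>a < r 0. \<epsilon> a * f a) \<in> I} =
       mat_apply (r 0) (r 1) (\<phi> 0) ` free_module V (r 1) \<and>
     (\<forall>i. {f \<in> free_module V (r (Suc i)). mat_apply (r i) (r (Suc i)) (\<phi> i) f = (\<lambda>_. 0)} =
       mat_apply (r (Suc i)) (r (Suc (Suc i))) (\<phi> (Suc i)) ` free_module V (r (Suc (Suc i)))) \<and>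
     (\<forall>i. \<forall>a < r i. \<forall>b < r (Suc i). Poly_Mapping.lookup (\<phi> i a b) 0 = 0)"

text \<open>
  \<open>betti V I i j\<close> is the graded Betti number \<open>\<beta>\<^sub>i\<^sub>,\<^sub>j(S/I)\<close>: the number of copies of \<open>S(-j)\<close> in
  \<open>F\<^sub>i\<close>. The description is definite because a minimal graded free resolution (for finite \<open>V\<close> and
  homogeneous \<open>I\<close>) exists and is unique up to isomorphism.
\<close>

definition betti :: "'v set \<Rightarrow> ('v, 'k::field) mpoly set \<Rightarrow> nat \<Rightarrow> int \<Rightarrow> nat" where
  "betti V I i j =
     (THE n. \<exists>r d \<epsilon> \<phi>. minimal_graded_free_resolution V I r d \<epsilon> \<phi> \<and>
                     n = card {a. a < r i \<and> d i a = j})"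

text \<open>
  The Castelnuovo--Mumford regularity of \<open>S/I\<close>. For finite \<open>V\<close> and a proper homogeneous ideal
  \<open>I\<close>, the set is nonempty, and finite by Hilbert's syzygy theorem.
\<close>

definition regularity :: "'v set \<Rightarrow> ('v, 'k::field) mpoly set \<Rightarrow> int" where
  "regularity V I = Max {j - int i | i j. betti V I i j \<noteq> 0}"

definition reg_edge :: "'k::field itself \<Rightarrow> 'v graph \<Rightarrow> int" where
  "reg_edge _ G = regularity (verts G) (edge_ideal G :: ('v, 'k) mpoly set)"

definition reg_eq_match_graphs :: "'k::field itself \<Rightarrow> nat graph set" where
  "reg_eq_match_graphs K =
     {H. simple_graph H \<and> connected_graph H \<and> reg_edge K H = int (match H)}"

end

theory Submission
  imports Defs
begin

text \<open>
  The Taylor resolution of the edge ideal has a basis element for each set \<open>A\<close> of edges, in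
  homological degree \<open>|A|\<close> and internal degree \<open>|\<Union>A|\<close>. Comparing it with a minimal resolution, by
  chain maps and homotopies in both directions, \<open>\<beta>\<^sub>i\<^sub>,\<^sub>j \<noteq> 0\<close> iff the Taylor complex tensored with the
  residue field has nonzero homology in degree \<open>(i, j)\<close>, which is witnessed by a cycle and a cocycle
  with nonzero pairing. The differential of this complex only removes edges without changing the
  union. Hence classes of an induced subgraph remain classes in the whole graph, and cycles and
  cocycles of the parts of a disjoint union can be multiplied. So the regularity of an induced
  subgraph, which is at least the sum over its components, bounds that of \<open>G\<close> from below, whereas
  the matching number of a graph is the sum over its components.
\<close>

section \<open>Polynomials\<close>

text \<open>\<open>betti\<close> is a definite description over resolutions with numbered bases, so
  nothing can be said about its value before a minimal resolution exists and its graded ranks are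
  unique. Existence comes from cancelling unit entries of the Taylor resolution, whose finiteness
  makes the process stop.

  Homology over the residue field is never formed as a quotient. A class is nonzero iff some cocycle
  pairs nontrivially with it, and such pairs of vectors can be extended by zero, pulled back and
  multiplied; the pairing of two products is the product of the pairings, hence nonzero over a
  field.

  The signs of the Taylor complex depend on an ordering of the edges while the Betti numbers do not,
  so each construction may choose the ordering that suits it.\<close>

abbreviation coef :: "('v, 'k::zero) mpoly \<Rightarrow> ('v \<Rightarrow>\<^sub>0 nat) \<Rightarrow> 'k" where
  "coef \<equiv> Poly_Mapping.lookup"

abbreviation const_coef :: "('v, 'k::zero) mpoly \<Rightarrow> 'k" where
  "const_coef p \<equiv> Poly_Mapping.lookup p 0"

abbreviation monom :: "('v \<Rightarrow>\<^sub>0 nat) \<Rightarrow> 'k::zero \<Rightarrow> ('v, 'k) mpoly" where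
  "monom \<equiv> Poly_Mapping.single"

lemma keys_add_nat:
  fixes a b :: "'v \<Rightarrow>\<^sub>0 nat"
  shows "Poly_Mapping.keys (a + b) = Poly_Mapping.keys a \<union> Poly_Mapping.keys b"
  by (auto simp: in_keys_iff lookup_add)

lemma polys_0 [simp]: "0 \<in> polys V"
  by (simp add: polys_def)

lemma polys_1 [simp]: "1 \<in> polys V"
  by (simp add: polys_def)

lemma polys_add: "p \<in> polys V \<Longrightarrow> q \<in> polys V \<Longrightarrow> p + q \<in> polys V"
  using keys_add[of p q] unfolding polys_def by blast

lemma polys_uminus: "p \<in> polys V \<Longrightarrow> - p \<in> polys V"
  for p :: "('v, 'k::comm_ring_1) mpoly"
  by (auto simp: polys_def in_keys_iff)

lemma polys_diff: "p \<in> polys V \<Longrightarrow> q \<in> polys V \<Longrightarrow> p - q \<in> polys V"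
  for p :: "('v, 'k::comm_ring_1) mpoly"
  using polys_add[of p V "- q"] polys_uminus[of q V] by simp

lemma polys_mult: "p \<in> polys V \<Longrightarrow> q \<in> polys V \<Longrightarrow> p * q \<in> polys V"
  for p :: "('v, 'k::comm_ring_1) mpoly"
  using keys_mult[of p q] unfolding polys_def by (fastforce simp: keys_add_nat)

lemma polys_sum: "(\<And>a. a \<in> A \<Longrightarrow> f a \<in> polys V) \<Longrightarrow> sum f A \<in> polys V"
  for f :: "'a \<Rightarrow> ('v, 'k::comm_ring_1) mpoly"
  by (induction A rule: infinite_finite_induct) (auto intro: polys_add)

lemma polys_mono: "Poly_Mapping.keys m \<subseteq> V \<Longrightarrow> monom m c \<in> polys V"
  by (auto simp: polys_def)

lemma mdeg_eq_sum:
  assumes "finite A" "Poly_Mapping.keys m \<subseteq> A"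
  shows "mdeg m = (\<Sum>v\<in>A. Poly_Mapping.lookup m v)"
  unfolding mdeg_def using assms by (intro sum.mono_neutral_left) (auto simp: in_keys_iff)

lemma mdeg_add: "mdeg (a + b) = mdeg a + mdeg b"
proof -
  let ?A = "Poly_Mapping.keys a \<union> Poly_Mapping.keys b"
  have "mdeg (a + b) = (\<Sum>v\<in>?A. Poly_Mapping.lookup (a + b) v)"
    by (intro mdeg_eq_sum) (auto simp: keys_add_nat)
  also have "\<dots> = (\<Sum>v\<in>?A. Poly_Mapping.lookup a v) + (\<Sum>v\<in>?A. Poly_Mapping.lookup b v)"
    by (simp add: lookup_add sum.distrib)
  also have "\<dots> = mdeg a + mdeg b"
    using mdeg_eq_sum[of ?A a] mdeg_eq_sum[of ?A b] by simp
  finally show ?thesis .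
qed

lemma mdeg_eq_0: "mdeg m = 0 \<longleftrightarrow> m = 0"
proof
  assume "mdeg m = 0"
  then have "Poly_Mapping.lookup m v = 0" for v
    unfolding mdeg_def by (cases "v \<in> Poly_Mapping.keys m") (auto simp: in_keys_iff)
  then show "m = 0" by (intro poly_mapping_eqI) simp
qed (simp add: mdeg_def)

lemma homogeneous_0 [simp]: "homogeneous d 0"
  by (simp add: homogeneous_def)

lemma homogeneous_1: "homogeneous 0 1"
  by (simp add: homogeneous_def mdeg_eq_0)

lemma homogeneous_add: "homogeneous d p \<Longrightarrow> homogeneous d q \<Longrightarrow> homogeneous d (p + q)"
  using keys_add[of p q] unfolding homogeneous_def by blast

lemma homogeneous_uminus: "homogeneous d p \<Longrightarrow> homogeneous d (- p)"
  for p :: "('v, 'k::comm_ring_1) mpoly"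
  by (auto simp: homogeneous_def in_keys_iff)

lemma homogeneous_diff: "homogeneous d p \<Longrightarrow> homogeneous d q \<Longrightarrow> homogeneous d (p - q)"
  for p :: "('v, 'k::comm_ring_1) mpoly"
  using homogeneous_add[of d p "- q"] homogeneous_uminus[of d q] by simp

lemma homogeneous_mult:
  fixes p :: "('v, 'k::comm_ring_1) mpoly"
  assumes "homogeneous a p" "homogeneous b q" "c = a + b"
  shows "homogeneous c (p * q)"
  using assms keys_mult[of p q] unfolding homogeneous_def by (fastforce simp: mdeg_add)

lemma homogeneous_sum: "(\<And>a. a \<in> A \<Longrightarrow> homogeneous d (f a)) \<Longrightarrow> homogeneous d (sum f A)"
  by (induction A rule: infinite_finite_induct) (auto intro: homogeneous_add)

lemma homogeneous_const_coef: "homogeneous d p \<Longrightarrow> const_coef p \<noteq> 0 \<Longrightarrow> d = 0"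
  by (force simp: homogeneous_def in_keys_iff mdeg_eq_0)

lemma homogeneous_0_eq_const:
  assumes "homogeneous 0 p"
  shows "p = monom 0 (const_coef p)"
proof (rule poly_mapping_eqI)
  show "coef p m = coef (monom 0 (const_coef p)) m" for m
    using assms by (cases "m = 0") (auto simp: homogeneous_def in_keys_iff mdeg_eq_0 lookup_single)
qed

text \<open>Exponents are natural numbers, so a sum of two exponent vectors is 0 only if both are.
  Hence taking constant coefficients is a ring homomorphism; it is the form in which complexes are
  tensored with the residue field.\<close>

lemma const_coef_mult: "const_coef (p * q) = const_coef p * const_coef q"
  for p :: "('v, 'k::comm_ring_1) mpoly"
proof -
  have "0 = l + m \<longleftrightarrow> m = 0 \<and> l = 0" for l m :: "'v \<Rightarrow>\<^sub>0 nat"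
    by (auto simp: poly_mapping_eq_iff fun_eq_iff lookup_add)
  then have "const_coef (p * q) = (\<Sum>l. coef p l * (\<Sum>m. coef q m when m = 0 when l = 0))"
    by (simp add: lookup_mult when_when conj_commute)
  then show ?thesis
    by (simp add: Sum_any_when_independent mult_when)
qed

lemma const_coef_sum: "const_coef (sum f A) = (\<Sum>a\<in>A. const_coef (f a))"
  by (rule lookup_sum)

lemma coef_mono_mult: "coef (monom m c * p) (m + n) = c * coef p n"
  for p :: "('v, 'k::comm_ring_1) mpoly"
  by (simp add: lookup_mult lookup_single when_mult)

lemma coef_mono_mult_0:
  fixes p :: "('v, 'k::comm_ring_1) mpoly"
  assumes "\<And>n. k \<noteq> m + n"
  shows "coef (monom m c * p) k = 0"
  using assms by (simp add: lookup_mult lookup_single when_mult)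

lemma mono_mult_cancel:
  fixes p q :: "('v, 'k::comm_ring_1) mpoly"
  assumes "monom m 1 * p = monom m 1 * q"
  shows "p = q"
proof (rule poly_mapping_eqI)
  show "coef p n = coef q n" for n
    using coef_mono_mult[of m 1 p n] coef_mono_mult[of m 1 q n] assms by simp
qed

text \<open>Exactness supplies preimages without control of degrees; passing to the part of degree
  \<open>d\<close> in each entry makes them homogeneous. For negative \<open>d\<close> this part is
  0.\<close>

definition hcomp :: "int \<Rightarrow> ('v, 'k::zero) mpoly \<Rightarrow> ('v, 'k) mpoly" where
  "hcomp d p = Poly_Mapping.Abs_poly_mapping (\<lambda>m. if int (mdeg m) = d then coef p m else 0)"

lemma coef_hcomp: "coef (hcomp d p) m = (if int (mdeg m) = d then coef p m else 0)"
proof -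
  have "finite {m. (if int (mdeg m) = d then coef p m else 0) \<noteq> 0}"
    by (rule finite_subset[OF _ finite_keys[of p]]) (auto simp: in_keys_iff split: if_split_asm)
  then show ?thesis by (simp add: hcomp_def)
qed

lemma keys_hcomp: "Poly_Mapping.keys (hcomp d p) \<subseteq> Poly_Mapping.keys p"
  by (auto simp: in_keys_iff coef_hcomp split: if_split_asm)

lemma polys_hcomp: "p \<in> polys V \<Longrightarrow> hcomp d p \<in> polys V"
  using keys_hcomp unfolding polys_def by blast

lemma homogeneous_hcomp: "homogeneous d (hcomp d p)"
  by (auto simp: homogeneous_def in_keys_iff coef_hcomp split: if_splits)

lemma hcomp_homogeneous: "homogeneous d p \<Longrightarrow> hcomp d p = p"
  by (intro poly_mapping_eqI) (auto simp: coef_hcomp homogeneous_def in_keys_iff)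

lemma hcomp_add: "hcomp d (p + q) = hcomp d p + hcomp d q"
  by (intro poly_mapping_eqI) (auto simp: coef_hcomp lookup_add)

lemma hcomp_diff: "hcomp d (p - q) = hcomp d p - hcomp d q"
  for p :: "('v, 'k::comm_ring_1) mpoly"
  by (intro poly_mapping_eqI) (auto simp: coef_hcomp lookup_minus)

lemma hcomp_sum: "hcomp d (sum f A) = (\<Sum>a\<in>A. hcomp d (f a))"
  by (intro poly_mapping_eqI) (auto simp: coef_hcomp lookup_sum)

text \<open>Degrees of monomials add, so \<open>p\<close> times the remainder
  \<open>q - hcomp (d - k) q\<close> has no monomial of degree \<open>d\<close>.\<close>

lemma hcomp_mult:
  fixes p q :: "('v, 'k::comm_ring_1) mpoly"
  assumes "homogeneous k p"
  shows "hcomp d (p * q) = p * hcomp (d - k) q"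
proof -
  let ?r = "q - hcomp (d - k) q"
  have "hcomp d (p * ?r) = 0"
  proof (rule poly_mapping_eqI)
    fix m
    have "coef (p * ?r) m = 0" if "int (mdeg m) = d"
    proof (rule ccontr)
      assume "coef (p * ?r) m \<noteq> 0"
      then obtain a b where "m = a + b" "a \<in> Poly_Mapping.keys p" "b \<in> Poly_Mapping.keys ?r"
        using keys_mult[of p ?r] by (auto simp: in_keys_iff)
      then show False
        using assms that
        by (auto simp: homogeneous_def mdeg_add in_keys_iff lookup_minus coef_hcomp split: if_splits)
    qed
    then show "coef (hcomp d (p * ?r)) m = coef 0 m" by (simp add: coef_hcomp)
  qed
  moreover have "hcomp d (p * hcomp (d - k) q) = p * hcomp (d - k) q"
    using assms homogeneous_hcomp by (intro hcomp_homogeneous homogeneous_mult) auto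
  moreover have "p * q = p * hcomp (d - k) q + p * ?r" by (simp add: algebra_simps)
  ultimately show ?thesis by (simp only: hcomp_add) simp
qed

section \<open>Graded free resolutions\<close>

text \<open>Matrices and vectors are plain functions with an explicit summation set, so bases of any
  type are possible. The ring is arbitrary because the same operations serve for polynomial matrices
  and for their constant coefficients.\<close>

definition mvec :: "'b set \<Rightarrow> ('a \<Rightarrow> 'b \<Rightarrow> 'r::comm_ring_1) \<Rightarrow> ('b \<Rightarrow> 'r) \<Rightarrow> 'a \<Rightarrow> 'r" where
  "mvec B X v a = (\<Sum>b\<in>B. X a b * v b)"

definition mmul :: "'b set \<Rightarrow> ('a \<Rightarrow> 'b \<Rightarrow> 'r::comm_ring_1) \<Rightarrow> ('b \<Rightarrow> 'c \<Rightarrow> 'r) \<Rightarrow> 'a \<Rightarrow> 'c \<Rightarrow> 'r" where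
  "mmul B X Y a c = mvec B X (\<lambda>b. Y b c) a"

lemma mvec_cong:
  "(\<And>b. b \<in> B \<Longrightarrow> X a b = X' a b) \<Longrightarrow> (\<And>b. b \<in> B \<Longrightarrow> v b = v' b) \<Longrightarrow>
    mvec B X v a = mvec B X' v' a"
  by (simp add: mvec_def)

lemma mmul_cong:
  "(\<And>b. b \<in> B \<Longrightarrow> X a b = X' a b) \<Longrightarrow> (\<And>b. b \<in> B \<Longrightarrow> Y b c = Y' b c) \<Longrightarrow>
    mmul B X Y a c = mmul B X' Y' a c"
  by (simp add: mmul_def mvec_def)

lemma mvec_mmul: "mvec C (mmul B X Y) v a = mvec B X (mvec C Y v) a"
  unfolding mmul_def mvec_def sum_distrib_left sum_distrib_right
  by (subst sum.swap) (simp add: mult.assoc)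

lemma mmul_assoc: "mmul C (mmul B X Y) Z a c = mmul B X (mmul C Y Z) a c"
  by (simp add: mmul_def[of C _ Z] mmul_def[of B _ "mmul C Y Z"] mvec_mmul)

lemma mmul_diff_left: "mmul B (\<lambda>a b. X a b - Y a b) Z a c = mmul B X Z a c - mmul B Y Z a c"
  by (simp add: mmul_def mvec_def left_diff_distrib sum_subtractf)

lemma mmul_diff_right: "mmul B X (\<lambda>a b. Y a b - Z a b) a c = mmul B X Y a c - mmul B X Z a c"
  by (simp add: mmul_def mvec_def right_diff_distrib sum_subtractf)

lemma mvec_0: "(\<And>b. b \<in> B \<Longrightarrow> v b = 0) \<Longrightarrow> mvec B X v a = 0"
  by (simp add: mvec_def)

definition idmat :: "'a \<Rightarrow> 'a \<Rightarrow> 'r::comm_ring_1" where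
  "idmat a b = (if a = b then 1 else 0)"

lemma mvec_idmat: "finite B \<Longrightarrow> a \<in> B \<Longrightarrow> mvec B idmat v a = v a"
  by (simp add: mvec_def idmat_def if_distrib[of "\<lambda>x. x * _"] sum.delta cong: if_cong)

lemma mmul_idmat_left: "finite B \<Longrightarrow> a \<in> B \<Longrightarrow> mmul B idmat X a c = X a c"
  by (simp add: mmul_def mvec_idmat)

lemma mmul_idmat_right: "finite B \<Longrightarrow> c \<in> B \<Longrightarrow> mmul B X idmat a c = X a c"
  by (simp add: mmul_def mvec_def idmat_def if_distrib[of "\<lambda>x. _ * x"] sum.delta cong: if_cong)

text \<open>Column \<open>b\<close> of \<open>X\<close> is the image, in a free module with basis degrees \<open>\<delta>\<close>, of a basis
  element of degree \<open>d b\<close> under a degree-preserving map.\<close>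

definition graded_matrix ::
    "'v set \<Rightarrow> 'c set \<Rightarrow> ('c \<Rightarrow> int) \<Rightarrow> 'b set \<Rightarrow> ('b \<Rightarrow> int) \<Rightarrow>
      ('c \<Rightarrow> 'b \<Rightarrow> ('v, 'k::comm_ring_1) mpoly) \<Rightarrow> bool" where
  "graded_matrix V C \<delta> B d X \<longleftrightarrow>
     (\<forall>c\<in>C. \<forall>b\<in>B. X c b \<in> polys V \<and> homogeneous (d b - \<delta> c) (X c b))"

lemma graded_matrix_mmul:
  assumes "graded_matrix V C \<delta> B d X" "graded_matrix V B d A e Y"
  shows "graded_matrix V C \<delta> A e (mmul B X Y)"
proof -
  have "homogeneous (e a - \<delta> c) (X c b * Y b a)" if "c \<in> C" "b \<in> B" "a \<in> A" for a b c
    using assms that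
    by (intro homogeneous_mult[of "d b - \<delta> c" _ "e a - d b"]) (auto simp: graded_matrix_def)
  then show ?thesis
    using assms unfolding graded_matrix_def mmul_def mvec_def
    by (auto intro!: polys_sum polys_mult homogeneous_sum)
qed

lemma graded_matrix_diff:
  assumes "graded_matrix V C \<delta> B d X" "graded_matrix V C \<delta> B d Y"
  shows "graded_matrix V C \<delta> B d (\<lambda>c b. X c b - Y c b)"
  using assms unfolding graded_matrix_def by (auto intro: polys_diff homogeneous_diff)

lemma graded_matrix_idmat: "graded_matrix V B d B d idmat"
  by (auto simp: graded_matrix_def idmat_def homogeneous_1)

definition const_mat :: "('a \<Rightarrow> 'b \<Rightarrow> ('v, 'k::comm_ring_1) mpoly) \<Rightarrow> 'a \<Rightarrow> 'b \<Rightarrow> 'k" where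
  "const_mat X a b = const_coef (X a b)"

lemma const_mat_mmul: "const_mat (mmul B X Y) a c = mmul B (const_mat X) (const_mat Y) a c"
  by (simp add: const_mat_def mmul_def mvec_def const_coef_sum const_coef_mult)

lemma const_mat_diff: "const_mat (\<lambda>a b. X a b - Y a b) a b = const_mat X a b - const_mat Y a b"
  by (simp add: const_mat_def lookup_minus)

lemma const_mat_idmat: "const_mat idmat a b = idmat a b"
  by (simp add: const_mat_def idmat_def)

text \<open>A homogeneous polynomial with nonzero constant coefficient has degree 0. So modulo the
  variables a degree-preserving matrix is block diagonal with respect to the internal
  degree.\<close>

lemma graded_matrix_const:
  "graded_matrix V C \<delta> B d X \<Longrightarrow> c \<in> C \<Longrightarrow> b \<in> B \<Longrightarrow> const_mat X c b \<noteq> 0 \<Longrightarrow> \<delta> c = d b"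
  using homogeneous_const_coef unfolding graded_matrix_def const_mat_def by fastforce

section \<open>Graded ideals and graded free resolutions\<close>

locale graded_ideal =
  fixes V :: "'v set" and I :: "('v, 'k::comm_ring_1) mpoly set"
  assumes ideal_0: "0 \<in> I"
    and ideal_add: "p \<in> I \<Longrightarrow> q \<in> I \<Longrightarrow> p + q \<in> I"
    and ideal_mult: "p \<in> polys V \<Longrightarrow> q \<in> I \<Longrightarrow> p * q \<in> I"
    and ideal_hcomp: "p \<in> I \<Longrightarrow> hcomp e p \<in> I"
begin

lemma ideal_uminus: "p \<in> I \<Longrightarrow> - p \<in> I"
  using ideal_mult[of "- 1" p] polys_uminus[of 1 V] by simp

lemma ideal_diff: "p \<in> I \<Longrightarrow> q \<in> I \<Longrightarrow> p - q \<in> I"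
  using ideal_add[of p "- q"] ideal_uminus[of q] by simp

lemma ideal_sum: "(\<And>a. a \<in> A \<Longrightarrow> f a \<in> I) \<Longrightarrow> sum f A \<in> I"
  by (induction A rule: infinite_finite_induct) (auto intro: ideal_add ideal_0)

end

text \<open>Vectors are only meaningful on the index sets. In position 0 a cycle is a vector which the
  augmentation maps into the ideal.\<close>

definition cycle_vec ::
    "('v, 'k::comm_ring_1) mpoly set \<Rightarrow> (nat \<Rightarrow> 'b set) \<Rightarrow> ('b \<Rightarrow> ('v, 'k) mpoly) \<Rightarrow>
      (nat \<Rightarrow> 'b \<Rightarrow> 'b \<Rightarrow> ('v, 'k) mpoly) \<Rightarrow> nat \<Rightarrow> ('b \<Rightarrow> ('v, 'k) mpoly) \<Rightarrow> bool" where
  "cycle_vec I B \<epsilon> \<phi> n v \<longleftrightarrow>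
     (case n of 0 \<Rightarrow> (\<Sum>a\<in>B 0. \<epsilon> a * v a) \<in> I
      | Suc k \<Rightarrow> \<forall>a\<in>B k. mvec (B (Suc k)) (\<phi> k) v a = 0)"

lemma cycle_vec_0: "cycle_vec I B \<epsilon> \<phi> 0 v \<longleftrightarrow> (\<Sum>a\<in>B 0. \<epsilon> a * v a) \<in> I"
  by (simp add: cycle_vec_def)

lemma cycle_vec_Suc:
  "cycle_vec I B \<epsilon> \<phi> (Suc k) v \<longleftrightarrow> (\<forall>a\<in>B k. mvec (B (Suc k)) (\<phi> k) v a = 0)"
  by (simp add: cycle_vec_def)

lemma cycle_vec_cong:
  "(\<And>a. a \<in> B n \<Longrightarrow> v a = w a) \<Longrightarrow> cycle_vec I B \<epsilon> \<phi> n v \<longleftrightarrow> cycle_vec I B \<epsilon> \<phi> n w"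
  by (cases n) (simp_all add: cycle_vec_def mvec_def)

text \<open>The bases may have any type, which admits sets of edges as well as initial segments of
  the naturals. As \<open>cycle_vec\<close> treats position 0 separately, the single axiom
  \<open>exact\<close> covers all positions; its right-to-left direction contains that composites
  vanish.\<close>

locale graded_resolution = graded_ideal V I
  for V :: "'v set" and I :: "('v, 'k::comm_ring_1) mpoly set" +
  fixes B :: "nat \<Rightarrow> 'b set" and d :: "nat \<Rightarrow> 'b \<Rightarrow> int"
    and \<epsilon> :: "'b \<Rightarrow> ('v, 'k) mpoly" and \<phi> :: "nat \<Rightarrow> 'b \<Rightarrow> 'b \<Rightarrow> ('v, 'k) mpoly"
  assumes finite_basis: "finite (B n)"
    and graded_aug: "a \<in> B 0 \<Longrightarrow> \<epsilon> a \<in> polys V \<and> homogeneous (d 0 a) (\<epsilon> a)"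
    and graded_maps: "graded_matrix V (B n) (d n) (B (Suc n)) (d (Suc n)) (\<phi> n)"
    and aug_surj: "p \<in> polys V \<Longrightarrow>
          \<exists>v. (\<forall>a\<in>B 0. v a \<in> polys V) \<and> p - (\<Sum>a\<in>B 0. \<epsilon> a * v a) \<in> I"
    and exact: "(\<forall>a\<in>B n. v a \<in> polys V) \<Longrightarrow> cycle_vec I B \<epsilon> \<phi> n v \<longleftrightarrow>
          (\<exists>w. (\<forall>b\<in>B (Suc n). w b \<in> polys V) \<and> (\<forall>a\<in>B n. v a = mvec (B (Suc n)) (\<phi> n) w a))"
begin

abbreviation "cyc \<equiv> cycle_vec I B \<epsilon> \<phi>"

lemma polys_maps: "a \<in> B n \<Longrightarrow> b \<in> B (Suc n) \<Longrightarrow> \<phi> n a b \<in> polys V"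
  using graded_maps[of n] by (simp add: graded_matrix_def)

lemma homogeneous_maps: "a \<in> B n \<Longrightarrow> b \<in> B (Suc n) \<Longrightarrow> homogeneous (d (Suc n) b - d n a) (\<phi> n a b)"
  using graded_maps[of n] by (simp add: graded_matrix_def)

text \<open>A column is the image of a basis vector, so the right-to-left direction of
  \<open>exact\<close> applies. This yields that the differential squares to zero.\<close>

lemma cyc_column:
  assumes "b \<in> B (Suc n)"
  shows "cyc n (\<lambda>a. \<phi> n a b)"
proof -
  have "\<phi> n a b = mvec (B (Suc n)) (\<phi> n) (\<lambda>b'. idmat b' b) a" if "a \<in> B n" for a
    using mmul_idmat_right[OF finite_basis assms, of "\<phi> n" a] by (simp add: mmul_def)
  then have "\<exists>w. (\<forall>b\<in>B (Suc n). w b \<in> polys V) \<and> (\<forall>a\<in>B n. \<phi> n a b = mvec (B (Suc n)) (\<phi> n) w a)"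
    by (intro exI[of _ "\<lambda>b'. idmat b' b"]) (simp add: idmat_def)
  moreover have "\<forall>a\<in>B n. \<phi> n a b \<in> polys V"
    using assms polys_maps by simp
  ultimately show ?thesis
    by (simp only: exact)
qed

lemma maps_maps: "a \<in> B n \<Longrightarrow> c \<in> B (Suc (Suc n)) \<Longrightarrow> mmul (B (Suc n)) (\<phi> n) (\<phi> (Suc n)) a c = 0"
  using cyc_column[of c "Suc n"] by (simp add: cycle_vec_Suc mmul_def)

text \<open>The entries of \<phi> are homogeneous. So replacing every entry of an arbitrary preimage
  by its component of the required degree replaces the image by a component of \<open>v\<close>,
  which is \<open>v\<close> itself.\<close>

lemma graded_lift:
  assumes v: "\<forall>a\<in>B n. v a \<in> polys V \<and> homogeneous (e - d n a) (v a)" and "cyc n v"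
  shows "\<exists>w. (\<forall>b\<in>B (Suc n). w b \<in> polys V \<and> homogeneous (e - d (Suc n) b) (w b)) \<and>
             (\<forall>a\<in>B n. v a = mvec (B (Suc n)) (\<phi> n) w a)"
proof -
  obtain w where w: "\<forall>b\<in>B (Suc n). w b \<in> polys V"
    and vw: "\<forall>a\<in>B n. v a = mvec (B (Suc n)) (\<phi> n) w a"
    using exact[of n v] assms by blast
  define w' where "w' b = hcomp (e - d (Suc n) b) (w b)" for b
  have "v a = mvec (B (Suc n)) (\<phi> n) w' a" if a: "a \<in> B n" for a
  proof -
    have "v a = hcomp (e - d n a) (v a)"
      using v a by (simp add: hcomp_homogeneous)
    also have "\<dots> = (\<Sum>b\<in>B (Suc n). hcomp (e - d n a) (\<phi> n a b * w b))"
      using vw a by (simp add: mvec_def hcomp_sum)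
    also have "\<dots> = mvec (B (Suc n)) (\<phi> n) w' a"
      unfolding mvec_def
    proof (rule sum.cong)
      fix b assume "b \<in> B (Suc n)"
      then show "hcomp (e - d n a) (\<phi> n a b * w b) = \<phi> n a b * w' b"
        using hcomp_mult[OF homogeneous_maps[OF a], of b "e - d n a" "w b"] by (simp add: w'_def)
    qed simp
    finally show ?thesis .
  qed
  moreover have "\<forall>b\<in>B (Suc n). w' b \<in> polys V \<and> homogeneous (e - d (Suc n) b) (w' b)"
    using w by (simp add: w'_def polys_hcomp homogeneous_hcomp)
  ultimately show ?thesis by blast
qed

text \<open>Passing to components also works modulo \<open>I\<close>, because a homogeneous ideal
  contains the components of its elements.\<close>

lemma graded_aug_lift:
  assumes p: "p \<in> polys V" "homogeneous e p"
  shows "\<exists>v. (\<forall>a\<in>B 0. v a \<in> polys V \<and> homogeneous (e - d 0 a) (v a)) \<and>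
             p - (\<Sum>a\<in>B 0. \<epsilon> a * v a) \<in> I"
proof -
  obtain v where v: "\<forall>a\<in>B 0. v a \<in> polys V" "p - (\<Sum>a\<in>B 0. \<epsilon> a * v a) \<in> I"
    using aug_surj[OF p(1)] by blast
  define v' where "v' a = hcomp (e - d 0 a) (v a)" for a
  have "hcomp e (\<epsilon> a * v a) = \<epsilon> a * v' a" if "a \<in> B 0" for a
    using hcomp_mult[of "d 0 a" "\<epsilon> a" e "v a"] graded_aug[OF that] by (simp add: v'_def)
  then have "hcomp e (p - (\<Sum>a\<in>B 0. \<epsilon> a * v a)) = p - (\<Sum>a\<in>B 0. \<epsilon> a * v' a)"
    using p(2) by (simp add: hcomp_diff hcomp_sum hcomp_homogeneous)
  then show ?thesis
    using v ideal_hcomp[OF v(2), of e]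
    by (intro exI[of _ v']) (simp add: v'_def polys_hcomp homogeneous_hcomp)
qed

text \<open>The lifting step shared by chain maps and homotopies, performed column by
  column.\<close>

lemma graded_matrix_lift:
  assumes X: "graded_matrix V (B n) (d n) A e X" and cyc: "\<And>a. a \<in> A \<Longrightarrow> cyc n (\<lambda>b. X b a)"
  shows "\<exists>Y. graded_matrix V (B (Suc n)) (d (Suc n)) A e Y \<and>
             (\<forall>b\<in>B n. \<forall>a\<in>A. X b a = mmul (B (Suc n)) (\<phi> n) Y b a)"
proof -
  have "\<forall>a\<in>A. \<exists>w. (\<forall>b\<in>B (Suc n). w b \<in> polys V \<and> homogeneous (e a - d (Suc n) b) (w b)) \<and>
             (\<forall>b\<in>B n. X b a = mvec (B (Suc n)) (\<phi> n) w b)"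
    using X cyc by (auto simp: graded_matrix_def intro!: graded_lift)
  then obtain W where
    "\<forall>a\<in>A. (\<forall>b\<in>B (Suc n). W a b \<in> polys V \<and> homogeneous (e a - d (Suc n) b) (W a b)) \<and>
             (\<forall>b\<in>B n. X b a = mvec (B (Suc n)) (\<phi> n) (W a) b)"
    by metis
  then show ?thesis
    by (intro exI[of _ "\<lambda>b a. W a b"]) (auto simp: graded_matrix_def mmul_def)
qed

end

section \<open>Comparison of two resolutions by chain maps and homotopies\<close>

locale two_resolutions =
  F: graded_resolution V I B d \<epsilon> \<phi> + T: graded_resolution V I C \<delta> \<eta> \<psi>
  for V :: "'v set" and I :: "('v, 'k::comm_ring_1) mpoly set"
    and B :: "nat \<Rightarrow> 'b set" and d \<epsilon> \<phi> and C :: "nat \<Rightarrow> 'c set" and \<delta> \<eta> \<psi>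
begin

text \<open>Comparison theorem: the columns of \<open>\<phi> n\<close> are cycles and
  \<open>f n\<close> preserves cycles, so the columns of their product are cycles of the second
  resolution, and exactness lifts them to \<open>f (Suc n)\<close>.\<close>

lemma chain_map:
  "\<exists>f. (\<forall>n. graded_matrix V (C n) (\<delta> n) (B n) (d n) (f n)) \<and>
       (\<forall>a\<in>B 0. \<epsilon> a - (\<Sum>c\<in>C 0. \<eta> c * f 0 c a) \<in> I) \<and>
       (\<forall>n. \<forall>c\<in>C n. \<forall>b\<in>B (Suc n).
          mmul (C (Suc n)) (\<psi> n) (f (Suc n)) c b = mmul (B n) (f n) (\<phi> n) c b)"
proof -
  define gm where "gm n f \<longleftrightarrow> graded_matrix V (C n) (\<delta> n) (B n) (d n) f"
    for n and f :: "'c \<Rightarrow> 'b \<Rightarrow> ('v, 'k) mpoly"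
  \<comment> \<open>The invariant of the recursion: cycles go to cycles. In position 0 this says
    that the augmentations agree modulo the ideal; later it follows from the chain map
    equation.\<close>
  define good where "good n f \<longleftrightarrow> (\<forall>v. (\<forall>a\<in>B n. v a \<in> polys V) \<longrightarrow> F.cyc n v \<longrightarrow>
                        T.cyc n (mvec (B n) f v))" for n f
  define aug where "aug f \<longleftrightarrow> (\<forall>a\<in>B 0. \<epsilon> a - (\<Sum>c\<in>C 0. \<eta> c * f c a) \<in> I)" for f
  define step where "step n f g \<longleftrightarrow> (\<forall>c\<in>C n. \<forall>b\<in>B (Suc n).
          mmul (C (Suc n)) (\<psi> n) g c b = mmul (B n) f (\<phi> n) c b)" for n f g
  have "\<exists>f. \<forall>n. (gm n (f n) \<and> good n (f n) \<and> (n = 0 \<longrightarrow> aug (f n))) \<and> step n (f n) (f (Suc n))"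
  proof (rule dependent_nat_choice)
    have "\<forall>a\<in>B 0. \<exists>v. (\<forall>c\<in>C 0. v c \<in> polys V \<and> homogeneous (d 0 a - \<delta> 0 c) (v c)) \<and>
             \<epsilon> a - (\<Sum>c\<in>C 0. \<eta> c * v c) \<in> I"
      using F.graded_aug by (blast intro: T.graded_aug_lift)
    from bchoice[OF this] obtain g where
      g: "\<forall>a\<in>B 0. (\<forall>c\<in>C 0. g a c \<in> polys V \<and> homogeneous (d 0 a - \<delta> 0 c) (g a c)) \<and>
             \<epsilon> a - (\<Sum>c\<in>C 0. \<eta> c * g a c) \<in> I" by blast
    define f where "f c a = g a c" for c a
    have gm: "gm 0 f" and aug: "aug f"
      using g by (auto simp: gm_def aug_def f_def graded_matrix_def)
    have "T.cyc 0 (mvec (B 0) f v)" if v: "\<forall>a\<in>B 0. v a \<in> polys V" "F.cyc 0 v" for v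
    proof -
      \<comment> \<open>The errors of the augmentation, weighted by \<open>v\<close>, lie in the
        ideal. Subtracting them from the augmentation of \<open>v\<close> leaves the augmentation of
        \<open>f v\<close>.\<close>
      have "(\<Sum>a\<in>B 0. v a * (\<epsilon> a - (\<Sum>c\<in>C 0. \<eta> c * f c a))) \<in> I"
        using aug v by (auto simp: aug_def intro!: F.ideal_sum F.ideal_mult)
      then have "(\<Sum>a\<in>B 0. \<epsilon> a * v a) - (\<Sum>a\<in>B 0. v a * (\<epsilon> a - (\<Sum>c\<in>C 0. \<eta> c * f c a))) \<in> I"
        using v(2) by (intro F.ideal_diff) (auto simp: cycle_vec_0)
      also have "(\<Sum>a\<in>B 0. \<epsilon> a * v a) - (\<Sum>a\<in>B 0. v a * (\<epsilon> a - (\<Sum>c\<in>C 0. \<eta> c * f c a)))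
          = (\<Sum>a\<in>B 0. \<Sum>c\<in>C 0. \<eta> c * (f c a * v a))"
        by (simp add: algebra_simps sum_subtractf sum_distrib_left)
      also have "\<dots> = (\<Sum>c\<in>C 0. \<eta> c * mvec (B 0) f v c)"
        by (subst sum.swap) (simp add: mvec_def sum_distrib_left)
      finally show ?thesis by (simp add: cycle_vec_0)
    qed
    then show "\<exists>f. gm 0 f \<and> good 0 f \<and> (0 = (0::nat) \<longrightarrow> aug f)"
      using gm aug by (auto simp: good_def)
  next
    fix f n assume f: "gm n f \<and> good n f \<and> (n = 0 \<longrightarrow> aug f)"
    have "graded_matrix V (C n) (\<delta> n) (B (Suc n)) (d (Suc n)) (mmul (B n) f (\<phi> n))"
      using f F.graded_maps[of n] by (auto simp: gm_def intro: graded_matrix_mmul)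
    moreover have "T.cyc n (\<lambda>c. mmul (B n) f (\<phi> n) c b)" if "b \<in> B (Suc n)" for b
    proof -
      have "\<forall>a\<in>B n. \<phi> n a b \<in> polys V"
        using F.polys_maps that by simp
      then show ?thesis
        using f F.cyc_column[OF that] by (simp add: good_def mmul_def)
    qed
    ultimately obtain g where g: "graded_matrix V (C (Suc n)) (\<delta> (Suc n)) (B (Suc n)) (d (Suc n)) g"
      and fg: "\<forall>c\<in>C n. \<forall>b\<in>B (Suc n). mmul (B n) f (\<phi> n) c b = mmul (C (Suc n)) (\<psi> n) g c b"
      using T.graded_matrix_lift by blast
    have "T.cyc (Suc n) (mvec (B (Suc n)) g v)" if v: "F.cyc (Suc n) v" for v
    proof -
      have "mvec (C (Suc n)) (\<psi> n) (mvec (B (Suc n)) g v) c = 0" if c: "c \<in> C n" for c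
      proof -
        have "mvec (C (Suc n)) (\<psi> n) (mvec (B (Suc n)) g v) c = mvec (B (Suc n)) (mmul (B n) f (\<phi> n)) v c"
          unfolding mvec_mmul[symmetric] using fg c by (intro mvec_cong) auto
        also have "\<dots> = 0"
          unfolding mvec_mmul using v by (simp add: cycle_vec_Suc mvec_def[of "B n"])
        finally show ?thesis .
      qed
      then show ?thesis by (simp add: cycle_vec_Suc)
    qed
    then show "\<exists>g. (gm (Suc n) g \<and> good (Suc n) g \<and> (Suc n = 0 \<longrightarrow> aug g)) \<and> step n f g"
      using g fg by (intro exI[of _ g]) (auto simp: gm_def good_def step_def)
  qed
  then obtain f where
    "\<And>n. (gm n (f n) \<and> good n (f n) \<and> (n = 0 \<longrightarrow> aug (f n))) \<and> step n (f n) (f (Suc n))" by blast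
  then show ?thesis
    by (intro exI[of _ f]) (auto simp: gm_def aug_def step_def)
qed

end

context graded_resolution
begin

text \<open>A chain endomorphism that induces 0 on S/I is null-homotopic: the columns of
  \<open>h (Suc n)\<close> minus \<open>s n\<close> times \<open>\<phi> n\<close> are cycles, and
  lifting them gives \<open>s (Suc n)\<close>.\<close>

lemma null_homotopy:
  assumes h: "\<And>n. graded_matrix V (B n) (d n) (B n) (d n) (h n)"
    and aug: "\<And>b. b \<in> B 0 \<Longrightarrow> (\<Sum>a\<in>B 0. \<epsilon> a * h 0 a b) \<in> I"
    and chain: "\<And>n a b. a \<in> B n \<Longrightarrow> b \<in> B (Suc n) \<Longrightarrow>
      mmul (B (Suc n)) (\<phi> n) (h (Suc n)) a b = mmul (B n) (h n) (\<phi> n) a b"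
  shows "\<exists>s. (\<forall>n. graded_matrix V (B (Suc n)) (d (Suc n)) (B n) (d n) (s n)) \<and>
      (\<forall>a\<in>B 0. \<forall>b\<in>B 0. h 0 a b = mmul (B (Suc 0)) (\<phi> 0) (s 0) a b) \<and>
      (\<forall>n. \<forall>a\<in>B (Suc n). \<forall>b\<in>B (Suc n). h (Suc n) a b =
          mmul (B n) (s n) (\<phi> n) a b + mmul (B (Suc (Suc n))) (\<phi> (Suc n)) (s (Suc n)) a b)"
proof -
  \<comment> \<open>The recorded identity is \<open>(h n - \<phi> n s n) \<phi> n = 0\<close>. With
    the chain map equation it makes the next columns cycles. It is inherited because
    \<open>h (Suc n) - \<phi> (Suc n) s (Suc n)\<close> equals \<open>s n \<phi> n\<close> and the
    differential squares to zero.\<close>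
  define P where "P n s \<longleftrightarrow> graded_matrix V (B (Suc n)) (d (Suc n)) (B n) (d n) s \<and>
      (\<forall>a\<in>B n. \<forall>c\<in>B (Suc n).
         mmul (B n) (\<lambda>a b. h n a b - mmul (B (Suc n)) (\<phi> n) s a b) (\<phi> n) a c = 0)" for n s
  define P0 where "P0 s \<longleftrightarrow> (\<forall>a\<in>B 0. \<forall>b\<in>B 0. h 0 a b = mmul (B (Suc 0)) (\<phi> 0) s a b)" for s
  define Q where "Q n s s' \<longleftrightarrow> (\<forall>a\<in>B (Suc n). \<forall>b\<in>B (Suc n). h (Suc n) a b =
          mmul (B n) s (\<phi> n) a b + mmul (B (Suc (Suc n))) (\<phi> (Suc n)) s' a b)" for n s s'
  have "\<exists>s. \<forall>n. (P n (s n) \<and> (n = 0 \<longrightarrow> P0 (s n))) \<and> Q n (s n) (s (Suc n))"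
  proof (rule dependent_nat_choice)
    obtain s where s: "graded_matrix V (B (Suc 0)) (d (Suc 0)) (B 0) (d 0) s" "P0 s"
      using graded_matrix_lift[of 0 "B 0" "d 0" "h 0"] h[of 0] aug by (auto simp: cycle_vec_0 P0_def)
    have "mmul (B 0) (\<lambda>a b. h 0 a b - mmul (B (Suc 0)) (\<phi> 0) s a b) (\<phi> 0) a c = 0"
      if "a \<in> B 0" "c \<in> B (Suc 0)" for a c
    proof -
      have "mmul (B 0) (\<lambda>a b. h 0 a b - mmul (B (Suc 0)) (\<phi> 0) s a b) (\<phi> 0) a c
        = mmul (B 0) (\<lambda>a b. 0) (\<phi> 0) a c"
        using s(2) that by (intro mmul_cong) (auto simp: P0_def)
      then show ?thesis by (simp add: mmul_def mvec_def)
    qed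
    then show "\<exists>s. P 0 s \<and> (0 = (0::nat) \<longrightarrow> P0 s)"
      using s by (auto simp: P_def)
  next
    fix s n assume s: "P n s \<and> (n = 0 \<longrightarrow> P0 s)"
    let ?X = "\<lambda>a b. h (Suc n) a b - mmul (B n) s (\<phi> n) a b"
    have "graded_matrix V (B (Suc n)) (d (Suc n)) (B (Suc n)) (d (Suc n)) ?X"
      using s h[of "Suc n"] graded_maps[of n]
      by (intro graded_matrix_diff graded_matrix_mmul) (auto simp: P_def)
    moreover have "cyc (Suc n) (\<lambda>a. ?X a b)" if b: "b \<in> B (Suc n)" for b
    proof -
      have "mmul (B (Suc n)) (\<phi> n) ?X a b = 0" if a: "a \<in> B n" for a
        using a b s chain[OF a b]
        by (simp add: P_def mmul_diff_right mmul_diff_left mmul_assoc)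
      then show ?thesis by (simp add: cycle_vec_Suc mmul_def)
    qed
    ultimately obtain s' where
      s': "graded_matrix V (B (Suc (Suc n))) (d (Suc (Suc n))) (B (Suc n)) (d (Suc n)) s'"
      and X: "\<forall>a\<in>B (Suc n). \<forall>b\<in>B (Suc n). ?X a b = mmul (B (Suc (Suc n))) (\<phi> (Suc n)) s' a b"
      using graded_matrix_lift[of "Suc n" "B (Suc n)" "d (Suc n)" ?X] by blast
    have "mmul (B (Suc n)) (\<lambda>a b. h (Suc n) a b - mmul (B (Suc (Suc n))) (\<phi> (Suc n)) s' a b)
            (\<phi> (Suc n)) a c = 0" if a: "a \<in> B (Suc n)" and c: "c \<in> B (Suc (Suc n))" for a c
    proof -
      have "h (Suc n) a b - mmul (B (Suc (Suc n))) (\<phi> (Suc n)) s' a b = mmul (B n) s (\<phi> n) a b"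
        if "b \<in> B (Suc n)" for b
        using X a that by (auto simp: algebra_simps)
      then have "mmul (B (Suc n)) (\<lambda>a b. h (Suc n) a b - mmul (B (Suc (Suc n))) (\<phi> (Suc n)) s' a b)
            (\<phi> (Suc n)) a c = mmul (B (Suc n)) (mmul (B n) s (\<phi> n)) (\<phi> (Suc n)) a c"
        by (intro mmul_cong) auto
      also have "\<dots> = mmul (B n) s (mmul (B (Suc n)) (\<phi> n) (\<phi> (Suc n))) a c"
        by (rule mmul_assoc)
      also have "\<dots> = 0"
        unfolding mmul_def[of "B n"] using maps_maps c by (intro mvec_0) auto
      finally show ?thesis .
    qed
    then show "\<exists>s'. (P (Suc n) s' \<and> (Suc n = 0 \<longrightarrow> P0 s')) \<and> Q n s s'"
      using s' X by (intro exI[of _ s']) (auto simp: P_def Q_def algebra_simps)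
  qed
  then obtain s where "\<And>n. (P n (s n) \<and> (n = 0 \<longrightarrow> P0 (s n))) \<and> Q n (s n) (s (Suc n))" by blast
  then show ?thesis
    by (intro exI[of _ s]) (auto simp: P_def P0_def Q_def)
qed

end

text \<open>The identity on vectors indexed by \<open>A\<close> factors through those indexed by
  \<open>C\<close>, so this is a comparison of ranks. In the induction, a nonzero entry in row
  \<open>c\<close> of \<open>f\<close> serves as a pivot and one element of \<open>A\<close> is
  removed along with \<open>c\<close>.\<close>

lemma card_le_if_mmul_eq_idmat:
  fixes f :: "'c \<Rightarrow> 'a \<Rightarrow> 'k::field"
  assumes "finite C" "finite A"
    and "\<And>a b. a \<in> A \<Longrightarrow> b \<in> A \<Longrightarrow> mmul C g f a b = idmat a b"
  shows "card A \<le> card C"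
  using assms
proof (induction C arbitrary: A f rule: finite_induct)
  case empty
  then have "A = {}" by (force simp: mmul_def mvec_def idmat_def)
  then show ?case by simp
next
  case (insert c C)
  show ?case
  proof (cases "\<forall>b\<in>A. f c b = 0")
    case True
    then have "mmul C g f a b = idmat a b" if "a \<in> A" "b \<in> A" for a b
      using insert.prems(2)[OF that] insert.hyps that by (simp add: mmul_def mvec_def)
    then have "card A \<le> card C" by (intro insert.IH insert.prems)
    then show ?thesis using insert.hyps by simp
  next
    case False
    then obtain b0 where b0: "b0 \<in> A" "f c b0 \<noteq> 0" by blast
    define r where "r b = f c b / f c b0" for b
    \<comment> \<open>Multiples of column \<open>b0\<close> are subtracted to clear row
      \<open>c\<close>. The product with \<open>g\<close> remains the identity on the other columns,
      since its column \<open>b0\<close> is 0 outside row \<open>b0\<close>.\<close>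
    define f' where "f' x b = f x b - f x b0 * r b" for x b
    have "mmul C g f' a b = idmat a b" if "a \<in> A - {b0}" "b \<in> A - {b0}" for a b
    proof -
      have "f' c b = 0" using b0 by (simp add: f'_def r_def)
      then have "mmul C g f' a b = mmul (insert c C) g f' a b"
        using insert.hyps by (simp add: mmul_def mvec_def)
      also have "\<dots> = mmul (insert c C) g f a b - mmul (insert c C) g f a b0 * r b"
        by (simp add: mmul_def mvec_def f'_def right_diff_distrib sum_subtractf sum_distrib_right
              mult.assoc)
      also have "\<dots> = idmat a b"
        using insert.prems(2) that b0 by (auto simp: idmat_def)
      finally show ?thesis .
    qed
    then have "card (A - {b0}) \<le> card C"
      using insert.prems by (intro insert.IH[of _ f']) auto
    then show ?thesis
      using b0 insert.prems insert.hyps by (simp add: card_Diff_singleton)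
  qed
qed

context two_resolutions
begin

text \<open>Tensoring with the residue field, i.e. passing to constant coefficients, turns the chain
  maps and the homotopy into statements about matrices over the field.\<close>

lemma homotopy_const:
  obtains f :: "nat \<Rightarrow> 'c \<Rightarrow> 'b \<Rightarrow> 'k" and g :: "nat \<Rightarrow> 'b \<Rightarrow> 'c \<Rightarrow> 'k"
    and s :: "nat \<Rightarrow> 'b \<Rightarrow> 'b \<Rightarrow> 'k"
  where
    "\<And>n c a. c \<in> C n \<Longrightarrow> a \<in> B n \<Longrightarrow> f n c a \<noteq> 0 \<Longrightarrow> \<delta> n c = d n a"
    "\<And>n c a. c \<in> C n \<Longrightarrow> a \<in> B n \<Longrightarrow> g n a c \<noteq> 0 \<Longrightarrow> d n a = \<delta> n c"
    "\<And>n c b. c \<in> C n \<Longrightarrow> b \<in> B (Suc n) \<Longrightarrow>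
      mmul (C (Suc n)) (const_mat (\<psi> n)) (f (Suc n)) c b = mmul (B n) (f n) (const_mat (\<phi> n)) c b"
    "\<And>n a c. a \<in> B n \<Longrightarrow> c \<in> C (Suc n) \<Longrightarrow>
      mmul (B (Suc n)) (const_mat (\<phi> n)) (g (Suc n)) a c = mmul (C n) (g n) (const_mat (\<psi> n)) a c"
    "\<And>a b. a \<in> B 0 \<Longrightarrow> b \<in> B 0 \<Longrightarrow>
      mmul (C 0) (g 0) (f 0) a b = idmat a b + mmul (B (Suc 0)) (const_mat (\<phi> 0)) (s 0) a b"
    "\<And>n a b. a \<in> B (Suc n) \<Longrightarrow> b \<in> B (Suc n) \<Longrightarrow>
      mmul (C (Suc n)) (g (Suc n)) (f (Suc n)) a b = idmat a b +
        mmul (B n) (s n) (const_mat (\<phi> n)) a b +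
        mmul (B (Suc (Suc n))) (const_mat (\<phi> (Suc n))) (s (Suc n)) a b"
proof -
  interpret R: two_resolutions V I C \<delta> \<eta> \<psi> B d \<epsilon> \<phi>
    by unfold_locales
  obtain f where f: "\<And>n. graded_matrix V (C n) (\<delta> n) (B n) (d n) (f n)"
    and f_aug: "\<And>a. a \<in> B 0 \<Longrightarrow> \<epsilon> a - (\<Sum>c\<in>C 0. \<eta> c * f 0 c a) \<in> I"
    and f_chain: "\<And>n c b. c \<in> C n \<Longrightarrow> b \<in> B (Suc n) \<Longrightarrow>
          mmul (C (Suc n)) (\<psi> n) (f (Suc n)) c b = mmul (B n) (f n) (\<phi> n) c b"
    using chain_map by blast
  obtain g where g: "\<And>n. graded_matrix V (B n) (d n) (C n) (\<delta> n) (g n)"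
    and g_aug: "\<And>c. c \<in> C 0 \<Longrightarrow> \<eta> c - (\<Sum>a\<in>B 0. \<epsilon> a * g 0 a c) \<in> I"
    and g_chain: "\<And>n a c. a \<in> B n \<Longrightarrow> c \<in> C (Suc n) \<Longrightarrow>
          mmul (B (Suc n)) (\<phi> n) (g (Suc n)) a c = mmul (C n) (g n) (\<psi> n) a c"
    using R.chain_map by blast
  \<comment> \<open>Both \<open>g f\<close> and the identity induce the identity on S/I, so their
    difference is null-homotopic.\<close>
  define h where "h n a b = mmul (C n) (g n) (f n) a b - idmat a b" for n a b
  have h: "graded_matrix V (B n) (d n) (B n) (d n) (h n)" for n
    unfolding h_def by (intro graded_matrix_diff graded_matrix_mmul[OF g f] graded_matrix_idmat)
  have h_aug: "(\<Sum>a\<in>B 0. \<epsilon> a * h 0 a b) \<in> I" if b: "b \<in> B 0" for b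
  proof -
    \<comment> \<open>The augmentation error of \<open>g\<close>, pulled back along
      \<open>f\<close>, plus that of \<open>f\<close> is minus the augmentation of
      \<open>h\<close>.\<close>
    let ?p = "\<Sum>c\<in>C 0. f 0 c b * (\<eta> c - (\<Sum>a\<in>B 0. \<epsilon> a * g 0 a c))"
    have "?p \<in> I"
      using g_aug f[of 0] b by (intro F.ideal_sum F.ideal_mult) (auto simp: graded_matrix_def)
    then have "- (?p + (\<epsilon> b - (\<Sum>c\<in>C 0. \<eta> c * f 0 c b))) \<in> I"
      using f_aug[OF b] by (intro F.ideal_uminus F.ideal_add)
    also have "?p = (\<Sum>c\<in>C 0. \<eta> c * f 0 c b) - (\<Sum>a\<in>B 0. \<epsilon> a * mmul (C 0) (g 0) (f 0) a b)"
      unfolding mmul_def mvec_def right_diff_distrib sum_subtractf sum_distrib_left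
      by (subst (2) sum.swap) (simp add: ac_simps)
    also have "- (\<dots> + (\<epsilon> b - (\<Sum>c\<in>C 0. \<eta> c * f 0 c b)))
        = (\<Sum>a\<in>B 0. \<epsilon> a * mmul (C 0) (g 0) (f 0) a b) - \<epsilon> b" by simp
    also have "\<epsilon> b = (\<Sum>a\<in>B 0. \<epsilon> a * idmat a b)"
      using mmul_idmat_right[OF F.finite_basis b, of "\<lambda>_. \<epsilon>"] by (simp add: mmul_def mvec_def)
    finally show ?thesis
      by (simp add: h_def right_diff_distrib sum_subtractf)
  qed
  have h_chain: "mmul (B (Suc n)) (\<phi> n) (h (Suc n)) a b = mmul (B n) (h n) (\<phi> n) a b"
    if a: "a \<in> B n" and b: "b \<in> B (Suc n)" for n a b
  proof -
    have "mmul (B (Suc n)) (\<phi> n) (mmul (C (Suc n)) (g (Suc n)) (f (Suc n))) a b =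
        mmul (C (Suc n)) (mmul (C n) (g n) (\<psi> n)) (f (Suc n)) a b"
      unfolding mmul_assoc[symmetric] using g_chain a by (intro mmul_cong) auto
    also have "\<dots> = mmul (B n) (mmul (C n) (g n) (f n)) (\<phi> n) a b"
      unfolding mmul_assoc using f_chain b by (intro mmul_cong) auto
    finally show ?thesis
      using a b F.finite_basis
      by (simp add: h_def[abs_def] mmul_diff_left mmul_diff_right mmul_idmat_left mmul_idmat_right)
  qed
  obtain s where "\<And>n. graded_matrix V (B (Suc n)) (d (Suc n)) (B n) (d n) (s n)"
    and s0: "\<And>a b. a \<in> B 0 \<Longrightarrow> b \<in> B 0 \<Longrightarrow> h 0 a b = mmul (B (Suc 0)) (\<phi> 0) (s 0) a b"
    and s: "\<And>n a b. a \<in> B (Suc n) \<Longrightarrow> b \<in> B (Suc n) \<Longrightarrow> h (Suc n) a b =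
          mmul (B n) (s n) (\<phi> n) a b + mmul (B (Suc (Suc n))) (\<phi> (Suc n)) (s (Suc n)) a b"
    using F.null_homotopy[OF h h_aug h_chain] by blast
  have const_h: "const_mat (h n) a b = mmul (C n) (const_mat (g n)) (const_mat (f n)) a b - idmat a b"
    for n a b
    by (simp only: h_def[abs_def] const_mat_diff const_mat_mmul const_mat_idmat)
  show thesis
  proof (rule that[of "\<lambda>n. const_mat (f n)" "\<lambda>n. const_mat (g n)" "\<lambda>n. const_mat (s n)"])
    show "mmul (C 0) (const_mat (g 0)) (const_mat (f 0)) a b =
        idmat a b + mmul (B (Suc 0)) (const_mat (\<phi> 0)) (const_mat (s 0)) a b"
      if "a \<in> B 0" "b \<in> B 0" for a b
    proof -
      have "const_mat (h 0) a b = const_mat (mmul (B (Suc 0)) (\<phi> 0) (s 0)) a b"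
        using s0[OF that] by (simp add: const_mat_def)
      then show ?thesis unfolding const_h const_mat_mmul by (simp add: algebra_simps)
    qed
    show "mmul (C (Suc n)) (const_mat (g (Suc n))) (const_mat (f (Suc n))) a b = idmat a b +
        mmul (B n) (const_mat (s n)) (const_mat (\<phi> n)) a b +
        mmul (B (Suc (Suc n))) (const_mat (\<phi> (Suc n))) (const_mat (s (Suc n))) a b"
      if "a \<in> B (Suc n)" "b \<in> B (Suc n)" for n a b
    proof -
      have "const_mat (h (Suc n)) a b = const_mat (mmul (B n) (s n) (\<phi> n)) a b +
          const_mat (mmul (B (Suc (Suc n))) (\<phi> (Suc n)) (s (Suc n))) a b"
        using s[OF that] by (simp add: const_mat_def lookup_add)
      then show ?thesis unfolding const_h const_mat_mmul by (simp add: algebra_simps)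
    qed
    show "mmul (C (Suc n)) (const_mat (\<psi> n)) (const_mat (f (Suc n))) c b
        = mmul (B n) (const_mat (f n)) (const_mat (\<phi> n)) c b"
      if "c \<in> C n" "b \<in> B (Suc n)" for n c b
      unfolding const_mat_mmul[symmetric] using f_chain[OF that] by (simp add: const_mat_def)
    show "mmul (B (Suc n)) (const_mat (\<phi> n)) (const_mat (g (Suc n))) a c
        = mmul (C n) (const_mat (g n)) (const_mat (\<psi> n)) a c"
      if "a \<in> B n" "c \<in> C (Suc n)" for n a c
      unfolding const_mat_mmul[symmetric] using g_chain[OF that] by (simp add: const_mat_def)
  qed (use graded_matrix_const[OF f] graded_matrix_const[OF g] in blast)+
qed

end

section \<open>Minimal resolutions and homology over the residue field\<close>

definition minimal_maps ::
    "(nat \<Rightarrow> 'b set) \<Rightarrow> (nat \<Rightarrow> 'b \<Rightarrow> 'b \<Rightarrow> ('v, 'k::comm_ring_1) mpoly) \<Rightarrow> bool" where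
  "minimal_maps B \<phi> \<longleftrightarrow> (\<forall>n. \<forall>a\<in>B n. \<forall>b\<in>B (Suc n). const_mat (\<phi> n) a b = 0)"

text \<open>A pair consisting of a cycle and a cocycle, in homological degree \<open>i\<close> and internal degree
  \<open>j\<close> of the complex tensored with the residue field, on which the canonical pairing does not
  vanish. Such a pair exists iff the homology in this degree is nonzero.\<close>

definition homology_witness ::
    "(nat \<Rightarrow> 'c set) \<Rightarrow> (nat \<Rightarrow> 'c \<Rightarrow> int) \<Rightarrow> (nat \<Rightarrow> 'c \<Rightarrow> 'c \<Rightarrow> 'k::comm_ring_1) \<Rightarrow>
      nat \<Rightarrow> int \<Rightarrow> ('c \<Rightarrow> 'k) \<Rightarrow> ('c \<Rightarrow> 'k) \<Rightarrow> bool" where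
  "homology_witness C \<delta> \<psi> i j z w \<longleftrightarrow>
     (\<forall>c\<in>C i. z c \<noteq> 0 \<longrightarrow> \<delta> i c = j) \<and>
     (\<forall>k. i = Suc k \<longrightarrow> (\<forall>c\<in>C k. (\<Sum>c'\<in>C i. \<psi> k c c' * z c') = 0)) \<and>
     (\<forall>c\<in>C (Suc i). (\<Sum>c'\<in>C i. w c' * \<psi> i c' c) = 0) \<and>
     (\<Sum>c\<in>C i. w c * z c) \<noteq> 0"

context two_resolutions
begin

text \<open>A minimal differential vanishes modulo the variables. The chain map equations then make
  the columns of \<open>f\<close> cycles and the rows of \<open>g\<close> cocycles, and both
  homotopy terms drop out of \<open>g f = 1 + s \<phi> + \<phi> s\<close>.\<close>

lemma minimal_left_inverse:
  assumes min: "minimal_maps B \<phi>"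
  obtains f :: "nat \<Rightarrow> 'c \<Rightarrow> 'b \<Rightarrow> 'k" and g :: "nat \<Rightarrow> 'b \<Rightarrow> 'c \<Rightarrow> 'k"
  where
    "\<And>n c a. c \<in> C n \<Longrightarrow> a \<in> B n \<Longrightarrow> f n c a \<noteq> 0 \<Longrightarrow> \<delta> n c = d n a"
    "\<And>n c a. c \<in> C n \<Longrightarrow> a \<in> B n \<Longrightarrow> g n a c \<noteq> 0 \<Longrightarrow> d n a = \<delta> n c"
    "\<And>n c b. c \<in> C n \<Longrightarrow> b \<in> B (Suc n) \<Longrightarrow> mmul (C (Suc n)) (const_mat (\<psi> n)) (f (Suc n)) c b = 0"
    "\<And>n a c. a \<in> B n \<Longrightarrow> c \<in> C (Suc n) \<Longrightarrow> mmul (C n) (g n) (const_mat (\<psi> n)) a c = 0"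
    "\<And>n a b. a \<in> B n \<Longrightarrow> b \<in> B n \<Longrightarrow> mmul (C n) (g n) (f n) a b = idmat a b"
proof -
  obtain f :: "nat \<Rightarrow> 'c \<Rightarrow> 'b \<Rightarrow> 'k" and g :: "nat \<Rightarrow> 'b \<Rightarrow> 'c \<Rightarrow> 'k" and s :: "nat \<Rightarrow> 'b \<Rightarrow> 'b \<Rightarrow> 'k" where
    f: "\<And>n c a. c \<in> C n \<Longrightarrow> a \<in> B n \<Longrightarrow> f n c a \<noteq> 0 \<Longrightarrow> \<delta> n c = d n a"
    and g: "\<And>n c a. c \<in> C n \<Longrightarrow> a \<in> B n \<Longrightarrow> g n a c \<noteq> 0 \<Longrightarrow> d n a = \<delta> n c"
    and f_chain: "\<And>n c b. c \<in> C n \<Longrightarrow> b \<in> B (Suc n) \<Longrightarrow>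
      mmul (C (Suc n)) (const_mat (\<psi> n)) (f (Suc n)) c b = mmul (B n) (f n) (const_mat (\<phi> n)) c b"
    and g_chain: "\<And>n a c. a \<in> B n \<Longrightarrow> c \<in> C (Suc n) \<Longrightarrow>
      mmul (B (Suc n)) (const_mat (\<phi> n)) (g (Suc n)) a c = mmul (C n) (g n) (const_mat (\<psi> n)) a c"
    and s0: "\<And>a b. a \<in> B 0 \<Longrightarrow> b \<in> B 0 \<Longrightarrow>
      mmul (C 0) (g 0) (f 0) a b = idmat a b + mmul (B (Suc 0)) (const_mat (\<phi> 0)) (s 0) a b"
    and s: "\<And>n a b. a \<in> B (Suc n) \<Longrightarrow> b \<in> B (Suc n) \<Longrightarrow>
      mmul (C (Suc n)) (g (Suc n)) (f (Suc n)) a b = idmat a b +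
        mmul (B n) (s n) (const_mat (\<phi> n)) a b +
        mmul (B (Suc (Suc n))) (const_mat (\<phi> (Suc n))) (s (Suc n)) a b"
  proof (rule homotopy_const, goal_cases)
    case (1 f g s)
    then show thesis by (intro that[of f g s])
  qed
  have l0: "mvec (B (Suc n)) (const_mat (\<phi> n)) v x = 0" if "x \<in> B n" for n v x
    using min that by (simp add: minimal_maps_def mvec_def)
  have r0: "mvec (B n) X (\<lambda>b. const_mat (\<phi> n) b c) x = 0" if "c \<in> B (Suc n)"
    for n c and X :: "'e \<Rightarrow> 'b \<Rightarrow> 'k" and x
    using min that by (simp add: minimal_maps_def mvec_def)
  have gf: "mmul (C n) (g n) (f n) a b = idmat a b" if "a \<in> B n" "b \<in> B n" for n a b
    using that s0[of a b] s[of a _ b]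
    by (cases n) (auto simp: mmul_def[of "B _"] l0 r0)
  show thesis
  proof (rule that[of f g])
    show "mmul (C (Suc n)) (const_mat (\<psi> n)) (f (Suc n)) c b = 0"
      if "c \<in> C n" "b \<in> B (Suc n)" for n c b
      unfolding f_chain[OF that] mmul_def[of "B n"] by (rule r0) fact
    show "mmul (C n) (g n) (const_mat (\<psi> n)) a c = 0"
      if "a \<in> B n" "c \<in> C (Suc n)" for n a c
      unfolding g_chain[OF that, symmetric] mmul_def[of "B (Suc n)"] by (rule l0) fact
  qed (fact f g gf)+
qed

text \<open>Column \<open>a\<close> of \<open>f\<close> is the cycle and row \<open>a\<close> of
  \<open>g\<close> the cocycle; they pair to the diagonal entry of \<open>g f\<close>, which is
  1.\<close>

lemma homology_witness_if_minimal:
  assumes min: "minimal_maps B \<phi>" and a: "a \<in> B i"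
  shows "\<exists>z w. homology_witness C \<delta> (\<lambda>n. const_mat (\<psi> n)) i (d i a) z w"
proof -
  obtain f :: "nat \<Rightarrow> 'c \<Rightarrow> 'b \<Rightarrow> 'k" and g :: "nat \<Rightarrow> 'b \<Rightarrow> 'c \<Rightarrow> 'k" where
    f: "\<And>n c a. c \<in> C n \<Longrightarrow> a \<in> B n \<Longrightarrow> f n c a \<noteq> 0 \<Longrightarrow> \<delta> n c = d n a"
    and f_cycle: "\<And>n c b. c \<in> C n \<Longrightarrow> b \<in> B (Suc n) \<Longrightarrow>
      mmul (C (Suc n)) (const_mat (\<psi> n)) (f (Suc n)) c b = 0"
    and g_cocycle: "\<And>n a c. a \<in> B n \<Longrightarrow> c \<in> C (Suc n) \<Longrightarrow>
      mmul (C n) (g n) (const_mat (\<psi> n)) a c = 0"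
    and gf: "\<And>n a b. a \<in> B n \<Longrightarrow> b \<in> B n \<Longrightarrow> mmul (C n) (g n) (f n) a b = idmat a b"
  proof (rule minimal_left_inverse[OF min], goal_cases)
    case (1 f g)
    show thesis by (rule that[of f g]) (fact 1)+
  qed
  have "homology_witness C \<delta> (\<lambda>n. const_mat (\<psi> n)) i (d i a) (\<lambda>c. f i c a) (g i a)"
    using f f_cycle g_cocycle[OF a] gf[OF a a] a
    by (auto simp: homology_witness_def mmul_def mvec_def idmat_def)
  then show ?thesis by blast
qed

end

text \<open>Since \<open>f\<close> and \<open>g\<close> preserve the internal degree,
  \<open>g f = 1\<close> restricts to the basis elements of degree \<open>j\<close>, and ranks can
  be compared there.\<close>

lemma card_generators_le:
  fixes I :: "('v, 'k::field) mpoly set" and B :: "nat \<Rightarrow> 'b set" and C :: "nat \<Rightarrow> 'c set"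
  assumes "two_resolutions V I B d \<epsilon> \<phi> C \<delta> \<eta> \<psi>" and min: "minimal_maps B \<phi>"
  shows "card {a \<in> B i. d i a = j} \<le> card {c \<in> C i. \<delta> i c = j}"
proof -
  interpret two_resolutions V I B d \<epsilon> \<phi> C \<delta> \<eta> \<psi> by fact
  obtain f :: "nat \<Rightarrow> 'c \<Rightarrow> 'b \<Rightarrow> 'k" and g :: "nat \<Rightarrow> 'b \<Rightarrow> 'c \<Rightarrow> 'k" where
    f: "\<And>n c a. c \<in> C n \<Longrightarrow> a \<in> B n \<Longrightarrow> f n c a \<noteq> 0 \<Longrightarrow> \<delta> n c = d n a"
    and gf: "\<And>n a b. a \<in> B n \<Longrightarrow> b \<in> B n \<Longrightarrow> mmul (C n) (g n) (f n) a b = idmat a b"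
  proof (rule minimal_left_inverse[OF min], goal_cases)
    case (1 f g)
    show thesis by (rule that[of f g]) (fact 1)+
  qed
  show ?thesis
  proof (rule card_le_if_mmul_eq_idmat)
    fix a b assume ab: "a \<in> {a \<in> B i. d i a = j}" "b \<in> {a \<in> B i. d i a = j}"
    have "mmul {c \<in> C i. \<delta> i c = j} (g i) (f i) a b = mmul (C i) (g i) (f i) a b"
      unfolding mmul_def mvec_def using ab f[of _ i b] T.finite_basis
      by (intro sum.mono_neutral_left) auto
    then show "mmul {c \<in> C i. \<delta> i c = j} (g i) (f i) a b = idmat a b"
      using gf ab by simp
  qed (simp_all add: F.finite_basis T.finite_basis)
qed

text \<open>Uniqueness of graded Betti numbers, which makes the description in \<open>betti\<close>
  definite.\<close>

lemma card_generators_eq: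
  fixes I :: "('v, 'k::field) mpoly set" and B :: "nat \<Rightarrow> 'b set" and C :: "nat \<Rightarrow> 'c set"
  assumes "two_resolutions V I B d \<epsilon> \<phi> C \<delta> \<eta> \<psi>" "minimal_maps B \<phi>" "minimal_maps C \<psi>"
  shows "card {a \<in> B i. d i a = j} = card {c \<in> C i. \<delta> i c = j}"
proof (rule antisym)
  interpret two_resolutions V I B d \<epsilon> \<phi> C \<delta> \<eta> \<psi> by fact
  have "two_resolutions V I C \<delta> \<eta> \<psi> B d \<epsilon> \<phi>" by unfold_locales
  then show "card {c \<in> C i. \<delta> i c = j} \<le> card {a \<in> B i. d i a = j}"
    using assms(3) by (rule card_generators_le)
qed (use assms in \<open>auto intro: card_generators_le\<close>)

context two_resolutions
begin

text \<open>Here \<open>B\<close> is the resolution with the nonzero homology class, and the class is moved to \<open>C\<close>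
  and back; the homotopy terms are annihilated by a cocycle.\<close>

lemma generator_if_homology_witness:
  assumes wit: "homology_witness B d (\<lambda>n. const_mat (\<phi> n)) i j z w"
  shows "\<exists>c\<in>C i. \<delta> i c = j"
proof (rule ccontr)
  assume no: "\<not> (\<exists>c\<in>C i. \<delta> i c = j)"
  obtain f :: "nat \<Rightarrow> 'c \<Rightarrow> 'b \<Rightarrow> 'k" and g :: "nat \<Rightarrow> 'b \<Rightarrow> 'c \<Rightarrow> 'k" and s :: "nat \<Rightarrow> 'b \<Rightarrow> 'b \<Rightarrow> 'k" where
    f: "\<And>n c a. c \<in> C n \<Longrightarrow> a \<in> B n \<Longrightarrow> f n c a \<noteq> 0 \<Longrightarrow> \<delta> n c = d n a"
    and s0: "\<And>a b. a \<in> B 0 \<Longrightarrow> b \<in> B 0 \<Longrightarrow>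
      mmul (C 0) (g 0) (f 0) a b = idmat a b + mmul (B (Suc 0)) (const_mat (\<phi> 0)) (s 0) a b"
    and s: "\<And>n a b. a \<in> B (Suc n) \<Longrightarrow> b \<in> B (Suc n) \<Longrightarrow>
      mmul (C (Suc n)) (g (Suc n)) (f (Suc n)) a b = idmat a b +
        mmul (B n) (s n) (const_mat (\<phi> n)) a b +
        mmul (B (Suc (Suc n))) (const_mat (\<phi> (Suc n))) (s (Suc n)) a b"
  proof (rule homotopy_const, goal_cases)
    case (1 f g s)
    show thesis by (rule that[of f g s]) (fact 1)+
  qed
  have z_deg: "d i b = j" if "b \<in> B i" "z b \<noteq> 0" for b
    using wit that by (simp add: homology_witness_def)
  have cycle: "mvec (B (Suc k)) (const_mat (\<phi> k)) z a = 0" if "i = Suc k" "a \<in> B k" for k a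
    using wit that by (simp add: homology_witness_def mvec_def)
  have cocycle: "mvec (B i) (\<lambda>_. w) (\<lambda>b. const_mat (\<phi> i) b a) () = 0"
    if "a \<in> B (Suc i)" for a
    using wit that by (simp add: homology_witness_def mvec_def)
  \<comment> \<open>\<open>W\<close> sends a matrix X to the scalar w X z. In
    \<open>g f = 1 + s \<phi> + \<phi> s\<close> it annihilates \<open>\<phi> s\<close> because
    \<open>w\<close> is a cocycle and \<open>s \<phi>\<close> because \<open>z\<close> is a cycle,
    so \<open>g f\<close> has the value of the pairing.\<close>
  define W where "W X = mvec (B i) (\<lambda>_. w) (mvec (B i) X z) ()"
    for X :: "'b \<Rightarrow> 'b \<Rightarrow> 'k"
  have W_cong: "W X = W Y" if "\<And>a b. a \<in> B i \<Longrightarrow> b \<in> B i \<Longrightarrow> X a b = Y a b" for X Y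
    unfolding W_def using that by (intro mvec_cong) auto
  have W_add: "W (\<lambda>a b. X a b + Y a b) = W X + W Y" for X Y
    by (simp add: W_def mvec_def distrib_left distrib_right sum.distrib)
  have W_id: "W idmat = (\<Sum>b\<in>B i. w b * z b)"
    using F.finite_basis unfolding W_def mvec_def[of "B i" "\<lambda>_. w"]
    by (intro sum.cong) (auto simp: mvec_idmat)
  have W_boundary: "W (mmul (B (Suc i)) (const_mat (\<phi> i)) (s i)) = 0"
    unfolding W_def mvec_mmul
    by (subst mvec_mmul[symmetric], unfold mmul_def)
      (simp add: cocycle mvec_def[of "B (Suc i)"])
  have W_cycle: "W (mmul (B k) (s k) (const_mat (\<phi> k))) = 0" if "i = Suc k" for k
    unfolding W_def mvec_mmul using that cycle by (simp add: mvec_def[of "B k"] mvec_0)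
  \<comment> \<open>\<open>z\<close> lives in internal degree \<open>j\<close>, where position
    \<open>i\<close> of the other resolution has no basis element; hence
    \<open>f z = 0\<close>.\<close>
  have "mvec (B i) (f i) z c = 0" if c: "c \<in> C i" for c
    unfolding mvec_def
  proof (intro sum.neutral ballI)
    fix b assume b: "b \<in> B i"
    show "f i c b * z b = 0"
    proof (rule ccontr)
      assume "f i c b * z b \<noteq> 0"
      then have "\<delta> i c = j" using f[OF c b] z_deg[OF b]
        by (cases "f i c b = 0"; cases "z b = 0") simp_all
      then show False using no c by blast
    qed
  qed
  then have "W (mmul (C i) (g i) (f i)) = 0"
    unfolding W_def mvec_mmul by (simp add: mvec_0 mvec_def[of "C i"])
  moreover have "W (mmul (C i) (g i) (f i)) = W idmat"
  proof (cases i)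
    case 0
    have "W (mmul (C i) (g i) (f i)) =
        W (\<lambda>a b. idmat a b + mmul (B (Suc i)) (const_mat (\<phi> i)) (s i) a b)"
      by (rule W_cong) (use 0 s0 in simp)
    then show ?thesis by (simp add: W_add W_boundary)
  next
    case (Suc k)
    have "W (mmul (C i) (g i) (f i)) = W (\<lambda>a b. (idmat a b +
        mmul (B k) (s k) (const_mat (\<phi> k)) a b) + mmul (B (Suc i)) (const_mat (\<phi> i)) (s i) a b)"
      by (rule W_cong) (use Suc s in simp)
    then show ?thesis
      using W_cycle[OF Suc] W_boundary W_add[of idmat] by (subst (asm) W_add) simp
  qed
  ultimately show False
    using wit W_id by (simp add: homology_witness_def)
qed

end

section \<open>Existence of minimal resolutions\<close>

text \<open>A unit entry of a map is cancelled together with its row and its column, by Gaussian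
  elimination.\<close>

lemma (in graded_resolution) cancel_unit:
  fixes u :: "('v, 'k) mpoly"
  assumes a: "a \<in> B n" and b: "b \<in> B (Suc n)"
    and u: "u \<in> polys V" "homogeneous 0 u" "\<phi> n a b * u = 1" and deg: "d n a = d (Suc n) b"
  defines "B' \<equiv> B(n := B n - {a}, Suc n := B (Suc n) - {b})"
    and "\<phi>' \<equiv> \<phi>(n := \<lambda>x y. \<phi> n x y - \<phi> n x b * u * \<phi> n a y)"
  shows "graded_resolution V I B' d \<epsilon> \<phi>'"
proof -
  \<comment> \<open>\<open>ext v\<close> sets coordinate \<open>b\<close> to the only value for
    which the image under \<open>\<phi> n\<close> is 0 in coordinate \<open>a\<close>. The matrix
    \<open>\<phi>' n\<close> turns out to be \<open>\<phi> n\<close> composed with this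
    extension.\<close>
  define ext where "ext v = v(b := - u * mvec (B (Suc n) - {b}) (\<phi> n) v a)" for v
  define im where "im k v \<longleftrightarrow> (\<exists>w. (\<forall>y\<in>B (Suc k). w y \<in> polys V) \<and>
      (\<forall>x\<in>B k. v x = mvec (B (Suc k)) (\<phi> k) w x))" for k v
  define im' where "im' k v \<longleftrightarrow> (\<exists>w. (\<forall>y\<in>B' (Suc k). w y \<in> polys V) \<and>
      (\<forall>x\<in>B' k. v x = mvec (B' (Suc k)) (\<phi>' k) w x))" for k v
  have cyc_im: "cyc k v \<longleftrightarrow> im k v" if "\<forall>x\<in>B k. v x \<in> polys V" for k v
    using exact[OF that] by (simp add: im_def)
  have B'n: "B' n = B n - {a}" and B'Suc: "B' (Suc n) = B (Suc n) - {b}"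
    and B'_other: "\<And>k. k \<noteq> n \<Longrightarrow> k \<noteq> Suc n \<Longrightarrow> B' k = B k"
    and B'_sub: "\<And>k. B' k \<subseteq> B k"
    by (auto simp: B'_def)
  have \<phi>'n: "\<phi>' n x y = \<phi> n x y - \<phi> n x b * u * \<phi> n a y" for x y
    by (simp add: \<phi>'_def)
  have \<phi>'_other: "\<phi>' k = \<phi> k" if "k \<noteq> n" for k
    using that by (simp add: \<phi>'_def)
  have mvec_a: "mvec (B n) X v x = X x a * v a + mvec (B n - {a}) X v x" for X v and x :: 'b
    unfolding mvec_def by (rule sum.remove[OF finite_basis a])
  have mvec_b: "mvec (B (Suc n)) X v x = X x b * v b + mvec (B (Suc n) - {b}) X v x" for X v and x :: 'b
    unfolding mvec_def by (rule sum.remove[OF finite_basis b])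
  have ext: "mvec (B (Suc n)) (\<phi> n) (ext v) x = mvec (B' (Suc n)) (\<phi>' n) v x" for v x
  proof -
    have "mvec (B (Suc n) - {b}) (\<phi> n) (ext v) x = mvec (B (Suc n) - {b}) (\<phi> n) v x"
      by (intro mvec_cong) (auto simp: ext_def)
    then have "mvec (B (Suc n)) (\<phi> n) (ext v) x = \<phi> n x b * ext v b + mvec (B (Suc n) - {b}) (\<phi> n) v x"
      by (simp add: mvec_b)
    also have "\<dots> = mvec (B' (Suc n)) (\<phi>' n) v x"
      by (simp add: B'Suc \<phi>'n mvec_def ext_def left_diff_distrib sum_subtractf
          sum_distrib_left mult.assoc sum_negf)
    finally show ?thesis .
  qed
  have row_a: "mvec (B' (Suc n)) (\<phi>' n) v a = 0" for v
    by (simp add: mvec_def \<phi>'n u)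
  have eq_ext: "ext v = v" if "mvec (B (Suc n)) (\<phi> n) v a = 0" for v
  proof -
    have "v b = u * \<phi> n a b * v b" using u(3) by (simp add: mult.commute)
    also have "\<dots> = - u * mvec (B (Suc n) - {b}) (\<phi> n) v a"
      using that by (simp add: mvec_b add_eq_0_iff mult.assoc)
    finally show ?thesis by (auto simp: ext_def)
  qed
  have ext_polys: "\<forall>y\<in>B (Suc n). ext v y \<in> polys V" if "\<forall>y\<in>B' (Suc n). v y \<in> polys V" for v
    using that polys_maps[OF a] u(1)
    by (auto simp: ext_def B'Suc mvec_def intro!: polys_mult polys_uminus polys_sum)
  \<comment> \<open>Subtracting a multiple of column \<open>b\<close> moves coordinate
    \<open>a\<close> to 0. Columns are cycles, so the image under the map out of position
    \<open>n\<close> stays the same, modulo \<open>I\<close> in the case of the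
    augmentation.\<close>
  have clear_a: "\<exists>w'. (\<forall>x\<in>B n. w' x \<in> polys V) \<and> w' a = 0 \<and> (\<forall>x. w' x = w x - \<phi> n x b * (u * w a))"
    if "\<forall>x\<in>B n. w x \<in> polys V" for w
    using that a b u polys_maps
    by (intro exI[of _ "\<lambda>x. w x - \<phi> n x b * (u * w a)"])
      (auto simp: mult.assoc[symmetric] intro!: polys_diff polys_mult)
  show ?thesis
  proof
    show "finite (B' k)" for k
      using finite_basis B'_sub finite_subset by blast
    show "\<epsilon> x \<in> polys V \<and> homogeneous (d 0 x) (\<epsilon> x)" if "x \<in> B' 0" for x
      using that B'_sub graded_aug by blast
    show "graded_matrix V (B' k) (d k) (B' (Suc k)) (d (Suc k)) (\<phi>' k)" for k
    proof (cases "k = n")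
      case True
      have "homogeneous (d (Suc n) y - d n x) (\<phi> n x b * u * \<phi> n a y)"
        if "x \<in> B n" "y \<in> B (Suc n)" for x y
      proof (rule homogeneous_mult)
        show "homogeneous (d (Suc n) b - d n x) (\<phi> n x b * u)"
          using homogeneous_maps that b u by (intro homogeneous_mult) auto
        show "homogeneous (d (Suc n) y - d n a) (\<phi> n a y)"
          using homogeneous_maps that a by auto
      qed (simp add: deg)
      moreover have "\<phi> n x b * u * \<phi> n a y \<in> polys V"
        if "x \<in> B n" "y \<in> B (Suc n)" for x y
        using polys_maps a b u that by (intro polys_mult) auto
      ultimately have "graded_matrix V (B n) (d n) (B (Suc n)) (d (Suc n)) (\<phi>' n)"
        unfolding \<phi>'_def fun_upd_same
        by (intro graded_matrix_diff[OF graded_maps]) (simp add: graded_matrix_def)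
      then show ?thesis
        using B'_sub True by (auto simp: graded_matrix_def)
    next
      case False
      then show ?thesis
        using graded_maps[of k] B'_sub by (auto simp: graded_matrix_def \<phi>'_other)
    qed
    show "\<exists>v. (\<forall>x\<in>B' 0. v x \<in> polys V) \<and> p - (\<Sum>x\<in>B' 0. \<epsilon> x * v x) \<in> I" if p: "p \<in> polys V" for p
    proof -
      obtain v where v: "\<forall>x\<in>B 0. v x \<in> polys V" "p - (\<Sum>x\<in>B 0. \<epsilon> x * v x) \<in> I"
        using aug_surj[OF p] by blast
      show ?thesis
      proof (cases "n = 0")
        case True
        obtain v' where v': "\<forall>x\<in>B 0. v' x \<in> polys V" "v' a = 0" "\<And>x. v' x = v x - \<phi> 0 x b * (u * v a)"
          using clear_a[of v] v True by blast
        have "(\<Sum>x\<in>B' 0. \<epsilon> x * v' x) = (\<Sum>x\<in>B 0. \<epsilon> x * v' x)"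
          using True v'(2) B'n finite_basis by (intro sum.mono_neutral_left) auto
        also have "\<dots> = (\<Sum>x\<in>B 0. \<epsilon> x * v x) - (\<Sum>x\<in>B 0. \<epsilon> x * \<phi> 0 x b) * (u * v a)"
          by (simp add: v' right_diff_distrib sum_subtractf sum_distrib_right mult.assoc)
        finally have "p - (\<Sum>x\<in>B' 0. \<epsilon> x * v' x) =
            p - (\<Sum>x\<in>B 0. \<epsilon> x * v x) + u * v a * (\<Sum>x\<in>B 0. \<epsilon> x * \<phi> 0 x b)"
          by (simp add: algebra_simps)
        moreover have "\<dots> \<in> I"
          using v True cyc_column[of b 0] a b u
          by (intro ideal_add ideal_mult polys_mult) (auto simp: cycle_vec_0)
        ultimately have "p - (\<Sum>x\<in>B' 0. \<epsilon> x * v' x) \<in> I"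
          by (simp only:)
        then show ?thesis
          using v'(1) B'_sub[of 0] by (intro exI[of _ v']) auto
      next
        case False
        then show ?thesis using v by (auto simp: B'_other)
      qed
    qed
    have "cycle_vec I B' \<epsilon> \<phi>' k v \<longleftrightarrow> im' k v" if v: "\<forall>x\<in>B' k. v x \<in> polys V" for k v
    proof -
      \<comment> \<open>Cancellation can be felt at the two positions that lose a basis element and
        at their neighbours on either side.\<close>
      consider "k = n" | "k = Suc n" | "k = Suc (Suc n)" | "n = Suc k"
        | "k \<noteq> n" "k \<noteq> Suc n" "k \<noteq> Suc (Suc n)" "n \<noteq> Suc k" by blast
      then show ?thesis
      proof cases
        case 1
        \<comment> \<open>The missing coordinate \<open>a\<close> is filled with 0, the value which
          images of extended vectors have there.\<close>
        let ?v = "v(a := 0)"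
        have drop: "mvec (B n - {a}) X v x = mvec (B n) X ?v x" for X and x :: 'b
        proof -
          have "mvec (B n - {a}) X ?v x = mvec (B n - {a}) X v x"
            by (rule mvec_cong) auto
          then show ?thesis by (simp add: mvec_a)
        qed
        have "cycle_vec I B' \<epsilon> \<phi>' n v \<longleftrightarrow> cyc n ?v"
        proof (cases n)
          case 0
          then show ?thesis
            using drop[of "\<lambda>_. \<epsilon>" undefined] B'n by (simp add: cycle_vec_0 mvec_def)
        next
          case (Suc m)
          then show ?thesis
            using drop B'n B'_other[of m] \<phi>'_other[of m] by (simp add: cycle_vec_Suc)
        qed
        also have "\<dots> \<longleftrightarrow> im n ?v"
          using v 1 B'n by (intro cyc_im) auto
        also have "\<dots> \<longleftrightarrow> im' n v"
        proof
          assume "im n ?v"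
          then obtain w where w: "\<forall>y\<in>B (Suc n). w y \<in> polys V"
            "\<forall>x\<in>B n. ?v x = mvec (B (Suc n)) (\<phi> n) w x" unfolding im_def by blast
          then have "ext w = w" using a by (intro eq_ext) auto
          moreover have "v x = mvec (B (Suc n)) (\<phi> n) w x" if "x \<in> B n - {a}" for x
            using that w(2)[rule_format, of x] by simp
          ultimately show "im' n v"
            unfolding im'_def using w(1) ext[of w] B'n B'_sub[of "Suc n"] by (intro exI[of _ w]) auto
        next
          assume "im' n v"
          then obtain w where "\<forall>y\<in>B' (Suc n). w y \<in> polys V"
            "\<forall>x\<in>B' n. v x = mvec (B' (Suc n)) (\<phi>' n) w x" unfolding im'_def by blast
          then show "im n ?v"
            unfolding im_def using ext ext_polys row_a B'n by (intro exI[of _ "ext w"]) auto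
        qed
        finally show ?thesis using 1 by simp
      next
        case 2
        have "cycle_vec I B' \<epsilon> \<phi>' (Suc n) v \<longleftrightarrow> cyc (Suc n) (ext v)"
          using row_a B'n by (auto simp: cycle_vec_Suc ext)
        also have "\<dots> \<longleftrightarrow> im (Suc n) (ext v)"
          using ext_polys v 2 by (intro cyc_im) auto
        also have "\<dots> \<longleftrightarrow> im' (Suc n) v"
        proof
          assume "im (Suc n) (ext v)"
          then obtain w where w: "\<forall>z\<in>B (Suc (Suc n)). w z \<in> polys V"
            "\<forall>y\<in>B (Suc n). ext v y = mvec (B (Suc (Suc n))) (\<phi> (Suc n)) w y"
            unfolding im_def by blast
          moreover have "ext v y = v y" if "y \<in> B (Suc n) - {b}" for y
            using that by (simp add: ext_def)
          ultimately show "im' (Suc n) v"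
            unfolding im'_def by (intro exI[of _ w]) (auto simp: B'Suc B'_other \<phi>'_other)
        next
          assume "im' (Suc n) v"
          then obtain w where w: "\<forall>z\<in>B (Suc (Suc n)). w z \<in> polys V"
            and vw: "\<forall>y\<in>B (Suc n) - {b}. v y = mvec (B (Suc (Suc n))) (\<phi> (Suc n)) w y"
            unfolding im'_def by (auto simp: B'Suc B'_other \<phi>'_other)
          define t where "t = mvec (B (Suc (Suc n))) (\<phi> (Suc n)) w"
          have "\<forall>y\<in>B (Suc n). t y \<in> polys V"
            using w polys_maps by (auto simp: t_def mvec_def intro!: polys_sum polys_mult)
          then have "cyc (Suc n) t"
            using w by (auto simp: cyc_im im_def t_def)
          then have "ext t = t"
            using a by (intro eq_ext) (auto simp: cycle_vec_Suc)
          moreover have "ext v y = ext t y" if "y \<in> B (Suc n)" for y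
            using vw that by (auto simp: ext_def t_def intro!: arg_cong2[where f = "(*)"] mvec_cong)
          ultimately show "im (Suc n) (ext v)"
            unfolding im_def using w by (auto simp: t_def)
        qed
        finally show ?thesis using 2 by simp
      next
        case 3
        let ?t = "mvec (B k) (\<phi> (Suc n)) v"
        \<comment> \<open>The equation for the deleted row \<open>b\<close> is absent from the new
          cycle condition. It follows from the others: \<open>?t\<close> is a boundary, hence a
          cycle, and so its coordinate \<open>b\<close> is determined by the rest.\<close>
        have "?t b = 0" if 0: "\<forall>y\<in>B (Suc n) - {b}. ?t y = 0"
        proof -
          have "\<forall>y\<in>B (Suc n). ?t y \<in> polys V"
            using v 3 polys_maps by (auto simp: B'_other mvec_def intro!: polys_sum polys_mult)
          then have "cyc (Suc n) ?t"
            using v 3 by (auto simp: cyc_im im_def B'_other)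
          then have "ext ?t = ?t"
            using a by (intro eq_ext) (auto simp: cycle_vec_Suc)
          then have "?t b = - u * mvec (B (Suc n) - {b}) (\<phi> n) ?t a"
            by (metis ext_def fun_upd_same)
          moreover have "mvec (B (Suc n) - {b}) (\<phi> n) ?t a = 0"
            using 0 by (simp add: mvec_def[of "B (Suc n) - {b}"])
          ultimately show ?thesis by simp
        qed
        then have "cycle_vec I B' \<epsilon> \<phi>' k v \<longleftrightarrow> cyc k v"
          using 3 by (auto simp: cycle_vec_Suc B'Suc B'_other \<phi>'_other)
        also have "\<dots> \<longleftrightarrow> im k v"
          using v 3 by (intro cyc_im) (auto simp: B'_other)
        finally show ?thesis
          using 3 by (simp add: im_def im'_def B'_other \<phi>'_other)
      next
        case 4
        have "cycle_vec I B' \<epsilon> \<phi>' k v \<longleftrightarrow> cyc k v"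
          using 4 by (cases k) (auto simp: cycle_vec_0 cycle_vec_Suc B'_other \<phi>'_other)
        also have "\<dots> \<longleftrightarrow> im k v"
          using v 4 by (intro cyc_im) (auto simp: B'_other)
        also have "\<dots> \<longleftrightarrow> im' k v"
        proof
          assume "im k v"
          then obtain w where w: "\<forall>x\<in>B n. w x \<in> polys V"
            and vw: "\<forall>x\<in>B k. v x = mvec (B n) (\<phi> k) w x" unfolding im_def 4 by blast
          obtain w' where w': "\<forall>x\<in>B n. w' x \<in> polys V" "w' a = 0"
            "\<And>x. w' x = w x - \<phi> n x b * (u * w a)"
            using clear_a[OF w] by blast
          have "mvec (B' n) (\<phi> k) w' x = mvec (B n) (\<phi> k) w x" if x: "x \<in> B k" for x
          proof -
            have "mvec (B' n) (\<phi> k) w' x = mvec (B n) (\<phi> k) w' x"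
              using mvec_a[of "\<phi> k" w' x] w'(2) B'n by simp
            also have "\<dots> = mvec (B n) (\<phi> k) w x - mmul (B n) (\<phi> k) (\<phi> n) x b * (u * w a)"
              by (simp add: mvec_def mmul_def w'(3) right_diff_distrib sum_subtractf
                  sum_distrib_right mult.assoc)
            finally show ?thesis using maps_maps[of x k b] x b 4 by simp
          qed
          then show "im' k v"
            unfolding im'_def using vw w'(1) 4 B'_sub[of n]
            by (intro exI[of _ w']) (auto simp: B'_other \<phi>'_other)
        next
          assume "im' k v"
          then obtain w where w: "\<forall>x\<in>B' n. w x \<in> polys V"
            and vw: "\<forall>x\<in>B k. v x = mvec (B' n) (\<phi> k) w x"
            unfolding im'_def using 4 by (auto simp: B'_other \<phi>'_other)
          have "mvec (B n) (\<phi> k) (w(a := 0)) x = mvec (B' n) (\<phi> k) w x" for x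
          proof -
            have "mvec (B n - {a}) (\<phi> k) (w(a := 0)) x = mvec (B n - {a}) (\<phi> k) w x"
              by (rule mvec_cong) auto
            then show ?thesis by (simp add: mvec_a B'n)
          qed
          then show "im k v"
            unfolding im_def using w vw 4 B'n by (intro exI[of _ "w(a := 0)"]) auto
        qed
        finally show ?thesis .
      next
        case 5
        have "cycle_vec I B' \<epsilon> \<phi>' k v \<longleftrightarrow> cyc k v"
          using 5 by (cases k) (auto simp: cycle_vec_0 cycle_vec_Suc B'_other \<phi>'_other)
        also have "\<dots> \<longleftrightarrow> im k v"
          using v 5 by (intro cyc_im) (auto simp: B'_other)
        finally show ?thesis
          using 5 by (simp add: im_def im'_def B'_other \<phi>'_other)
      qed
    qed
    then show "(\<forall>x\<in>B' k. v x \<in> polys V) \<Longrightarrow> cycle_vec I B' \<epsilon> \<phi>' k v \<longleftrightarrow>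
          (\<exists>w. (\<forall>y\<in>B' (Suc k). w y \<in> polys V) \<and> (\<forall>x\<in>B' k. v x = mvec (B' (Suc k)) (\<phi>' k) w x))"
      for k v
      by (simp add: im'_def)
  qed
qed

text \<open>An entry with nonzero constant coefficient is homogeneous of degree 0, hence a nonzero
  constant and invertible over a field. Each cancellation lowers the total number of basis elements,
  which is finite because the bases are empty from \<open>N\<close> on.\<close>

lemma minimal_resolution_exists:
  fixes I :: "('v, 'k::field) mpoly set"
  assumes "graded_resolution V I B d \<epsilon> \<phi>" and "\<And>n. n \<ge> N \<Longrightarrow> B n = {}"
  shows "\<exists>B' \<phi>'. graded_resolution V I B' d \<epsilon> \<phi>' \<and> minimal_maps B' \<phi>'"
  using assms
proof (induction "\<Sum>n<N. card (B n)" arbitrary: B \<phi> rule: less_induct)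
  case less
  interpret graded_resolution V I B d \<epsilon> \<phi> by fact
  show ?case
  proof (cases "minimal_maps B \<phi>")
    case True
    then show ?thesis using less.prems(1) by blast
  next
    case False
    then obtain n a b where ab: "a \<in> B n" "b \<in> B (Suc n)" and c: "const_coef (\<phi> n a b) \<noteq> 0"
      by (auto simp: minimal_maps_def const_mat_def)
    have deg: "d n a = d (Suc n) b"
      using homogeneous_const_coef[OF homogeneous_maps[OF ab] c] by simp
    define u :: "('v, 'k) mpoly" where "u = monom 0 (1 / const_coef (\<phi> n a b))"
    have "\<phi> n a b = monom 0 (const_coef (\<phi> n a b))"
      using homogeneous_maps[OF ab] deg by (intro homogeneous_0_eq_const) simp
    then have "\<phi> n a b * u = monom 0 (const_coef (\<phi> n a b)) * u"
      by (rule arg_cong)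
    also have "\<dots> = 1"
      using c by (simp add: u_def mult_single)
    finally have "\<phi> n a b * u = 1" .
    moreover have "u \<in> polys V" "homogeneous 0 u"
      by (simp_all add: u_def polys_mono homogeneous_def mdeg_eq_0)
    ultimately obtain B' \<phi>' where B': "graded_resolution V I B' d \<epsilon> \<phi>'"
      "B' = B(n := B n - {a}, Suc n := B (Suc n) - {b})"
      using cancel_unit[OF ab] deg by blast
    have "n < N" using ab less.prems(2) by (metis emptyE not_le_imp_less)
    then have "(\<Sum>n<N. card (B' n)) < (\<Sum>n<N. card (B n))"
    proof (intro sum_strict_mono_ex1 bexI[of _ n])
      have "B' n \<subset> B n" using ab by (auto simp: B'(2))
      then show "card (B' n) < card (B n)" by (intro psubset_card_mono finite_basis)
    qed (auto simp: B'(2) finite_basis intro!: card_mono)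
    moreover have "B' m = {}" if "m \<ge> N" for m
      using less.prems(2)[OF that] by (auto simp: B'(2))
    ultimately show ?thesis
      using less.hyps B'(1) by blast
  qed
qed

section \<open>Passage to numbered bases as in the definition of Betti numbers\<close>

lemma (in graded_resolution) reindex:
  assumes \<beta>: "\<And>n. bij_betw (\<beta> n) (C n) (B n)"
  shows "graded_resolution V I C (\<lambda>n c. d n (\<beta> n c)) (\<lambda>c. \<epsilon> (\<beta> 0 c))
           (\<lambda>n c c'. \<phi> n (\<beta> n c) (\<beta> (Suc n) c'))"
proof -
  let ?\<phi> = "\<lambda>n c c'. \<phi> n (\<beta> n c) (\<beta> (Suc n) c')"
  let ?\<epsilon> = "\<lambda>c. \<epsilon> (\<beta> 0 c)"
  have B: "B n = \<beta> n ` C n" for n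
    using \<beta> by (simp add: bij_betw_def)
  define inv where "inv n = inv_into (C n) (\<beta> n)" for n
  have inv: "inv n (\<beta> n c) = c" if "c \<in> C n" for n c
    using \<beta>[of n] that by (simp add: inv_def bij_betw_def)
  have mvec: "mvec (C (Suc n)) (?\<phi> n) (\<lambda>c. v (\<beta> (Suc n) c)) c = mvec (B (Suc n)) (\<phi> n) v (\<beta> n c)" for n v c
    unfolding mvec_def by (rule sum.reindex_bij_betw[OF \<beta>])
  have aug: "(\<Sum>c\<in>C 0. ?\<epsilon> c * v (\<beta> 0 c)) = (\<Sum>a\<in>B 0. \<epsilon> a * v a)" for v
    by (rule sum.reindex_bij_betw[OF \<beta>])
  have cycle: "cycle_vec I C ?\<epsilon> ?\<phi> n (\<lambda>c. v (\<beta> n c)) \<longleftrightarrow> cyc n v" for n v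
    by (cases n) (simp_all add: cycle_vec_0 cycle_vec_Suc aug mvec B)
  show ?thesis
  proof
    show "finite (C n)" for n
      using finite_basis \<beta> bij_betw_finite by blast
    show "\<epsilon> (\<beta> 0 a) \<in> polys V \<and> homogeneous (d 0 (\<beta> 0 a)) (\<epsilon> (\<beta> 0 a))" if "a \<in> C 0" for a
      using graded_aug that by (simp add: B)
    show "graded_matrix V (C n) (\<lambda>c. d n (\<beta> n c)) (C (Suc n)) (\<lambda>c. d (Suc n) (\<beta> (Suc n) c)) (?\<phi> n)" for n
      using graded_maps[of n] by (simp add: graded_matrix_def B)
    show "\<exists>v. (\<forall>a\<in>C 0. v a \<in> polys V) \<and> p - (\<Sum>a\<in>C 0. ?\<epsilon> a * v a) \<in> I" if p: "p \<in> polys V" for p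
    proof -
      obtain v where "\<forall>a\<in>B 0. v a \<in> polys V" "p - (\<Sum>a\<in>B 0. \<epsilon> a * v a) \<in> I"
        using aug_surj[OF p] by blast
      then show ?thesis
        by (intro exI[of _ "\<lambda>c. v (\<beta> 0 c)"]) (simp add: aug B)
    qed
    show "cycle_vec I C ?\<epsilon> ?\<phi> n v \<longleftrightarrow> (\<exists>w. (\<forall>b\<in>C (Suc n). w b \<in> polys V) \<and>
        (\<forall>a\<in>C n. v a = mvec (C (Suc n)) (?\<phi> n) w a))" if v: "\<forall>a\<in>C n. v a \<in> polys V" for n v
    proof -
      define v' where "v' a = v (inv n a)" for a
      have v': "v' (\<beta> n c) = v c" if "c \<in> C n" for c
        using that by (simp add: v'_def inv)
      have "cycle_vec I C ?\<epsilon> ?\<phi> n v \<longleftrightarrow> cycle_vec I C ?\<epsilon> ?\<phi> n (\<lambda>c. v' (\<beta> n c))"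
        by (rule cycle_vec_cong) (simp add: v')
      also have "\<dots> \<longleftrightarrow> cyc n v'" by (rule cycle)
      also have "\<dots> \<longleftrightarrow> (\<exists>w. (\<forall>b\<in>B (Suc n). w b \<in> polys V) \<and>
          (\<forall>a\<in>B n. v' a = mvec (B (Suc n)) (\<phi> n) w a))"
        using v by (intro exact) (simp add: B v')
      also have "\<dots> \<longleftrightarrow> (\<exists>w. (\<forall>b\<in>C (Suc n). w b \<in> polys V) \<and>
        (\<forall>a\<in>C n. v a = mvec (C (Suc n)) (?\<phi> n) w a))" (is "?L \<longleftrightarrow> ?R")
      proof
        assume ?L
        then obtain w where "\<forall>b\<in>B (Suc n). w b \<in> polys V" "\<forall>a\<in>B n. v' a = mvec (B (Suc n)) (\<phi> n) w a"
          by blast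
        then show ?R
          by (intro exI[of _ "\<lambda>c. w (\<beta> (Suc n) c)"]) (auto simp: mvec B v')
      next
        assume ?R
        then obtain w where w: "\<forall>b\<in>C (Suc n). w b \<in> polys V"
          "\<forall>a\<in>C n. v a = mvec (C (Suc n)) (?\<phi> n) w a" by blast
        have "mvec (C (Suc n)) (?\<phi> n) w a = mvec (B (Suc n)) (\<phi> n) (\<lambda>b. w (inv (Suc n) b)) (\<beta> n a)" for a
          unfolding mvec[symmetric] by (intro mvec_cong) (simp_all add: inv)
        then show ?L
          using w by (intro exI[of _ "\<lambda>b. w (inv (Suc n) b)"]) (auto simp: B v' inv)
      qed
      finally show ?thesis .
    qed
  qed
qed

text \<open>The definition of a resolution compares sets of functions that vanish beyond the rank,
  the locale compares vectors on index sets only. \<open>P\<close> stands for the cycle condition,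
  and truncation by \<open>cut\<close> passes between the two views.\<close>

lemma free_module_exact_iff:
  fixes A :: "nat \<Rightarrow> nat \<Rightarrow> ('v, 'k::comm_ring_1) mpoly"
  assumes A: "\<And>a b. a < m \<Longrightarrow> b < n \<Longrightarrow> A a b \<in> polys V"
    and P: "\<And>f g. (\<And>a. a < m \<Longrightarrow> f a = g a) \<Longrightarrow> P f \<longleftrightarrow> P g"
  shows "{f \<in> free_module V m. P f} = mat_apply m n A ` free_module V n \<longleftrightarrow>
    (\<forall>v. (\<forall>a\<in>{..<m}. v a \<in> polys V) \<longrightarrow> P v \<longleftrightarrow>
      (\<exists>w. (\<forall>b\<in>{..<n}. w b \<in> polys V) \<and> (\<forall>a\<in>{..<m}. v a = mvec {..<n} A w a)))"
    (is "?L = ?R \<longleftrightarrow> _")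
proof -
  define poly where "poly v \<longleftrightarrow> (\<forall>a\<in>{..<m}. v a \<in> polys V)" for v :: "nat \<Rightarrow> ('v, 'k) mpoly"
  define im where "im v \<longleftrightarrow>
    (\<exists>w. (\<forall>b\<in>{..<n}. w b \<in> polys V) \<and> (\<forall>a\<in>{..<m}. v a = mvec {..<n} A w a))" for v
  define cut where "cut v a = (if a < m then v a else 0)" for v :: "nat \<Rightarrow> ('v, 'k) mpoly" and a
  have cut_P: "P (cut f) \<longleftrightarrow> P f" for f
    by (rule P) (simp add: cut_def)
  have cut_im: "im (cut f) \<longleftrightarrow> im f" for f
    by (simp add: im_def cut_def)
  have cut_free: "poly f \<Longrightarrow> cut f \<in> free_module V m" for f
    by (auto simp: poly_def free_module_def cut_def)
  have free_poly: "f \<in> free_module V m \<Longrightarrow> poly f" for f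
    by (auto simp: poly_def free_module_def)
  have R: "f \<in> ?R \<longleftrightarrow> f \<in> free_module V m \<and> im f" for f
  proof
    assume "f \<in> ?R"
    then obtain w where w: "w \<in> free_module V n" "f = mat_apply m n A w" by blast
    then have "f \<in> free_module V m"
      using A by (auto simp: free_module_def mat_apply_def intro!: polys_sum polys_mult)
    moreover have "im f"
      unfolding im_def using w by (intro exI[of _ w]) (auto simp: free_module_def mat_apply_def mvec_def)
    ultimately show "f \<in> free_module V m \<and> im f" ..
  next
    assume f: "f \<in> free_module V m \<and> im f"
    then obtain w where w: "\<forall>b\<in>{..<n}. w b \<in> polys V" "\<forall>a\<in>{..<m}. f a = mvec {..<n} A w a"
      unfolding im_def by blast
    have "f = mat_apply m n A (\<lambda>b. if b < n then w b else 0)"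
    proof
      fix a
      show "f a = mat_apply m n A (\<lambda>b. if b < n then w b else 0) a"
        using f w(2) by (cases "a < m") (auto simp: mat_apply_def mvec_def free_module_def)
    qed
    moreover have "(\<lambda>b. if b < n then w b else 0) \<in> free_module V n"
      using w(1) by (simp add: free_module_def)
    ultimately show "f \<in> ?R" by (rule image_eqI)
  qed
  have "?L = ?R \<longleftrightarrow> (\<forall>f. f \<in> free_module V m \<and> P f \<longleftrightarrow> f \<in> free_module V m \<and> im f)"
    unfolding set_eq_iff R mem_Collect_eq ..
  also have "\<dots> \<longleftrightarrow> (\<forall>v. poly v \<longrightarrow> P v \<longleftrightarrow> im v)"
    using cut_free free_poly cut_P cut_im by blast
  finally show ?thesis by (simp only: poly_def im_def)
qed

lemma minimal_graded_free_resolution_iff: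
  fixes I :: "('v, 'k::comm_ring_1) mpoly set"
  assumes "graded_ideal V I"
  shows "minimal_graded_free_resolution V I r d \<epsilon> \<phi> \<longleftrightarrow>
    graded_resolution V I (\<lambda>n. {..<r n}) d \<epsilon> \<phi> \<and> minimal_maps (\<lambda>n. {..<r n}) \<phi>"
proof -
  let ?B = "\<lambda>n. {..<r n}"
  let ?maps = "\<forall>n. graded_matrix V (?B n) (d n) (?B (Suc n)) (d (Suc n)) (\<phi> n)"
  define ex where "ex n \<longleftrightarrow> (\<forall>v. (\<forall>a\<in>?B n. v a \<in> polys V) \<longrightarrow> cycle_vec I ?B \<epsilon> \<phi> n v \<longleftrightarrow>
      (\<exists>w. (\<forall>b\<in>?B (Suc n). w b \<in> polys V) \<and> (\<forall>a\<in>?B n. v a = mvec (?B (Suc n)) (\<phi> n) w a)))" for n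
  have ex_0: "{f \<in> free_module V (r 0). (\<Sum>a<r 0. \<epsilon> a * f a) \<in> I} =
       mat_apply (r 0) (r 1) (\<phi> 0) ` free_module V (r 1) \<longleftrightarrow> ex 0" if ?maps
    unfolding ex_def cycle_vec_0 One_nat_def
    using that by (intro free_module_exact_iff) (auto simp: graded_matrix_def)
  have ex_Suc: "{f \<in> free_module V (r (Suc i)). mat_apply (r i) (r (Suc i)) (\<phi> i) f = (\<lambda>_. 0)} =
       mat_apply (r (Suc i)) (r (Suc (Suc i))) (\<phi> (Suc i)) ` free_module V (r (Suc (Suc i)))
       \<longleftrightarrow> ex (Suc i)" if ?maps for i
  proof -
    have "mat_apply (r i) (r (Suc i)) (\<phi> i) v = (\<lambda>_. 0) \<longleftrightarrow> cycle_vec I ?B \<epsilon> \<phi> (Suc i) v" for v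
      by (auto simp: cycle_vec_Suc mat_apply_def mvec_def fun_eq_iff)
    then show ?thesis
      unfolding ex_def using that
      by (simp only:) (intro free_module_exact_iff cycle_vec_cong; auto simp: graded_matrix_def)
  qed
  have surj: "(\<exists>f\<in>free_module V (r 0). p - (\<Sum>a<r 0. \<epsilon> a * f a) \<in> I) \<longleftrightarrow>
      (\<exists>v. (\<forall>a\<in>?B 0. v a \<in> polys V) \<and> p - (\<Sum>a\<in>?B 0. \<epsilon> a * v a) \<in> I)" for p
  proof
    assume "\<exists>v. (\<forall>a\<in>?B 0. v a \<in> polys V) \<and> p - (\<Sum>a\<in>?B 0. \<epsilon> a * v a) \<in> I"
    then obtain v where "\<forall>a\<in>?B 0. v a \<in> polys V" "p - (\<Sum>a\<in>?B 0. \<epsilon> a * v a) \<in> I" by blast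
    then show "\<exists>f\<in>free_module V (r 0). p - (\<Sum>a<r 0. \<epsilon> a * f a) \<in> I"
      by (intro bexI[of _ "\<lambda>a. if a < r 0 then v a else 0"]) (auto simp: free_module_def)
  qed (auto simp: free_module_def)
  have all_nat: "(\<forall>n. Q n) \<longleftrightarrow> Q 0 \<and> (\<forall>i. Q (Suc i))" for Q
    by (metis not0_implies_Suc)
  have "minimal_graded_free_resolution V I r d \<epsilon> \<phi> \<longleftrightarrow>
     (\<forall>a\<in>?B 0. \<epsilon> a \<in> polys V \<and> homogeneous (d 0 a) (\<epsilon> a)) \<and> ?maps \<and>
     (\<forall>p\<in>polys V. \<exists>v. (\<forall>a\<in>?B 0. v a \<in> polys V) \<and> p - (\<Sum>a\<in>?B 0. \<epsilon> a * v a) \<in> I) \<and>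
     (\<forall>n. ex n) \<and> minimal_maps ?B \<phi>"
  proof -
    have maps: "(\<forall>i. \<forall>a<r i. \<forall>b<r (Suc i). \<phi> i a b \<in> polys V \<and>
        homogeneous (d (Suc i) b - d i a) (\<phi> i a b)) \<longleftrightarrow> ?maps"
      by (auto simp: graded_matrix_def)
    have min: "(\<forall>i. \<forall>a<r i. \<forall>b<r (Suc i). const_coef (\<phi> i a b) = 0) \<longleftrightarrow> minimal_maps ?B \<phi>"
      by (auto simp: minimal_maps_def const_mat_def)
    have aug: "(\<forall>a<r 0. \<epsilon> a \<in> polys V \<and> homogeneous (d 0 a) (\<epsilon> a)) \<longleftrightarrow>
        (\<forall>a\<in>?B 0. \<epsilon> a \<in> polys V \<and> homogeneous (d 0 a) (\<epsilon> a))" by auto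
    show ?thesis
      unfolding minimal_graded_free_resolution_def surj maps min aug all_nat[of ex]
      using ex_0 ex_Suc by (cases ?maps) (simp_all only: simp_thms conj_assoc)
  qed
  also have "\<dots> \<longleftrightarrow> graded_resolution V I ?B d \<epsilon> \<phi> \<and> minimal_maps ?B \<phi>"
    using assms
    by (auto simp: graded_resolution_def graded_resolution_axioms_def ex_def)
  finally show ?thesis .
qed

section \<open>The Taylor resolution\<close>

text \<open>The exponent vector of the product of the variables in \<open>W\<close>; only finite
  \<open>W\<close> give a finite support, so every fact about it assumes finiteness.\<close>

definition sqfree :: "'v set \<Rightarrow> 'v \<Rightarrow>\<^sub>0 nat" where
  "sqfree W = Poly_Mapping.Abs_poly_mapping (\<lambda>v. if v \<in> W then 1 else 0)"

lemma lookup_sqfree: "finite W \<Longrightarrow> Poly_Mapping.lookup (sqfree W) v = (if v \<in> W then 1 else 0)"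
  by (simp add: sqfree_def)

lemma keys_sqfree: "finite W \<Longrightarrow> Poly_Mapping.keys (sqfree W) = W"
  by (auto simp: in_keys_iff lookup_sqfree split: if_split_asm)

lemma mdeg_sqfree: "finite W \<Longrightarrow> mdeg (sqfree W) = card W"
  by (simp add: mdeg_def keys_sqfree lookup_sqfree)

text \<open>The right-hand side is the least common multiple of the two squarefree monomials, and
  the cofactor \<open>sqfree (U - W)\<close> is what appears in the Taylor differential.\<close>

lemma sqfree_add_diff: "finite U \<Longrightarrow> finite W \<Longrightarrow> sqfree W + sqfree (U - W) = sqfree (U \<union> W)"
  by (auto intro!: poly_mapping_eqI simp: lookup_add lookup_sqfree)

lemma sqfree_dvd:
  assumes "finite W" "W \<subseteq> Poly_Mapping.keys m"
  obtains n where "m = sqfree W + n"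
proof
  show "m = sqfree W + (m - sqfree W)"
    using assms
    by (intro poly_mapping_eqI) (auto simp: lookup_add lookup_minus lookup_sqfree in_keys_iff)
qed

text \<open>Membership is tested on supports of monomials instead of through generators, which suits
  arguments in a single multidegree. For edge ideals both descriptions agree by
  \<open>edge_ideal_eq_monomial_ideal\<close>.\<close>

definition monomial_ideal :: "'v set \<Rightarrow> 'v set set \<Rightarrow> ('v, 'k::comm_ring_1) mpoly set" where
  "monomial_ideal V E = {p \<in> polys V. \<forall>m\<in>Poly_Mapping.keys p. \<exists>e\<in>E. e \<subseteq> Poly_Mapping.keys m}"

lemma graded_ideal_monomial_ideal:
  "graded_ideal V (monomial_ideal V E :: ('v, 'k::comm_ring_1) mpoly set)"
proof
  fix p q :: "('v, 'k) mpoly"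
  show "p + q \<in> monomial_ideal V E" if "p \<in> monomial_ideal V E" "q \<in> monomial_ideal V E"
    using that keys_add[of p q] by (auto simp: monomial_ideal_def intro: polys_add)
  show "p * q \<in> monomial_ideal V E" if p: "p \<in> polys V" and q: "q \<in> monomial_ideal V E"
    unfolding monomial_ideal_def
  proof (intro CollectI conjI ballI)
    show "p * q \<in> polys V"
      using p q by (auto simp: monomial_ideal_def intro: polys_mult)
    fix m assume "m \<in> Poly_Mapping.keys (p * q)"
    then obtain a b where m: "m = a + b" and "b \<in> Poly_Mapping.keys q"
      using keys_mult[of p q] by blast
    then obtain e where "e \<in> E" "e \<subseteq> Poly_Mapping.keys b"
      using q by (auto simp: monomial_ideal_def)
    then show "\<exists>e\<in>E. e \<subseteq> Poly_Mapping.keys m"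
      by (auto simp: m keys_add_nat)
  qed
  show "hcomp e p \<in> monomial_ideal V E" if "p \<in> monomial_ideal V E" for e
    using that keys_hcomp[of e p] by (auto simp: monomial_ideal_def intro: polys_hcomp)
qed (simp add: monomial_ideal_def)

text \<open>The sign with which the face \<open>A\<close> occurs in the boundary of \<open>insert e A\<close>, where \<open>e \<notin> A\<close>.\<close>

definition face_sign :: "('e \<Rightarrow> nat) \<Rightarrow> 'e set \<Rightarrow> 'e \<Rightarrow> 'r::comm_ring_1" where
  "face_sign \<iota> A e = (- 1) ^ card {f \<in> A. \<iota> f < \<iota> e}"

lemma face_sign_square [simp]: "face_sign \<iota> A e * face_sign \<iota> A e = 1"
  by (simp add: face_sign_def flip: power_add)

lemma face_sign_insert:
  assumes "finite A" "f \<notin> A"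
  shows "face_sign \<iota> (insert f A) e = (if \<iota> f < \<iota> e then - face_sign \<iota> A e else face_sign \<iota> A e)"
proof -
  have "{x \<in> insert f A. \<iota> x < \<iota> e} =
      (if \<iota> f < \<iota> e then insert f {x \<in> A. \<iota> x < \<iota> e} else {x \<in> A. \<iota> x < \<iota> e})" by auto
  then show ?thesis using assms by (simp add: face_sign_def)
qed

text \<open>Exactly one of \<open>e\<close> and \<open>f\<close> precedes the other, so exactly one
  of the two insertions flips a sign. The first form serves the cone homotopy, the second the
  vanishing of the squared differential.\<close>

lemma face_sign_swap:
  assumes "finite A" "e \<notin> A" "f \<notin> A" "\<iota> e \<noteq> \<iota> f"
  shows "face_sign \<iota> (insert e A) f * face_sign \<iota> (insert f A) e = - (face_sign \<iota> A e * face_sign \<iota> A f)"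
    and "face_sign \<iota> A e * face_sign \<iota> (insert e A) f = - (face_sign \<iota> A f * face_sign \<iota> (insert f A) e)"
  using assms by (auto simp: face_sign_insert mult.commute)

text \<open>Opposite terms cancel. The diagonal has a hypothesis of its own because in
  characteristic 2 antisymmetry does not make it vanish.\<close>

lemma sum_antisymmetric:
  fixes g :: "'e \<Rightarrow> 'e \<Rightarrow> 'r::comm_ring_1"
  assumes "\<And>x y. x \<in> A \<Longrightarrow> y \<in> A \<Longrightarrow> g x y = - g y x" "\<And>x. x \<in> A \<Longrightarrow> g x x = 0"
  shows "(\<Sum>x\<in>A. \<Sum>y\<in>A. g x y) = 0"
  using assms
proof (induction A rule: infinite_finite_induct)
  case (insert a A)
  have "(\<Sum>x\<in>A. g x a) = - (\<Sum>x\<in>A. g a x)"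
    unfolding sum_negf[symmetric] by (rule sum.cong[OF refl], rule insert.prems(1)) auto
  moreover have "(\<Sum>x\<in>A. \<Sum>y\<in>A. g x y) = 0"
    by (rule insert.IH; rule insert.prems) auto
  moreover have "g a a = 0" by (rule insert.prems(2)) simp
  moreover have "(\<Sum>x\<in>insert a A. \<Sum>y\<in>insert a A. g x y) =
      g a a + (\<Sum>y\<in>A. g a y) + ((\<Sum>x\<in>A. g x a) + (\<Sum>x\<in>A. \<Sum>y\<in>A. g x y))"
    using insert.hyps by (simp add: sum.distrib)
  ultimately show ?case by simp
next
  case (infinite A)
  show ?case using infinite.hyps by simp
next
  case empty
  show ?case by simp
qed

section \<open>The Taylor complex and its exactness\<close>

definition taylor_basis :: "'v set set \<Rightarrow> nat \<Rightarrow> 'v set set set" where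
  "taylor_basis E n = {A. A \<subseteq> E \<and> card A = n}"

definition taylor_deg :: "'v set set \<Rightarrow> int" where
  "taylor_deg A = int (card (\<Union>A))"

text \<open>At most one summand is nonzero, since \<open>A'\<close> and \<open>A\<close> determine
  \<open>e\<close>. In the form of a sum, the entry lets sums over basis elements collapse after
  interchanging the summations.\<close>

definition taylor_map ::
    "('v set \<Rightarrow> nat) \<Rightarrow> 'v set set \<Rightarrow> 'v set set \<Rightarrow> 'v set set \<Rightarrow> ('v, 'k::comm_ring_1) mpoly" where
  "taylor_map \<iota> E A' A =
     (\<Sum>e\<in>E - A'. if A = insert e A' then monom (sqfree (e - \<Union>A')) (face_sign \<iota> A' e) else 0)"

text \<open>\<open>\<iota>\<close> orders the edges for the signs, and \<open>k\<close> carries the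
  coefficient ring as a type.\<close>

locale taylor =
  fixes V :: "'v set" and E :: "'v set set" and \<iota> :: "'v set \<Rightarrow> nat" and k :: "'k::comm_ring_1 itself"
  assumes finite_E: "finite E" and finite_edge: "e \<in> E \<Longrightarrow> finite e" and edge_sub: "e \<in> E \<Longrightarrow> e \<subseteq> V"
    and inj: "inj_on \<iota> E"
begin

abbreviation B where "B \<equiv> taylor_basis E"
abbreviation \<phi> :: "'v set set \<Rightarrow> 'v set set \<Rightarrow> ('v, 'k) mpoly" where "\<phi> \<equiv> taylor_map \<iota> E"
abbreviation sg :: "'v set set \<Rightarrow> 'v set \<Rightarrow> 'k" where "sg \<equiv> face_sign \<iota>"

lemma finite_Union: "A \<subseteq> E \<Longrightarrow> finite (\<Union>A)"
  using finite_E finite_edge by (auto intro: finite_subset)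

lemma finite_faces: "A \<subseteq> E \<Longrightarrow> finite A"
  using finite_E finite_subset by blast

lemma finite_basis: "finite (B n)"
  using finite_E by (simp add: taylor_basis_def)

lemma insert_basis: "A \<in> B n \<Longrightarrow> e \<in> E - A \<Longrightarrow> insert e A \<in> B (Suc n)"
  using finite_faces by (auto simp: taylor_basis_def)

lemma mvec_taylor_map:
  assumes "A \<in> B n"
  shows "mvec (B (Suc n)) \<phi> v A =
    (\<Sum>e\<in>E - A. monom (sqfree (e - \<Union>A)) (sg A e) * v (insert e A))"
proof -
  have "mvec (B (Suc n)) \<phi> v A = (\<Sum>e\<in>E - A. \<Sum>A'\<in>B (Suc n).
      if A' = insert e A then monom (sqfree (e - \<Union>A)) (sg A e) * v A' else 0)"
    unfolding mvec_def taylor_map_def sum_distrib_right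
    by (subst sum.swap) (auto intro!: sum.cong)
  also have "\<dots> = (\<Sum>e\<in>E - A. monom (sqfree (e - \<Union>A)) (sg A e) * v (insert e A))"
    using insert_basis[OF assms] finite_basis by (intro sum.cong) (auto simp: sum.delta)
  finally show ?thesis .
qed

text \<open>Multiplication by the monomial of the basis element \<open>A\<close> converts a
  coordinate to absolute multidegrees: its coefficient at \<open>m\<close> belongs to the strand of
  multidegree \<open>m\<close>.\<close>

definition shift :: "('v set set \<Rightarrow> ('v, 'k) mpoly) \<Rightarrow> 'v set set \<Rightarrow> ('v, 'k) mpoly" where
  "shift v A = monom (sqfree (\<Union>A)) 1 * v A"

text \<open>After homogenising with \<open>shift\<close>, the differential becomes the one of the full simplex on
  \<open>E\<close>, separately in each multidegree.\<close>

lemma coef_shift_mvec: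
  assumes A: "A \<in> B n"
  shows "coef (shift (mvec (B (Suc n)) \<phi> v) A) m =
    (\<Sum>e\<in>E - A. sg A e * coef (shift v (insert e A)) m)"
proof -
  have sub: "A \<subseteq> E" using A by (simp add: taylor_basis_def)
  have "shift (mvec (B (Suc n)) \<phi> v) A = (\<Sum>e\<in>E - A. monom 0 (sg A e) * shift v (insert e A))"
    unfolding shift_def mvec_taylor_map[OF A] sum_distrib_left
  proof (rule sum.cong)
    fix e assume e: "e \<in> E - A"
    have "sqfree (\<Union>A) + sqfree (e - \<Union>A) = sqfree (\<Union>(insert e A))"
      using sqfree_add_diff[of e "\<Union>A"] e finite_edge finite_Union[OF sub] by simp
    then show "monom (sqfree (\<Union>A)) 1 * (monom (sqfree (e - \<Union>A)) (sg A e) * v (insert e A)) =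
        monom 0 (sg A e) * (monom (sqfree (\<Union>(insert e A))) 1 * v (insert e A))"
      by (simp add: mult.assoc[symmetric] mult_single)
  qed simp
  moreover have "coef (monom 0 c * p) m = c * coef p m" for c and p :: "('v, 'k) mpoly"
    using coef_mono_mult[of 0 c p m] by simp
  ultimately show ?thesis by (simp add: lookup_sum)
qed

text \<open>In multidegree \<open>m\<close> only sets of edges inside the support of
  \<open>m\<close> occur, so this strand is the augmented chain complex of a full simplex.\<close>

lemma coef_shift_nonzero:
  assumes "A \<subseteq> E" "coef (shift v A) m \<noteq> 0"
  shows "\<Union>A \<subseteq> Poly_Mapping.keys m"
proof -
  obtain n where "m = sqfree (\<Union>A) + n"
    using assms(2) coef_mono_mult_0[of m "sqfree (\<Union>A)"] unfolding shift_def by blast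
  then show ?thesis using keys_sqfree[OF finite_Union[OF assms(1)]] by (simp add: keys_add_nat)
qed

lemma shift_eq_iff: "shift v A = shift w A \<longleftrightarrow> v A = w A"
  by (auto simp: shift_def dest: mono_mult_cancel)

lemma polys_shift: "A \<subseteq> E \<Longrightarrow> v A \<in> polys V \<Longrightarrow> shift v A \<in> polys V"
  using edge_sub finite_Union[of A] unfolding shift_def
  by (intro polys_mult polys_mono) (auto simp: keys_sqfree)

text \<open>In each multidegree, removing \<open>e\<close> and \<open>f\<close> in either order
  contributes the same coordinate of \<open>w\<close> with opposite signs.\<close>

lemma boundary_boundary:
  assumes A: "A \<in> B n"
  shows "mvec (B (Suc n)) \<phi> (mvec (B (Suc (Suc n))) \<phi> w) A = 0"
proof -
  have sub: "A \<subseteq> E" using A by (simp add: taylor_basis_def)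
  let ?u = "mvec (B (Suc n)) \<phi> (mvec (B (Suc (Suc n))) \<phi> w)"
  have "coef (shift ?u A) m = 0" for m
  proof -
    \<comment> \<open>The value 0 on the diagonal lets both sums run over all of
      \<open>E - A\<close>.\<close>
    define g where "g e f = (if e = f then 0 else
      sg A e * sg (insert e A) f * coef (shift w (insert f (insert e A))) m)" for e f
    have "coef (shift ?u A) m = (\<Sum>e\<in>E - A. sg A e *
        (\<Sum>f\<in>E - insert e A. sg (insert e A) f * coef (shift w (insert f (insert e A))) m))"
      unfolding coef_shift_mvec[OF A] using coef_shift_mvec insert_basis[OF A] by simp
    also have "\<dots> = (\<Sum>e\<in>E - A. \<Sum>f\<in>E - A. g e f)"
    proof (rule sum.cong)
      fix e assume e: "e \<in> E - A"
      have "(\<Sum>f\<in>E - A. g e f) = (\<Sum>f\<in>E - insert e A. g e f)"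
        using finite_E by (intro sum.mono_neutral_right) (auto simp: g_def)
      also have "\<dots> = sg A e * (\<Sum>f\<in>E - insert e A. sg (insert e A) f * coef (shift w (insert f (insert e A))) m)"
        unfolding sum_distrib_left by (intro sum.cong) (auto simp: g_def mult.assoc)
      finally show "sg A e * (\<Sum>f\<in>E - insert e A. sg (insert e A) f * coef (shift w (insert f (insert e A))) m)
          = (\<Sum>f\<in>E - A. g e f)" by simp
    qed simp
    also have "\<dots> = 0"
    proof (rule sum_antisymmetric)
      fix e f assume ef: "e \<in> E - A" "f \<in> E - A"
      show "g e f = - g f e"
      proof (cases "e = f")
        case False
        then have "\<iota> e \<noteq> \<iota> f" using ef inj by (auto dest: inj_onD)
        then have "sg A e * sg (insert e A) f = - (sg A f * sg (insert f A) e)"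
          using ef by (intro face_sign_swap(2) finite_faces[OF sub]) auto
        then show ?thesis
          using False by (simp add: g_def insert_commute)
      qed (simp add: g_def)
    qed (simp add: g_def)
    finally show ?thesis .
  qed
  then have "shift ?u A = shift (\<lambda>_. 0) A"
    by (intro poly_mapping_eqI) (simp add: shift_def)
  then show ?thesis by (simp add: shift_eq_iff)
qed

text \<open>The contracting homotopy in multidegree \<open>m\<close> is the cone with apex a chosen generator
  dividing the monomial of exponent \<open>m\<close>.\<close>

lemma cycle_is_boundary:
  assumes v: "\<forall>A\<in>B n. v A \<in> polys V"
    and cycle: "cycle_vec (monomial_ideal V E) B (\<lambda>_. 1) (\<lambda>_. \<phi>) n v"
  shows "\<exists>w. (\<forall>A\<in>B (Suc n). w A \<in> polys V) \<and> (\<forall>A\<in>B n. v A = mvec (B (Suc n)) \<phi> w A)"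
proof -
  define has where "has m \<longleftrightarrow> (\<exists>e\<in>E. e \<subseteq> Poly_Mapping.keys m)" for m :: "'v \<Rightarrow>\<^sub>0 nat"
  define apex where "apex m = (SOME e. e \<in> E \<and> e \<subseteq> Poly_Mapping.keys m)" for m :: "'v \<Rightarrow>\<^sub>0 nat"
  have apex: "apex m \<in> E" "apex m \<subseteq> Poly_Mapping.keys m" if "has m" for m
    using that someI_ex[of "\<lambda>e. e \<in> E \<and> e \<subseteq> Poly_Mapping.keys m"]
    unfolding has_def apex_def by blast+
  \<comment> \<open>In multidegree \<open>m\<close> the cone takes, up to sign, coordinate
    \<open>A - {apex m}\<close> of \<open>v\<close> as coordinate \<open>A\<close>, and 0 if the
    apex is not in \<open>A\<close>.\<close>
  define W where "W A m = (if has m \<and> apex m \<in> A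
      then sg (A - {apex m}) (apex m) * coef (shift v (A - {apex m})) m else 0)" for A m
  \<comment> \<open>The shift is undone: the coefficient of \<open>w A\<close> at \<open>m\<close>
    sits in multidegree \<open>sqfree (\<Union>A) + m\<close>.\<close>
  define w where "w A = Poly_Mapping.Abs_poly_mapping (\<lambda>m. W A (sqfree (\<Union>A) + m))" for A
  have W_nonzero: "has m \<and> apex m \<in> A \<and> coef (shift v (A - {apex m})) m \<noteq> 0" if "W A m \<noteq> 0" for A m
    using that by (auto simp: W_def split: if_split_asm)
  have W_Union: "\<Union>A \<subseteq> Poly_Mapping.keys m" if "A \<subseteq> E" "W A m \<noteq> 0" for A m
  proof -
    have "\<Union>(A - {apex m}) \<subseteq> Poly_Mapping.keys m"
      using W_nonzero[OF that(2)] that(1) by (intro coef_shift_nonzero[of _ v]) auto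
    then show ?thesis using apex W_nonzero[OF that(2)] by blast
  qed
  have "finite {m. W A m \<noteq> 0}" if "A \<subseteq> E" for A
  proof (rule finite_subset)
    show "{m. W A m \<noteq> 0} \<subseteq> (\<Union>e\<in>E. Poly_Mapping.keys (shift v (A - {e})))"
    proof
      fix m assume "m \<in> {m. W A m \<noteq> 0}"
      then have "has m \<and> coef (shift v (A - {apex m})) m \<noteq> 0" using W_nonzero by blast
      then show "m \<in> (\<Union>e\<in>E. Poly_Mapping.keys (shift v (A - {e})))"
        using apex(1)[of m] by (auto simp: in_keys_iff)
    qed
  qed (simp add: finite_E)
  then have "finite ((\<lambda>m. sqfree (\<Union>A) + m) -` {m. W A m \<noteq> 0})" if "A \<subseteq> E" for A
    using that by (intro finite_vimageI) (auto simp: inj_on_def)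
  then have coef_w: "coef (w A) m = W A (sqfree (\<Union>A) + m)" if "A \<subseteq> E" for A m
    using that by (simp add: w_def vimage_def)
  have coef_shift_w: "coef (shift w A) m = W A m" if A: "A \<subseteq> E" for A m
  proof (cases "\<Union>A \<subseteq> Poly_Mapping.keys m")
    case True
    then obtain m' where "m = sqfree (\<Union>A) + m'"
      using sqfree_dvd finite_Union[OF A] by blast
    then show ?thesis using A by (simp add: shift_def coef_mono_mult coef_w)
  next
    case False
    then show ?thesis using W_Union[OF A] coef_shift_nonzero[OF A] by metis
  qed
  have w_polys: "w A \<in> polys V" if "A \<in> B (Suc n)" for A
  proof -
    have A: "A \<subseteq> E" "card A = Suc n" using that by (auto simp: taylor_basis_def)
    have "Poly_Mapping.keys m \<subseteq> V" if m: "m \<in> Poly_Mapping.keys (w A)" for m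
    proof -
      let ?m = "sqfree (\<Union>A) + m"
      have W: "W A ?m \<noteq> 0" using m coef_w[OF A(1)] by (simp add: in_keys_iff)
      have "A - {apex ?m} \<in> B n"
        using W_nonzero[OF W] A finite_faces[OF A(1)] by (auto simp: taylor_basis_def)
      then have "shift v (A - {apex ?m}) \<in> polys V"
        using v A by (intro polys_shift) auto
      then have "Poly_Mapping.keys ?m \<subseteq> V"
        using W_nonzero[OF W] by (auto simp: polys_def in_keys_iff)
      then show ?thesis by (simp add: keys_add_nat)
    qed
    then show ?thesis by (auto simp: polys_def)
  qed
  have "v A = mvec (B (Suc n)) \<phi> w A" if A: "A \<in> B n" for A
  proof -
    have sub: "A \<subseteq> E" and card: "card A = n" using A by (auto simp: taylor_basis_def)
    have "coef (shift v A) m = coef (shift (mvec (B (Suc n)) \<phi> w) A) m" for m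
    proof -
      have sum_W: "coef (shift (mvec (B (Suc n)) \<phi> w) A) m = (\<Sum>e\<in>E - A. sg A e * W (insert e A) m)"
        unfolding coef_shift_mvec[OF A] using sub by (intro sum.cong) (auto simp: coef_shift_w)
      show ?thesis
      proof (cases "has m")
        \<comment> \<open>If no edge divides the monomial, only the empty set of edges could have a
          coefficient here. It occurs in position 0, where being a cycle means membership in the
          ideal, and this excludes such \<open>m\<close>.\<close>
        case False
        have "coef (shift v A) m = 0"
        proof (rule ccontr)
          assume nz: "coef (shift v A) m \<noteq> 0"
          show False
          proof (cases n)
            case 0
            then have "A = {}" using card finite_faces[OF sub] by simp
            moreover have "B 0 = {{}}" by (auto simp: taylor_basis_def dest: finite_faces)
            moreover have "sqfree {} = (0 :: 'v \<Rightarrow>\<^sub>0 nat)"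
              by (intro poly_mapping_eqI) (simp add: lookup_sqfree)
            ultimately have "v {} \<in> monomial_ideal V E" "coef (v {}) m \<noteq> 0"
              using cycle nz 0 by (simp_all add: cycle_vec_0 shift_def)
            then show False using False by (auto simp: monomial_ideal_def has_def in_keys_iff)
          next
            case (Suc k)
            then obtain e where "e \<in> A" using card by fastforce
            then have "e \<in> E" "e \<subseteq> Poly_Mapping.keys m"
              using coef_shift_nonzero[OF sub nz] sub by blast+
            then show False using False unfolding has_def by blast
          qed
        qed
        then show ?thesis unfolding sum_W using False by (simp add: W_def)
      next
        case True
        let ?e = "apex m"
        show ?thesis
        proof (cases "?e \<in> A")
          case False
          \<comment> \<open>Only the summand of the apex survives, and its two equal signs
            cancel.\<close>
          have "(\<Sum>e\<in>E - A. sg A e * W (insert e A) m) =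
              (\<Sum>e\<in>E - A. if e = ?e then coef (shift v A) m else 0)"
          proof (rule sum.cong)
            fix e assume "e \<in> E - A"
            moreover from this have "insert e A - {e} = A" by auto
            ultimately show "sg A e * W (insert e A) m = (if e = ?e then coef (shift v A) m else 0)"
              using False True by (auto simp: W_def mult.assoc[symmetric])
          qed simp
          then show ?thesis
            unfolding sum_W using False apex(1)[OF True] finite_E by (simp add: sum.delta)
        next
          case e: True
          let ?A = "A - {?e}"
          obtain k where n: "n = Suc k"
            using card e finite_faces[OF sub] by (cases n) auto
          have A': "?A \<in> B k" "insert ?e ?A = A"
            using sub card e n finite_faces[OF sub] by (auto simp: taylor_basis_def)
          \<comment> \<open>The cycle condition at \<open>A\<close> without the apex expresses
            coordinate \<open>A\<close> of \<open>v\<close> through exactly those coordinates which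
            the cone uses.\<close>
          have "coef (shift (mvec (B (Suc k)) \<phi> v) ?A) m = 0"
            using cycle A' n by (simp add: cycle_vec_Suc shift_def)
          then have "(\<Sum>f\<in>E - ?A. sg ?A f * coef (shift v (insert f ?A)) m) = 0"
            using coef_shift_mvec[OF A'(1)] by simp
          also have "E - ?A = insert ?e (E - A)" using apex(1)[OF True] by auto
          finally have *: "(\<Sum>f\<in>E - A. sg ?A f * coef (shift v (insert f ?A)) m) =
              - (sg ?A ?e * coef (shift v A) m)"
            using e finite_E A'(2) by (simp add: eq_neg_iff_add_eq_0 add.commute)
          have "(\<Sum>f\<in>E - A. sg A f * W (insert f A) m) =
              (\<Sum>f\<in>E - A. - sg ?A ?e * (sg ?A f * coef (shift v (insert f ?A)) m))"
          proof (rule sum.cong)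
            fix f assume f: "f \<in> E - A"
            have "\<iota> f \<noteq> \<iota> ?e" using f e inj sub apex(1)[OF True] by (auto dest: inj_onD)
            then have "sg A f * sg (insert f ?A) ?e = - (sg ?A f * sg ?A ?e)"
              using face_sign_swap(1)[of ?A ?e f \<iota>] f finite_faces[OF sub] A'(2)
              by (simp add: mult.commute)
            moreover have "insert f A - {?e} = insert f ?A" using f e by auto
            ultimately show "sg A f * W (insert f A) m =
                - sg ?A ?e * (sg ?A f * coef (shift v (insert f ?A)) m)"
              using e True by (simp add: W_def mult.assoc[symmetric])
          qed simp
          also have "\<dots> = - sg ?A ?e * (\<Sum>f\<in>E - A. sg ?A f * coef (shift v (insert f ?A)) m)"
            by (rule sum_distrib_left[symmetric])
          also have "\<dots> = coef (shift v A) m"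
            unfolding * by (simp add: mult.assoc[symmetric])
          finally show ?thesis unfolding sum_W by simp
        qed
      qed
    qed
    then have "shift v A = shift (mvec (B (Suc n)) \<phi> w) A" by (rule poly_mapping_eqI)
    then show ?thesis by (simp add: shift_eq_iff)
  qed
  then show ?thesis using w_polys by blast
qed

lemma generator_mult_in_ideal:
  assumes "e \<in> E" "p \<in> polys V"
  shows "monom (sqfree e) c * p \<in> monomial_ideal V E"
proof -
  have "monom (sqfree e) c \<in> monomial_ideal V E"
    using assms finite_edge
    by (auto simp: monomial_ideal_def keys_sqfree intro!: polys_mono intro: edge_sub[THEN subsetD])
  from graded_ideal.ideal_mult[OF graded_ideal_monomial_ideal assms(2) this] show ?thesis
    by (simp only: mult.commute)
qed

lemma basis_0: "B 0 = {{}}"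
  by (auto simp: taylor_basis_def dest: finite_faces)

lemma taylor_resolution:
  "graded_resolution V (monomial_ideal V E :: ('v, 'k) mpoly set) B (\<lambda>_. taylor_deg) (\<lambda>_. 1) (\<lambda>_. \<phi>)"
proof -
  interpret graded_ideal V "monomial_ideal V E :: ('v, 'k) mpoly set"
    by (rule graded_ideal_monomial_ideal)
  show ?thesis
  proof
    show "finite (B n)" for n by (rule finite_basis)
    show "1 \<in> polys V \<and> homogeneous (taylor_deg a) (1 :: ('v, 'k) mpoly)" if "a \<in> B 0" for a
      using that by (simp add: basis_0 taylor_deg_def homogeneous_1)
    show "graded_matrix V (B n) taylor_deg (B (Suc n)) taylor_deg \<phi>" for n
      unfolding graded_matrix_def
    proof (intro ballI conjI)
      fix A' A assume A': "A' \<in> B n" and A: "A \<in> B (Suc n)"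
      have sub: "A' \<subseteq> E" using A' by (simp add: taylor_basis_def)
      show "\<phi> A' A \<in> polys V"
        unfolding taylor_map_def using finite_edge
        by (intro polys_sum) (auto simp: keys_sqfree intro!: polys_mono intro: edge_sub[THEN subsetD])
      show "homogeneous (taylor_deg A - taylor_deg A') (\<phi> A' A)"
        unfolding taylor_map_def
      proof (intro homogeneous_sum)
        fix e assume e: "e \<in> E - A'"
        have "\<Union>(insert e A') = (e - \<Union>A') \<union> \<Union>A'" by auto
        then have "card (\<Union>(insert e A')) = card ((e - \<Union>A') \<union> \<Union>A')" by simp
        also have "\<dots> = card (e - \<Union>A') + card (\<Union>A')"
          using finite_edge e finite_Union[OF sub] by (intro card_Un_disjoint) auto
        finally have "card (\<Union>(insert e A')) = card (e - \<Union>A') + card (\<Union>A')" .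
        then show "homogeneous (taylor_deg A - taylor_deg A')
            (if A = insert e A' then monom (sqfree (e - \<Union>A')) (sg A' e) else 0)"
          using e finite_edge by (auto simp: homogeneous_def taylor_deg_def mdeg_sqfree)
      qed
    qed
    show "\<exists>v. (\<forall>a\<in>B 0. v a \<in> polys V) \<and> p - (\<Sum>a\<in>B 0. 1 * v a) \<in> monomial_ideal V E"
      if "p \<in> polys V" for p :: "('v, 'k) mpoly"
      using that ideal_0 by (intro exI[of _ "\<lambda>_. p"]) (simp add: basis_0)
    fix n and v :: "'v set set \<Rightarrow> ('v, 'k) mpoly"
    assume v: "\<forall>A\<in>B n. v A \<in> polys V"
    show "cycle_vec (monomial_ideal V E) B (\<lambda>_. 1) (\<lambda>_. \<phi>) n v \<longleftrightarrow>
        (\<exists>w. (\<forall>b\<in>B (Suc n). w b \<in> polys V) \<and> (\<forall>a\<in>B n. v a = mvec (B (Suc n)) \<phi> w a))"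
    proof
      assume "\<exists>w. (\<forall>b\<in>B (Suc n). w b \<in> polys V) \<and> (\<forall>a\<in>B n. v a = mvec (B (Suc n)) \<phi> w a)"
      then obtain w where w: "\<forall>b\<in>B (Suc n). w b \<in> polys V"
        and vw: "\<forall>a\<in>B n. v a = mvec (B (Suc n)) \<phi> w a" by blast
      show "cycle_vec (monomial_ideal V E) B (\<lambda>_. 1) (\<lambda>_. \<phi>) n v"
      proof (cases n)
        case 0
        have "v {} = (\<Sum>e\<in>E. monom (sqfree e) (sg {} e) * w {e})"
          using vw mvec_taylor_map[of "{}" 0 w] 0 by (simp add: basis_0)
        also have "\<dots> \<in> monomial_ideal V E"
          using w 0 by (intro ideal_sum generator_mult_in_ideal) (auto simp: taylor_basis_def)
        finally show ?thesis using 0 by (simp add: cycle_vec_0 basis_0)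
      next
        case (Suc k)
        have "mvec (B (Suc k)) \<phi> v A = 0" if "A \<in> B k" for A
          using boundary_boundary[OF that, of w] vw Suc
          by (metis (no_types, lifting) mvec_cong)
        then show ?thesis using Suc by (simp add: cycle_vec_Suc)
      qed
    qed (rule cycle_is_boundary[OF v])
  qed
qed

end

section \<open>Betti numbers and regularity of edge ideals\<close>

text \<open>The combinatorial form of \<^const>\<open>homology_witness\<close> for the Taylor resolution: modulo the
  variables, only those faces survive which have the same union.\<close>

definition taylor_witness ::
    "'v set set \<Rightarrow> ('v set \<Rightarrow> nat) \<Rightarrow> nat \<Rightarrow> nat \<Rightarrow> ('v set set \<Rightarrow> 'k::comm_ring_1) \<Rightarrow>
      ('v set set \<Rightarrow> 'k) \<Rightarrow> bool" where
  "taylor_witness E \<iota> i j z w \<longleftrightarrow>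
     (\<forall>A. z A \<noteq> 0 \<longrightarrow> A \<subseteq> E \<and> card A = i \<and> card (\<Union>A) = j) \<and>
     (\<forall>A. w A \<noteq> 0 \<longrightarrow> A \<subseteq> E \<and> card A = i) \<and>
     (\<forall>A\<subseteq>E. (\<Sum>e | e \<in> E - A \<and> e \<subseteq> \<Union>A. face_sign \<iota> A e * z (insert e A)) = 0) \<and>
     (\<forall>A\<subseteq>E. (\<Sum>e | e \<in> A \<and> e \<subseteq> \<Union>(A - {e}). face_sign \<iota> (A - {e}) e * w (A - {e})) = 0) \<and>
     (\<Sum>A\<in>Pow E. w A * z A) \<noteq> 0"

lemma taylor_witnessD:
  assumes "taylor_witness E \<iota> i j z w"
  shows "z A \<noteq> 0 \<Longrightarrow> A \<subseteq> E \<and> card A = i \<and> card (\<Union>A) = j"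
    and "w A \<noteq> 0 \<Longrightarrow> A \<subseteq> E \<and> card A = i"
    and "A \<subseteq> E \<Longrightarrow> (\<Sum>e | e \<in> E - A \<and> e \<subseteq> \<Union>A. face_sign \<iota> A e * z (insert e A)) = 0"
    and "A \<subseteq> E \<Longrightarrow>
      (\<Sum>e | e \<in> A \<and> e \<subseteq> \<Union>(A - {e}). face_sign \<iota> (A - {e}) e * w (A - {e})) = 0"
    and "(\<Sum>A\<in>Pow E. w A * z A) \<noteq> 0"
  using assms by (simp_all only: taylor_witness_def simp_thms)

context taylor
begin

lemma const_taylor_map:
  assumes "A \<subseteq> E"
  shows "const_mat \<phi> A' A = (\<Sum>e | e \<in> E - A' \<and> A = insert e A' \<and> e \<subseteq> \<Union>A'. sg A' e)"
proof -
  have "const_coef (if A = insert e A' then monom (sqfree (e - \<Union>A')) (sg A' e) else 0) =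
      (if A = insert e A' \<and> e \<subseteq> \<Union>A' then sg A' e else 0)" if "e \<in> E - A'" for e
  proof -
    have "sqfree (e - \<Union>A') = 0 \<longleftrightarrow> e - \<Union>A' = {}"
      using keys_sqfree[of "e - \<Union>A'"] finite_edge that by (metis DiffD1 finite_Diff keys_eq_empty)
    then show ?thesis by (auto simp: lookup_single when_def)
  qed
  then have "const_mat \<phi> A' A = (\<Sum>e\<in>E - A'. if A = insert e A' \<and> e \<subseteq> \<Union>A' then sg A' e else 0)"
    unfolding const_mat_def taylor_map_def const_coef_sum by (intro sum.cong) auto
  also have "\<dots> = (\<Sum>e | e \<in> E - A' \<and> A = insert e A' \<and> e \<subseteq> \<Union>A'. sg A' e)"
    using finite_E by (simp only: sum.inter_filter finite_Diff)
  finally show ?thesis .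
qed

lemma sum_boundary:
  assumes A: "A \<in> B n"
  shows "(\<Sum>A'\<in>B (Suc n). const_mat \<phi> A A' * z A') =
    (\<Sum>e | e \<in> E - A \<and> e \<subseteq> \<Union>A. sg A e * z (insert e A))"
proof -
  let ?S = "{e \<in> E - A. e \<subseteq> \<Union>A}"
  have fin: "finite ?S" using finite_E by auto
  have "(\<Sum>A'\<in>B (Suc n). const_mat \<phi> A A' * z A') =
      (\<Sum>A'\<in>B (Suc n). \<Sum>e\<in>?S. if A' = insert e A then sg A e * z A' else 0)"
  proof (rule sum.cong)
    fix A' assume "A' \<in> B (Suc n)"
    then have "const_mat \<phi> A A' = (\<Sum>e\<in>?S. if A' = insert e A then sg A e else 0)"
      using fin by (subst const_taylor_map)
        (auto simp: taylor_basis_def sum.inter_filter[symmetric] intro!: sum.cong)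
    then show "const_mat \<phi> A A' * z A' = (\<Sum>e\<in>?S. if A' = insert e A then sg A e * z A' else 0)"
      by (simp only: sum_distrib_right) (intro sum.cong; simp)
  qed simp
  also have "\<dots> = (\<Sum>e\<in>?S. sg A e * z (insert e A))"
    using insert_basis[OF A] finite_basis by (subst sum.swap) (intro sum.cong; simp add: sum.delta)
  finally show ?thesis .
qed

lemma sum_coboundary:
  assumes A: "A \<in> B (Suc n)"
  shows "(\<Sum>A'\<in>B n. w A' * const_mat \<phi> A' A) =
    (\<Sum>e | e \<in> A \<and> e \<subseteq> \<Union>(A - {e}). sg (A - {e}) e * w (A - {e}))"
proof -
  have sub: "A \<subseteq> E" and card: "card A = Suc n" using A by (auto simp: taylor_basis_def)
  let ?S = "{e \<in> A. e \<subseteq> \<Union>(A - {e})}"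
  have fin: "finite ?S" using finite_faces[OF sub] by auto
  have "(\<Sum>A'\<in>B n. w A' * const_mat \<phi> A' A) =
      (\<Sum>A'\<in>B n. \<Sum>e\<in>?S. if A' = A - {e} then sg A' e * w A' else 0)"
  proof (rule sum.cong)
    fix A' assume A': "A' \<in> B n"
    have "{e \<in> E - A'. A = insert e A' \<and> e \<subseteq> \<Union>A'} = {e \<in> ?S. A' = A - {e}}"
      using sub by auto
    then have "const_mat \<phi> A' A = (\<Sum>e\<in>?S. if A' = A - {e} then sg A' e else 0)"
      using fin sub by (simp add: const_taylor_map sum.inter_filter[symmetric])
    then show "w A' * const_mat \<phi> A' A = (\<Sum>e\<in>?S. if A' = A - {e} then sg A' e * w A' else 0)"
      by (simp only: sum_distrib_left) (intro sum.cong; simp add: mult.commute)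
  qed simp
  also have "\<dots> = (\<Sum>e\<in>?S. sg (A - {e}) e * w (A - {e}))"
  proof (subst sum.swap, rule sum.cong)
    fix e assume "e \<in> ?S"
    then have "A - {e} \<in> B n"
      using sub card finite_faces[OF sub] by (auto simp: taylor_basis_def)
    then show "(\<Sum>A'\<in>B n. if A' = A - {e} then sg A' e * w A' else 0) = sg (A - {e}) e * w (A - {e})"
      using finite_basis by (simp add: sum.delta)
  qed simp
  finally show ?thesis .
qed

text \<open>\<open>homology_witness\<close> constrains vectors on one basis,
  \<open>taylor_witness\<close> on all sets of edges. Once the vectors are 0 outside that basis,
  sets of the wrong size contribute only zero terms.\<close>

lemma homology_witness_iff:
  "(\<exists>z w. homology_witness B (\<lambda>_. taylor_deg) (\<lambda>_. const_mat \<phi>) i j z w) \<longleftrightarrow>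
   (\<exists>j' z w. j = int j' \<and> taylor_witness E \<iota> i j' z (w :: 'v set set \<Rightarrow> 'k))"
proof
  assume "\<exists>z w. homology_witness B (\<lambda>_. taylor_deg) (\<lambda>_. const_mat \<phi>) i j z w"
  then obtain z w where hw: "homology_witness B (\<lambda>_. taylor_deg) (\<lambda>_. const_mat \<phi>) i j z w"
    by blast
  have z_deg: "taylor_deg A = j" if "A \<in> B i" "z A \<noteq> 0" for A
    using hw that by (simp add: homology_witness_def)
  have z_cycle: "(\<Sum>A'\<in>B i. const_mat \<phi> A A' * z A') = 0" if "i = Suc k" "A \<in> B k" for k A
    using hw that by (simp add: homology_witness_def)
  have w_cocycle: "(\<Sum>A'\<in>B i. w A' * const_mat \<phi> A' A) = 0" if "A \<in> B (Suc i)" for A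
    using hw that by (simp add: homology_witness_def)
  define z' where "z' A = (if A \<in> B i then z A else 0)" for A
  define w' where "w' A = (if A \<in> B i then w A else 0)" for A
  have pairing: "(\<Sum>A\<in>B i. w A * z A) \<noteq> 0" using hw by (simp add: homology_witness_def)
  \<comment> \<open>A nonzero pairing has a nonzero summand, and its index shows that the integer
    \<open>j\<close> is a cardinality.\<close>
  then obtain A0 where "A0 \<in> B i" "w A0 * z A0 \<noteq> 0"
    by (rule sum.not_neutral_contains_not_neutral)
  then have j: "j = int (card (\<Union>A0))"
    using z_deg[of A0] by (simp add: taylor_deg_def) fastforce
  have "taylor_witness E \<iota> i (card (\<Union>A0)) z' w'"
    unfolding taylor_witness_def
  proof (intro conjI allI impI)
    fix A
    show "A \<subseteq> E" "card A = i" "card (\<Union>A) = card (\<Union>A0)" if "z' A \<noteq> 0"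
      using that z_deg[of A] j
      by (auto simp: z'_def taylor_basis_def taylor_deg_def split: if_split_asm)
    show "A \<subseteq> E" "card A = i" if "w' A \<noteq> 0"
      using that by (auto simp: w'_def taylor_basis_def split: if_split_asm)
  next
    fix A assume sub: "A \<subseteq> E"
    show "(\<Sum>e | e \<in> E - A \<and> e \<subseteq> \<Union>A. sg A e * z' (insert e A)) = 0"
    proof (cases "i = Suc (card A)")
      case True
      have A: "A \<in> B (card A)" using sub by (simp add: taylor_basis_def)
      have "(\<Sum>e | e \<in> E - A \<and> e \<subseteq> \<Union>A. sg A e * z' (insert e A)) =
          (\<Sum>e | e \<in> E - A \<and> e \<subseteq> \<Union>A. sg A e * z (insert e A))"
        using insert_basis[OF A] True by (intro sum.cong) (auto simp: z'_def)
      also have "\<dots> = (\<Sum>A'\<in>B i. const_mat \<phi> A A' * z A')"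
        using sum_boundary[OF A] True by simp
      also have "\<dots> = 0" using A True by (intro z_cycle)
      finally show ?thesis .
    next
      case False
      then have "z' (insert e A) = 0" if "e \<in> E - A" for e
        using that finite_faces[OF sub] by (auto simp: z'_def taylor_basis_def)
      then show ?thesis by (intro sum.neutral) auto
    qed
    show "(\<Sum>e | e \<in> A \<and> e \<subseteq> \<Union>(A - {e}). sg (A - {e}) e * w' (A - {e})) = 0"
    proof (cases "card A = Suc i")
      case True
      have A: "A \<in> B (Suc i)" using sub True by (simp add: taylor_basis_def)
      have "(\<Sum>e | e \<in> A \<and> e \<subseteq> \<Union>(A - {e}). sg (A - {e}) e * w' (A - {e})) =
          (\<Sum>e | e \<in> A \<and> e \<subseteq> \<Union>(A - {e}). sg (A - {e}) e * w (A - {e}))"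
        using True sub finite_faces[OF sub] by (intro sum.cong) (auto simp: w'_def taylor_basis_def)
      also have "\<dots> = 0"
        unfolding sum_coboundary[OF A, symmetric] by (rule w_cocycle[OF A])
      finally show ?thesis .
    next
      case False
      then have "w' (A - {e}) = 0" if "e \<in> A" for e
        using that finite_faces[OF sub] card_Suc_Diff1[of A e] by (auto simp: w'_def taylor_basis_def)
      then show ?thesis by (intro sum.neutral) auto
    qed
  next
    have "(\<Sum>A\<in>Pow E. w' A * z' A) = (\<Sum>A\<in>B i. w A * z A)"
      using finite_E by (intro sum.mono_neutral_cong_right)
        (auto simp: w'_def z'_def taylor_basis_def)
    then show "(\<Sum>A\<in>Pow E. w' A * z' A) \<noteq> 0" using pairing by simp
  qed
  then show "\<exists>j' z w. j = int j' \<and> taylor_witness E \<iota> i j' z (w :: 'v set set \<Rightarrow> 'k)"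
    using j by blast
next
  assume "\<exists>j' z w. j = int j' \<and> taylor_witness E \<iota> i j' z (w :: 'v set set \<Rightarrow> 'k)"
  then obtain j' z and w :: "'v set set \<Rightarrow> 'k" where j: "j = int j'" and tw: "taylor_witness E \<iota> i j' z w"
    by blast
  note z_supp = taylor_witnessD(1)[OF tw] and cycle = taylor_witnessD(3)[OF tw]
    and cocycle = taylor_witnessD(4)[OF tw] and pairing = taylor_witnessD(5)[OF tw]
  have "homology_witness B (\<lambda>_. taylor_deg) (\<lambda>_. const_mat \<phi>) i j z w"
    unfolding homology_witness_def
  proof (intro conjI ballI allI impI)
    show "taylor_deg A = j" if "z A \<noteq> 0" for A
      using z_supp[OF that] j by (simp add: taylor_deg_def)
    show "(\<Sum>A'\<in>B i. const_mat \<phi> A A' * z A') = 0" if "i = Suc k" "A \<in> B k" for k A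
      unfolding that(1) sum_boundary[OF that(2)] using that(2) by (intro cycle) (simp add: taylor_basis_def)
    show "(\<Sum>A'\<in>B i. w A' * const_mat \<phi> A' A) = 0" if "A \<in> B (Suc i)" for A
      unfolding sum_coboundary[OF that] using that by (intro cocycle) (simp add: taylor_basis_def)
    have "z A = 0" if "A \<notin> B i" for A
      using z_supp[of A] that by (auto simp: taylor_basis_def)
    then have "(\<Sum>A\<in>B i. w A * z A) = (\<Sum>A\<in>Pow E. w A * z A)"
      using finite_E by (intro sum.mono_neutral_left) (auto simp: taylor_basis_def)
    then show "(\<Sum>A\<in>B i. w A * z A) \<noteq> 0" using pairing by simp
  qed
  then show "\<exists>z w. homology_witness B (\<lambda>_. taylor_deg) (\<lambda>_. const_mat \<phi>) i j z w" by blast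
qed

end

text \<open>Cancelling units in the Taylor resolution and numbering the bases gives one resolution
  as in the definition, and uniqueness of the ranks evaluates \<open>betti\<close> on it. Comparison
  with the Taylor resolution in both directions relates its basis elements to homology.\<close>

lemma taylor_betti_nonzero_iff:
  fixes k :: "'k::field itself" and V :: "'v set"
  assumes "taylor V E \<iota>"
  shows "betti V (monomial_ideal V E :: ('v, 'k) mpoly set) i j \<noteq> 0 \<longleftrightarrow>
    (\<exists>j' z w. j = int j' \<and> taylor_witness E \<iota> i j' z (w :: 'v set set \<Rightarrow> 'k))"
proof -
  interpret taylor V E \<iota> k by fact
  let ?I = "monomial_ideal V E :: ('v, 'k) mpoly set"
  have iff: "minimal_graded_free_resolution V ?I r d \<epsilon> \<phi> \<longleftrightarrow>
      graded_resolution V ?I (\<lambda>n. {..<r n}) d \<epsilon> \<phi> \<and> minimal_maps (\<lambda>n. {..<r n}) \<phi>" for r d \<epsilon> \<phi>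
    by (rule minimal_graded_free_resolution_iff[OF graded_ideal_monomial_ideal])
  have empty: "B n = {}" if "n \<ge> Suc (card E)" for n
  proof -
    have "card A \<noteq> n" if "A \<subseteq> E" for A
      using card_mono[OF finite_E that] \<open>n \<ge> Suc (card E)\<close> by simp
    then show ?thesis by (auto simp: taylor_basis_def)
  qed
  have "\<exists>(B' :: nat \<Rightarrow> 'v set set set) \<phi>'. graded_resolution V ?I B' (\<lambda>_. taylor_deg) (\<lambda>_. 1) \<phi>' \<and> minimal_maps B' \<phi>'"
    by (rule minimal_resolution_exists[OF taylor_resolution]) (rule empty)
  then obtain B' :: "nat \<Rightarrow> 'v set set set" and \<phi>'
    where B': "graded_resolution V ?I B' (\<lambda>_. taylor_deg) (\<lambda>_. 1) \<phi>'" and min': "minimal_maps B' \<phi>'"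
    by blast
  have "\<exists>\<beta>. bij_betw \<beta> {..<card (B' n)} (B' n)" for n
    using ex_bij_betw_nat_finite[OF graded_resolution.finite_basis[OF B']]
    by (simp add: lessThan_atLeast0)
  then obtain \<beta> where \<beta>: "\<And>n. bij_betw (\<beta> n) {..<card (B' n)} (B' n)" by metis
  define r where "r n = card (B' n)" for n
  define d where "d n c = taylor_deg (\<beta> n c)" for n c
  define \<psi> where "\<psi> n c c' = \<phi>' n (\<beta> n c) (\<beta> (Suc n) c')" for n c c'
  have res: "graded_resolution V ?I (\<lambda>n. {..<r n}) d (\<lambda>_. 1) \<psi>"
    unfolding r_def d_def[abs_def] \<psi>_def[abs_def] by (rule graded_resolution.reindex[OF B' \<beta>])
  have min: "minimal_maps (\<lambda>n. {..<r n}) \<psi>"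
    using min' \<beta> unfolding minimal_maps_def r_def \<psi>_def const_mat_def
    by (meson bij_betwE)
  have "betti V ?I i j = card {a. a < r i \<and> d i a = j}"
    unfolding betti_def
  proof (rule the_equality)
    show "\<exists>r' d' \<epsilon>' \<phi>'. minimal_graded_free_resolution V ?I r' d' \<epsilon>' \<phi>' \<and>
        card {a. a < r i \<and> d i a = j} = card {a. a < r' i \<and> d' i a = j}"
      using res min iff by blast
  next
    fix n assume "\<exists>r' d' \<epsilon>' \<phi>'. minimal_graded_free_resolution V ?I r' d' \<epsilon>' \<phi>' \<and>
        n = card {a. a < r' i \<and> d' i a = j}"
    then obtain r' d' \<epsilon>' \<phi>' where
      "minimal_graded_free_resolution V ?I r' d' \<epsilon>' \<phi>'" and n: "n = card {a. a < r' i \<and> d' i a = j}"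
      by blast
    then have res': "graded_resolution V ?I (\<lambda>n. {..<r' n}) d' \<epsilon>' \<phi>'"
      "minimal_maps (\<lambda>n. {..<r' n}) \<phi>'"
      unfolding iff by blast+
    have "two_resolutions V ?I (\<lambda>n. {..<r' n}) d' \<epsilon>' \<phi>' (\<lambda>n. {..<r n}) d (\<lambda>_. 1) \<psi>"
      using res res' by (intro two_resolutions.intro)
    from card_generators_eq[OF this res'(2) min, of i j]
    show "n = card {a. a < r i \<and> d i a = j}" by (simp add: n)
  qed
  moreover have "finite {a. a < r i \<and> d i a = j}" by simp
  ultimately have "betti V ?I i j \<noteq> 0 \<longleftrightarrow> (\<exists>a\<in>{..<r i}. d i a = j)"
    by auto
  also have "\<dots> \<longleftrightarrow> (\<exists>z w. homology_witness B (\<lambda>_. taylor_deg) (\<lambda>_. const_mat \<phi>) i j z w)"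
  proof
    assume "\<exists>a\<in>{..<r i}. d i a = j"
    then obtain a where a: "a \<in> {..<r i}" "d i a = j" by blast
    have "two_resolutions V ?I (\<lambda>n. {..<r n}) d (\<lambda>_. 1) \<psi> B (\<lambda>_. taylor_deg) (\<lambda>_. 1) (\<lambda>_. \<phi>)"
      using res taylor_resolution by (intro two_resolutions.intro)
    from two_resolutions.homology_witness_if_minimal[OF this min a(1)]
    show "\<exists>z w. homology_witness B (\<lambda>_. taylor_deg) (\<lambda>_. const_mat \<phi>) i j z w"
      using a(2) by simp
  next
    assume "\<exists>z w. homology_witness B (\<lambda>_. taylor_deg) (\<lambda>_. const_mat \<phi>) i j z w"
    then obtain z w where "homology_witness B (\<lambda>_. taylor_deg) (\<lambda>_. const_mat \<phi>) i j z w" by blast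
    moreover have "two_resolutions V ?I B (\<lambda>_. taylor_deg) (\<lambda>_. 1) (\<lambda>_. \<phi>) (\<lambda>n. {..<r n}) d (\<lambda>_. 1) \<psi>"
      using res taylor_resolution by (intro two_resolutions.intro)
    ultimately show "\<exists>a\<in>{..<r i}. d i a = j"
      using two_resolutions.generator_if_homology_witness by blast
  qed
  finally show ?thesis by (simp only: homology_witness_iff)
qed

section \<open>Betti numbers and regularity in terms of graphs\<close>

lemma finite_edges: "simple_graph G \<Longrightarrow> finite (edges G)"
  by (rule finite_subset[of _ "Pow (verts G)"]) (auto simp: simple_graph_def)

lemma taylor_graph:
  assumes "simple_graph G" "inj_on \<iota> (edges G)"
  shows "taylor (verts G) (edges G) \<iota>"
  using assms finite_edges[OF assms(1)]
  by unfold_locales (auto simp: simple_graph_def intro: finite_subset)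

text \<open>For the inclusion of the monomial ideal in the edge ideal, exactness of the Taylor
  complex is reused: an element of the monomial ideal is a cycle in position 0, so it is the image
  of a vector under the map whose entries are the edge monomials.\<close>

lemma edge_ideal_eq_monomial_ideal:
  fixes G :: "'v graph"
  assumes G: "simple_graph G"
  shows "(edge_ideal G :: ('v, 'k::comm_ring_1) mpoly set) = monomial_ideal (verts G) (edges G)"
proof -
  obtain \<iota> :: "'v set \<Rightarrow> nat" where "inj_on \<iota> (edges G)"
    using finite_imp_inj_to_nat_seg[OF finite_edges[OF G]] by blast
  then interpret taylor "verts G" "edges G" \<iota> "TYPE('k)"
    by (rule taylor_graph[OF G])
  interpret graded_ideal "verts G" "monomial_ideal (verts G) (edges G) :: ('v, 'k) mpoly set"
    by (rule graded_ideal_monomial_ideal)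
  define gen where "gen e = (monom (sqfree e) 1 :: ('v, 'k) mpoly)" for e
  \<comment> \<open>Combinations in \<open>ideal_generated\<close> are indexed by generators, the
    Taylor map by edges; injectivity identifies the two.\<close>
  have inj_gen: "inj_on gen (edges G)"
  proof (rule inj_onI)
    fix e f assume "e \<in> edges G" "f \<in> edges G" "gen e = gen f"
    then have "finite e" "finite f" "sqfree e = sqfree f"
      using finite_edge by (auto simp: gen_def lookup_single when_def poly_mapping_eq_iff fun_eq_iff
          split: if_split_asm dest: spec[of _ "sqfree e"])
    then show "e = f" by (metis keys_sqfree)
  qed
  have var_mult: "var u * var v = gen {u, v}" if "{u, v} \<in> edges G" for u v
  proof -
    have "u \<noteq> v" using G that by (auto simp: simple_graph_def)
    then have "Poly_Mapping.single u 1 + Poly_Mapping.single v 1 = sqfree {u, v}"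
      by (intro poly_mapping_eqI) (auto simp: lookup_add lookup_single lookup_sqfree when_def)
    then show ?thesis by (simp add: var_def gen_def mult_single)
  qed
  have edge_pair: "\<exists>u v. e = {u, v}" if "e \<in> edges G" for e
  proof -
    have "card e = 2" using G that by (simp add: simple_graph_def)
    then show ?thesis by (auto simp: card_2_iff)
  qed
  have gens: "{var u * var v | u v. {u, v} \<in> edges G} = gen ` edges G"
    using var_mult edge_pair by (auto simp: image_iff) metis+
  have "p \<in> monomial_ideal (verts G) (edges G)" if p_in: "p \<in> edge_ideal G" for p :: "('v, 'k) mpoly"
  proof -
    obtain A f where p: "p = (\<Sum>b\<in>A. f b * b)" and A: "A \<subseteq> gen ` edges G"
      and f: "\<forall>b\<in>A. f b \<in> polys (verts G)"
      using p_in unfolding edge_ideal_def ideal_generated_def gens by blast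
    show ?thesis
      unfolding p
    proof (rule ideal_sum)
      fix b assume b: "b \<in> A"
      then obtain e where "e \<in> edges G" "b = gen e" using A by blast
      then show "f b * b \<in> monomial_ideal (verts G) (edges G)"
        using generator_mult_in_ideal[of e "f b" 1] f b by (simp add: gen_def mult.commute)
    qed
  qed
  moreover have "p \<in> edge_ideal G" if p: "p \<in> monomial_ideal (verts G) (edges G)" for p :: "('v, 'k) mpoly"
  proof -
    obtain w where w: "\<forall>A\<in>B (Suc 0). w A \<in> polys (verts G)"
      and pw: "\<forall>A\<in>B 0. p = mvec (B (Suc 0)) \<phi> w A"
      using cycle_is_boundary[of 0 "\<lambda>_. p"] p
      by (auto simp: basis_0 cycle_vec_0 monomial_ideal_def)
    define f where "f b = w {inv_into (edges G) gen b}" for b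
    have f: "f (gen e) = w {e}" if "e \<in> edges G" for e
      using inv_into_f_f[OF inj_gen that] by (simp add: f_def)
    have "p = (\<Sum>e\<in>edges G. gen e * w {e})"
      using pw mvec_taylor_map[of "{}" 0 w] by (simp add: basis_0 gen_def face_sign_def)
    also have "\<dots> = (\<Sum>e\<in>edges G. f (gen e) * gen e)"
      by (intro sum.cong) (auto simp: f mult.commute)
    also have "\<dots> = (\<Sum>b\<in>gen ` edges G. f b * b)"
      by (simp add: sum.reindex[OF inj_gen])
    finally have "p = (\<Sum>b\<in>gen ` edges G. f b * b)" .
    moreover have "\<forall>b\<in>gen ` edges G. f b \<in> polys (verts G)"
      using w f by (auto simp: taylor_basis_def)
    ultimately show ?thesis
      unfolding edge_ideal_def ideal_generated_def gens using finite_E by blast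
  qed
  ultimately show ?thesis by blast
qed

definition betti_nonzero :: "'k::field itself \<Rightarrow> 'v graph \<Rightarrow> nat \<Rightarrow> nat \<Rightarrow> bool" where
  "betti_nonzero k G i j \<longleftrightarrow> betti (verts G) (edge_ideal G :: ('v, 'k) mpoly set) i (int j) \<noteq> 0"

lemma betti_edge_ideal_nonzero_iff:
  fixes G :: "'v graph"
  assumes "simple_graph G" "inj_on \<iota> (edges G)"
  shows "betti (verts G) (edge_ideal G :: ('v, 'k::field) mpoly set) i j \<noteq> 0 \<longleftrightarrow>
    (\<exists>j' z w. j = int j' \<and> taylor_witness (edges G) \<iota> i j' z (w :: 'v set set \<Rightarrow> 'k))"
  unfolding edge_ideal_eq_monomial_ideal[OF assms(1)]
  by (rule taylor_betti_nonzero_iff[OF taylor_graph[OF assms]])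

lemma betti_nonzero_iff:
  assumes "simple_graph G" "inj_on \<iota> (edges G)"
  shows "betti_nonzero TYPE('k::field) G i j \<longleftrightarrow>
    (\<exists>z w. taylor_witness (edges G) \<iota> i j z (w :: _ \<Rightarrow> 'k))"
  using betti_edge_ideal_nonzero_iff[OF assms, of i "int j", where 'k = 'k]
  by (simp add: betti_nonzero_def)

lemma graph_order_exists:
  fixes G :: "'v graph"
  assumes "simple_graph G"
  obtains \<iota> :: "'v set \<Rightarrow> nat" where "inj_on \<iota> (edges G)"
  using finite_imp_inj_to_nat_seg[OF finite_edges[OF assms]] by blast

text \<open>The class is that of the empty set of edges, a cocycle because no edge is contained in
  the empty union. It shows that the maximum in the regularity ranges over a nonempty set.\<close>

lemma betti_nonzero_0:
  fixes G :: "'v graph"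
  assumes G: "simple_graph G"
  shows "betti_nonzero TYPE('k::field) G 0 0"
proof -
  obtain \<iota> :: "'v set \<Rightarrow> nat" where \<iota>: "inj_on \<iota> (edges G)"
    using graph_order_exists[OF G] .
  define z :: "'v set set \<Rightarrow> 'k" where "z A = (if A = {} then 1 else 0)" for A
  have nonempty: "e \<noteq> {}" if "e \<in> edges G" for e using G that by (auto simp: simple_graph_def)
  have "taylor_witness (edges G) \<iota> 0 0 z z"
    unfolding taylor_witness_def
  proof (intro conjI allI impI)
    fix A assume A: "A \<subseteq> edges G"
    show "(\<Sum>e | e \<in> A \<and> e \<subseteq> \<Union>(A - {e}). face_sign \<iota> (A - {e}) e * z (A - {e})) = 0"
    proof (rule sum.neutral, rule ballI)
      fix e assume "e \<in> {e \<in> A. e \<subseteq> \<Union>(A - {e})}"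
      then have "A - {e} \<noteq> {}" using nonempty[of e] A by auto
      then show "face_sign \<iota> (A - {e}) e * z (A - {e}) = 0" by (simp add: z_def)
    qed
  next
    have "(\<Sum>A\<in>Pow (edges G). z A * z A) = (\<Sum>A\<in>{{}}. z A * z A)"
      using finite_edges[OF G] by (intro sum.mono_neutral_right) (auto simp: z_def)
    then show "(\<Sum>A\<in>Pow (edges G). z A * z A) \<noteq> 0" by (simp add: z_def)
  qed (auto simp: z_def split: if_split_asm)
  then show ?thesis using betti_nonzero_iff[OF G \<iota>] by blast
qed

text \<open>The homological degree is at most the number of edges, the internal degree at most the
  number of vertices, and (0, 0) always occurs; so \<open>Max\<close> is a genuine maximum.\<close>

lemma reg_edge_eq_Max:
  fixes G :: "'v graph"
  assumes G: "simple_graph G"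
  defines "D \<equiv> {int j - int i | i j. betti_nonzero TYPE('k::field) G i j}"
  shows "reg_edge TYPE('k) G = Max D" "finite D" "D \<noteq> {}"
proof -
  obtain \<iota> :: "'v set \<Rightarrow> nat" where \<iota>: "inj_on \<iota> (edges G)"
    using graph_order_exists[OF G] .
  have "{j - int i | i j. betti (verts G) (edge_ideal G :: ('v, 'k) mpoly set) i j \<noteq> 0} = D"
  proof -
    have "\<exists>j'. j = int j'" if "betti (verts G) (edge_ideal G :: ('v, 'k) mpoly set) i j \<noteq> 0" for i j
      using that betti_edge_ideal_nonzero_iff[OF G \<iota>, where 'k = 'k] by blast
    then show ?thesis
      unfolding D_def betti_nonzero_def by blast
  qed
  then show "reg_edge TYPE('k) G = Max D"
    by (simp add: reg_edge_def regularity_def)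
  have "i \<le> card (edges G) \<and> j \<le> card (verts G)" if ij: "betti_nonzero TYPE('k) G i j" for i j
  proof -
    obtain z and w :: "'v set set \<Rightarrow> 'k" where tw: "taylor_witness (edges G) \<iota> i j z w"
      using ij betti_nonzero_iff[OF G \<iota>] by blast
    then have "(\<Sum>A\<in>Pow (edges G). w A * z A) \<noteq> 0"
      by (simp add: taylor_witness_def)
    then obtain A where "w A * z A \<noteq> 0"
      by (rule sum.not_neutral_contains_not_neutral)
    then have "z A \<noteq> 0" by auto
    then have A: "A \<subseteq> edges G" "card A = i" "card (\<Union>A) = j"
      using taylor_witnessD(1)[OF tw] by auto
    then have "\<Union>A \<subseteq> verts G" "finite (verts G)" using G by (auto simp: simple_graph_def)
    then show ?thesis
      using A card_mono[of "edges G" A] card_mono[of "verts G" "\<Union>A"] finite_edges[OF G] by simp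
  qed
  then have "D \<subseteq> (\<lambda>(i, j). int j - int i) ` ({..card (edges G)} \<times> {..card (verts G)})"
    unfolding D_def by force
  then show "finite D" by (rule finite_subset) simp
  show "D \<noteq> {}" using betti_nonzero_0[OF G] unfolding D_def by blast
qed

lemma reg_edge_ge:
  assumes "simple_graph G" "betti_nonzero TYPE('k::field) G i j"
  shows "int j - int i \<le> reg_edge TYPE('k) G"
  using reg_edge_eq_Max[OF assms(1), where 'k = 'k] assms(2) by (auto intro!: Max_ge)

lemma reg_edge_attained:
  assumes "simple_graph G"
  obtains i j where "betti_nonzero TYPE('k::field) G i j" "reg_edge TYPE('k) G = int j - int i"
proof -
  have "reg_edge TYPE('k) G \<in> {int j - int i | i j. betti_nonzero TYPE('k) G i j}"
    unfolding reg_edge_eq_Max(1)[OF assms]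
    by (rule Max_in) (rule reg_edge_eq_Max[OF assms])+
  then show thesis using that by blast
qed

section \<open>Operations on Taylor homology classes\<close>

lemma taylor_witness_induced:
  assumes fin: "finite E" and tw: "taylor_witness {e \<in> E. e \<subseteq> W} \<iota> i j z w"
  shows "taylor_witness E \<iota> i j z w"
proof -
  let ?E = "{e \<in> E. e \<subseteq> W}"
  note D = taylor_witnessD[OF tw]
  show ?thesis
    unfolding taylor_witness_def
  proof (intro conjI allI impI)
    fix A
    show "A \<subseteq> E" "card A = i" "card (\<Union>A) = j" if "z A \<noteq> 0"
      using D(1)[OF that] by auto
    show "A \<subseteq> E" "card A = i" if "w A \<noteq> 0"
      using D(2)[OF that] by auto
  next
    fix A assume A: "A \<subseteq> E"
    show "(\<Sum>e | e \<in> E - A \<and> e \<subseteq> \<Union>A. face_sign \<iota> A e * z (insert e A)) = 0"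
    proof (cases "A \<subseteq> ?E")
      case True
      then have "{e \<in> E - A. e \<subseteq> \<Union>A} = {e \<in> ?E - A. e \<subseteq> \<Union>A}" by blast
      then show ?thesis using D(3)[OF True] by simp
    next
      case False
      then have "z (insert e A) = 0" for e using D(1)[of "insert e A"] by blast
      then show ?thesis by simp
    qed
    show "(\<Sum>e | e \<in> A \<and> e \<subseteq> \<Union>(A - {e}). face_sign \<iota> (A - {e}) e * w (A - {e})) = 0"
    proof (cases "A \<subseteq> ?E")
      case True
      then show ?thesis by (rule D(4))
    next
      case False
      \<comment> \<open>If \<open>A - {e}\<close> lies in the subgraph, its union is inside
        \<open>W\<close>, and so is \<open>e\<close>, which it covers. No set outside the subgraph
        receives a coboundary term, precisely because the subgraph is induced.\<close>
      have "w (A - {e}) = 0" if "e \<in> A" "e \<subseteq> \<Union>(A - {e})" for e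
      proof (rule ccontr)
        assume "w (A - {e}) \<noteq> 0"
        then have "A - {e} \<subseteq> ?E" using D(2) by blast
        then show False using that False A by blast
      qed
      then show ?thesis by (intro sum.neutral) auto
    qed
  next
    have "w A * z A = 0" if "\<not> A \<subseteq> ?E" for A using D(1)[of A] that by (metis mult_zero_right)
    then have "(\<Sum>A\<in>Pow ?E. w A * z A) = (\<Sum>A\<in>Pow E. w A * z A)"
      using fin by (intro sum.mono_neutral_left) auto
    then show "(\<Sum>A\<in>Pow E. w A * z A) \<noteq> 0" using D(5) by simp
  qed
qed

text \<open>The Taylor complex of a disjoint union is the tensor product of the Taylor complexes.\<close>

lemma taylor_witness_disjoint_Un:
  fixes z\<^sub>1 z\<^sub>2 w\<^sub>1 w\<^sub>2 :: "'v set set \<Rightarrow> 'k::field"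
  assumes fin: "finite E\<^sub>1" "finite E\<^sub>2" "\<And>e. e \<in> E\<^sub>1 \<union> E\<^sub>2 \<Longrightarrow> finite e"
    and nonempty: "{} \<notin> E\<^sub>1 \<union> E\<^sub>2" and disj: "\<Union>E\<^sub>1 \<inter> \<Union>E\<^sub>2 = {}"
    and order: "\<And>e f. e \<in> E\<^sub>1 \<Longrightarrow> f \<in> E\<^sub>2 \<Longrightarrow> \<iota> e < \<iota> f"
    and tw1: "taylor_witness E\<^sub>1 \<iota> i\<^sub>1 j\<^sub>1 z\<^sub>1 w\<^sub>1" and tw2: "taylor_witness E\<^sub>2 \<iota> i\<^sub>2 j\<^sub>2 z\<^sub>2 w\<^sub>2"
  shows "taylor_witness (E\<^sub>1 \<union> E\<^sub>2) \<iota> (i\<^sub>1 + i\<^sub>2) (j\<^sub>1 + j\<^sub>2)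
      (\<lambda>A. if A \<subseteq> E\<^sub>1 \<union> E\<^sub>2 then z\<^sub>1 (A \<inter> E\<^sub>1) * z\<^sub>2 (A \<inter> E\<^sub>2) else 0)
      (\<lambda>A. if A \<subseteq> E\<^sub>1 \<union> E\<^sub>2 then w\<^sub>1 (A \<inter> E\<^sub>1) * w\<^sub>2 (A \<inter> E\<^sub>2) else 0)"
    (is "taylor_witness ?E _ _ _ ?z ?w")
proof -
  note D1 = taylor_witnessD[OF tw1] and D2 = taylor_witnessD[OF tw2]
  have E12: "E\<^sub>1 \<inter> E\<^sub>2 = {}"
  proof (rule equals0I)
    fix e assume e: "e \<in> E\<^sub>1 \<inter> E\<^sub>2"
    then have "e \<subseteq> \<Union>E\<^sub>1 \<inter> \<Union>E\<^sub>2" by blast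
    then show False using e disj nonempty by simp
  qed
  have split: "A = A \<inter> E\<^sub>1 \<union> A \<inter> E\<^sub>2" if "A \<subseteq> ?E" for A using that by blast
  have finA: "finite A" "finite (\<Union>A)" if "A \<subseteq> ?E" for A
    using that fin by (auto intro: finite_subset)
  have card: "card A = card (A \<inter> E\<^sub>1) + card (A \<inter> E\<^sub>2)" if "A \<subseteq> ?E" for A
    using finA[OF that] E12 by (subst split[OF that], subst card_Un_disjoint) auto
  have card_Union: "card (\<Union>A) = card (\<Union>(A \<inter> E\<^sub>1)) + card (\<Union>(A \<inter> E\<^sub>2))" if "A \<subseteq> ?E" for A
  proof -
    have "\<Union>A = \<Union>(A \<inter> E\<^sub>1) \<union> \<Union>(A \<inter> E\<^sub>2)" using that by blast
    moreover have "finite (\<Union>(A \<inter> E\<^sub>1))" "finite (\<Union>(A \<inter> E\<^sub>2))"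
      using finA(2)[of "A \<inter> E\<^sub>1"] finA(2)[of "A \<inter> E\<^sub>2"] by auto
    moreover have "\<Union>(A \<inter> E\<^sub>1) \<inter> \<Union>(A \<inter> E\<^sub>2) = {}" using disj by blast
    ultimately show ?thesis by (simp only: card_Un_disjoint)
  qed
  have sub1: "e \<subseteq> \<Union>A \<longleftrightarrow> e \<subseteq> \<Union>(A \<inter> E\<^sub>1)" if "e \<in> E\<^sub>1" "A \<subseteq> ?E" for e A
    using that disj by blast
  have sub2: "e \<subseteq> \<Union>A \<longleftrightarrow> e \<subseteq> \<Union>(A \<inter> E\<^sub>2)" if "e \<in> E\<^sub>2" "A \<subseteq> ?E" for e A
    using that disj by blast
  have sign1: "face_sign \<iota> A e = (face_sign \<iota> (A \<inter> E\<^sub>1) e :: 'k)" if "e \<in> E\<^sub>1" "A \<subseteq> ?E" for e A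
  proof -
    have "{f \<in> A. \<iota> f < \<iota> e} = {f \<in> A \<inter> E\<^sub>1. \<iota> f < \<iota> e}"
      using that order by (fastforce dest: less_asym)
    then show ?thesis by (simp add: face_sign_def)
  qed
  \<comment> \<open>All of \<open>E\<^sub>1\<close> precedes an edge of \<open>E\<^sub>2\<close>,
    which produces the Koszul sign of a tensor product of complexes.\<close>
  have sign2: "face_sign \<iota> A e = (- 1) ^ card (A \<inter> E\<^sub>1) * (face_sign \<iota> (A \<inter> E\<^sub>2) e :: 'k)"
    if "e \<in> E\<^sub>2" "A \<subseteq> ?E" for e A
  proof -
    have "{f \<in> A. \<iota> f < \<iota> e} = A \<inter> E\<^sub>1 \<union> {f \<in> A \<inter> E\<^sub>2. \<iota> f < \<iota> e}"
      using that order by blast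
    moreover have "card \<dots> = card (A \<inter> E\<^sub>1) + card {f \<in> A \<inter> E\<^sub>2. \<iota> f < \<iota> e}"
      using finA(1)[OF that(2)] E12 by (intro card_Un_disjoint) auto
    ultimately show ?thesis by (simp add: face_sign_def power_add)
  qed
  show ?thesis
    unfolding taylor_witness_def
  proof (intro conjI allI impI)
    fix A
    assume z: "?z A \<noteq> 0"
    then show A: "A \<subseteq> ?E" by (simp split: if_split_asm)
    have "z\<^sub>1 (A \<inter> E\<^sub>1) \<noteq> 0" "z\<^sub>2 (A \<inter> E\<^sub>2) \<noteq> 0"
      using z A by auto
    then show "card A = i\<^sub>1 + i\<^sub>2" "card (\<Union>A) = j\<^sub>1 + j\<^sub>2"
      using D1(1) D2(1) card[OF A] card_Union[OF A] by simp_all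
  next
    fix A
    assume w: "?w A \<noteq> 0"
    then show A: "A \<subseteq> ?E" by (simp split: if_split_asm)
    have "w\<^sub>1 (A \<inter> E\<^sub>1) \<noteq> 0" "w\<^sub>2 (A \<inter> E\<^sub>2) \<noteq> 0"
      using w A by auto
    then show "card A = i\<^sub>1 + i\<^sub>2"
      using D1(2) D2(2) card[OF A] by simp
  next
    fix A assume A: "A \<subseteq> ?E"
    let ?A1 = "A \<inter> E\<^sub>1" and ?A2 = "A \<inter> E\<^sub>2"
    let ?S1 = "{e \<in> E\<^sub>1 - ?A1. e \<subseteq> \<Union>?A1}" and ?S2 = "{e \<in> E\<^sub>2 - ?A2. e \<subseteq> \<Union>?A2}"
    \<comment> \<open>Vertices of an edge are covered only by edges of its own part, so the sum
      splits into a sum for each part.\<close>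
    have "e \<in> {e \<in> ?E - A. e \<subseteq> \<Union>A} \<longleftrightarrow> e \<in> ?S1 \<union> ?S2" for e
    proof (cases "e \<in> E\<^sub>1")
      case True
      moreover have "e \<notin> E\<^sub>2" using True E12 by blast
      ultimately show ?thesis using sub1[OF True A] by simp
    next
      case False
      then show ?thesis using sub2[OF _ A, of e] by auto
    qed
    then have "{e \<in> ?E - A. e \<subseteq> \<Union>A} = ?S1 \<union> ?S2" by (rule set_eqI)
    then have "(\<Sum>e | e \<in> ?E - A \<and> e \<subseteq> \<Union>A. face_sign \<iota> A e * ?z (insert e A)) =
        (\<Sum>e\<in>?S1. face_sign \<iota> A e * ?z (insert e A)) + (\<Sum>e\<in>?S2. face_sign \<iota> A e * ?z (insert e A))"
      using fin E12 by (simp only:) (intro sum.union_disjoint; auto)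
    also have "(\<Sum>e\<in>?S1. face_sign \<iota> A e * ?z (insert e A)) =
        (\<Sum>e\<in>?S1. face_sign \<iota> ?A1 e * z\<^sub>1 (insert e ?A1)) * z\<^sub>2 ?A2"
      unfolding sum_distrib_right
    proof (rule sum.cong)
      fix e assume e: "e \<in> ?S1"
      then have "insert e A \<inter> E\<^sub>1 = insert e ?A1" "insert e A \<inter> E\<^sub>2 = ?A2" using E12 by auto
      then show "face_sign \<iota> A e * ?z (insert e A) = face_sign \<iota> ?A1 e * z\<^sub>1 (insert e ?A1) * z\<^sub>2 ?A2"
        using e A sign1[of e A] by (simp add: mult.assoc)
    qed simp
    also have "(\<Sum>e\<in>?S1. face_sign \<iota> ?A1 e * z\<^sub>1 (insert e ?A1)) = 0"
      by (rule D1(3)) simp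
    also have "(\<Sum>e\<in>?S2. face_sign \<iota> A e * ?z (insert e A)) =
        (- 1) ^ card ?A1 * z\<^sub>1 ?A1 * (\<Sum>e\<in>?S2. face_sign \<iota> ?A2 e * z\<^sub>2 (insert e ?A2))"
      unfolding sum_distrib_left
    proof (rule sum.cong)
      fix e assume e: "e \<in> ?S2"
      then have "insert e A \<inter> E\<^sub>2 = insert e ?A2" "insert e A \<inter> E\<^sub>1 = ?A1" using E12 by auto
      then show "face_sign \<iota> A e * ?z (insert e A) =
          (- 1) ^ card ?A1 * z\<^sub>1 ?A1 * (face_sign \<iota> ?A2 e * z\<^sub>2 (insert e ?A2))"
        using e A sign2[of e A] by (simp add: ac_simps)
    qed simp
    also have "(\<Sum>e\<in>?S2. face_sign \<iota> ?A2 e * z\<^sub>2 (insert e ?A2)) = 0"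
      by (rule D2(3)) simp
    finally show "(\<Sum>e | e \<in> ?E - A \<and> e \<subseteq> \<Union>A. face_sign \<iota> A e * ?z (insert e A)) = 0" by simp
  next
    fix A assume A: "A \<subseteq> ?E"
    let ?A1 = "A \<inter> E\<^sub>1" and ?A2 = "A \<inter> E\<^sub>2"
    let ?S1 = "{e \<in> ?A1. e \<subseteq> \<Union>(?A1 - {e})}" and ?S2 = "{e \<in> ?A2. e \<subseteq> \<Union>(?A2 - {e})}"
    have A_e: "A - {e} \<subseteq> ?E" for e using A by blast
    have int1: "(A - {e}) \<inter> E\<^sub>1 = ?A1 - {e}" and int2: "(A - {e}) \<inter> E\<^sub>2 = ?A2 - {e}" for e by blast+
    have "e \<in> {e \<in> A. e \<subseteq> \<Union>(A - {e})} \<longleftrightarrow> e \<in> ?S1 \<union> ?S2" for e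
    proof (cases "e \<in> E\<^sub>1")
      case True
      moreover have "e \<notin> E\<^sub>2" using True E12 by blast
      ultimately show ?thesis using sub1[OF True A_e, of e] by (simp add: int1)
    next
      case False
      then show ?thesis using sub2[OF _ A_e, of e e] A by (cases "e \<in> A") (auto simp: int2)
    qed
    then have "{e \<in> A. e \<subseteq> \<Union>(A - {e})} = ?S1 \<union> ?S2" by (rule set_eqI)
    then have "(\<Sum>e | e \<in> A \<and> e \<subseteq> \<Union>(A - {e}). face_sign \<iota> (A - {e}) e * ?w (A - {e})) =
        (\<Sum>e\<in>?S1. face_sign \<iota> (A - {e}) e * ?w (A - {e})) +
        (\<Sum>e\<in>?S2. face_sign \<iota> (A - {e}) e * ?w (A - {e}))"
      using finA(1)[OF A] E12 by (simp only:) (intro sum.union_disjoint; auto)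
    also have "(\<Sum>e\<in>?S1. face_sign \<iota> (A - {e}) e * ?w (A - {e})) =
        (\<Sum>e\<in>?S1. face_sign \<iota> (?A1 - {e}) e * w\<^sub>1 (?A1 - {e})) * w\<^sub>2 ?A2"
      unfolding sum_distrib_right
    proof (rule sum.cong)
      fix e assume e: "e \<in> ?S1"
      then have "?A2 - {e} = ?A2" using E12 by auto
      then show "face_sign \<iota> (A - {e}) e * ?w (A - {e}) =
          face_sign \<iota> (?A1 - {e}) e * w\<^sub>1 (?A1 - {e}) * w\<^sub>2 ?A2"
        using e A_e[of e] sign1[OF _ A_e, of e e] by (simp add: int1 int2 mult.assoc)
    qed simp
    also have "(\<Sum>e\<in>?S1. face_sign \<iota> (?A1 - {e}) e * w\<^sub>1 (?A1 - {e})) = 0"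
      by (rule D1(4)) simp
    also have "(\<Sum>e\<in>?S2. face_sign \<iota> (A - {e}) e * ?w (A - {e})) =
        (- 1) ^ card ?A1 * w\<^sub>1 ?A1 * (\<Sum>e\<in>?S2. face_sign \<iota> (?A2 - {e}) e * w\<^sub>2 (?A2 - {e}))"
      unfolding sum_distrib_left
    proof (rule sum.cong)
      fix e assume e: "e \<in> ?S2"
      then have "?A1 - {e} = ?A1" using E12 by auto
      then show "face_sign \<iota> (A - {e}) e * ?w (A - {e}) =
          (- 1) ^ card ?A1 * w\<^sub>1 ?A1 * (face_sign \<iota> (?A2 - {e}) e * w\<^sub>2 (?A2 - {e}))"
        using e A_e[of e] sign2[OF _ A_e, of e e] by (simp add: int1 int2 mult_ac)
    qed simp
    also have "(\<Sum>e\<in>?S2. face_sign \<iota> (?A2 - {e}) e * w\<^sub>2 (?A2 - {e})) = 0"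
      by (rule D2(4)) simp
    finally show "(\<Sum>e | e \<in> A \<and> e \<subseteq> \<Union>(A - {e}). face_sign \<iota> (A - {e}) e * ?w (A - {e})) = 0"
      by simp
  next
    \<comment> \<open>Sets of edges of the union are pairs of sets, so the pairing factors into two
      nonzero elements of a field.\<close>
    have bij: "bij_betw (\<lambda>(A1, A2). A1 \<union> A2) (Pow E\<^sub>1 \<times> Pow E\<^sub>2) (Pow ?E)"
      by (rule bij_betw_byWitness[where f' = "\<lambda>A. (A \<inter> E\<^sub>1, A \<inter> E\<^sub>2)"]) (use E12 in auto)
    have "(\<Sum>A\<in>Pow ?E. ?w A * ?z A) =
        (\<Sum>(A1, A2)\<in>Pow E\<^sub>1 \<times> Pow E\<^sub>2. (w\<^sub>1 A1 * z\<^sub>1 A1) * (w\<^sub>2 A2 * z\<^sub>2 A2))"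
      unfolding sum.reindex_bij_betw[OF bij, symmetric]
    proof (rule sum.cong, simp, clarify)
      fix A1 A2 assume "A1 \<subseteq> E\<^sub>1" "A2 \<subseteq> E\<^sub>2"
      then have "A1 \<union> A2 \<subseteq> ?E" "(A1 \<union> A2) \<inter> E\<^sub>1 = A1" "(A1 \<union> A2) \<inter> E\<^sub>2 = A2"
        using E12 by auto
      then show "?w (A1 \<union> A2) * ?z (A1 \<union> A2) = (w\<^sub>1 A1 * z\<^sub>1 A1) * (w\<^sub>2 A2 * z\<^sub>2 A2)"
        by (simp add: ac_simps)
    qed
    also have "\<dots> = (\<Sum>A1\<in>Pow E\<^sub>1. w\<^sub>1 A1 * z\<^sub>1 A1) * (\<Sum>A2\<in>Pow E\<^sub>2. w\<^sub>2 A2 * z\<^sub>2 A2)"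
      by (simp add: sum_product sum.cartesian_product)
    finally show "(\<Sum>A\<in>Pow ?E. ?w A * ?z A) \<noteq> 0" using D1(5) D2(5) by simp
  qed
qed

text \<open>The ordering is pulled back along \<open>f\<close> together with the vectors, so the
  signs agree without any monotonicity of \<open>f\<close>. The vectors are cut off outside subsets
  of \<open>E\<close>, where \<open>f\<close> need not be injective.\<close>

lemma taylor_witness_image:
  fixes w :: "'v set set \<Rightarrow> 'k::comm_ring_1"
  assumes fin: "finite E" and inj: "inj_on f (\<Union>E)"
    and tw: "taylor_witness ((`) f ` E) \<iota> i j z w"
  shows "taylor_witness E (\<lambda>e. \<iota> (f ` e)) i j
      (\<lambda>A. if A \<subseteq> E then z ((`) f ` A) else 0) (\<lambda>A. if A \<subseteq> E then w ((`) f ` A) else 0)"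
    (is "taylor_witness _ ?\<iota> _ _ ?z ?w")
proof -
  note D = taylor_witnessD[OF tw]
  let ?F = "(`) f"
  have injF: "inj_on ?F E" using inj by (rule inj_on_image)
  have card: "card (?F ` A) = card A" if "A \<subseteq> E" for A
    using card_image[OF inj_on_subset[OF injF that]] .
  have card_Union: "card (\<Union>(?F ` A)) = card (\<Union>A)" if "A \<subseteq> E" for A
  proof -
    have "\<Union>(?F ` A) = f ` \<Union>A" by blast
    moreover have "inj_on f (\<Union>A)" using inj that by (auto intro: inj_on_subset)
    ultimately show ?thesis by (simp only: card_image)
  qed
  have sign: "face_sign \<iota> (?F ` A) (?F e) = (face_sign ?\<iota> A e :: 'k)" if "A \<subseteq> E" for A e
  proof -
    have "{x \<in> ?F ` A. \<iota> x < \<iota> (?F e)} = ?F ` {x \<in> A. ?\<iota> x < ?\<iota> e}" by blast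
    moreover have "inj_on ?F {x \<in> A. ?\<iota> x < ?\<iota> e}"
      using that by (intro inj_on_subset[OF injF]) auto
    ultimately show ?thesis by (simp add: face_sign_def card_image)
  qed
  have sub: "?F e \<subseteq> \<Union>(?F ` A) \<longleftrightarrow> e \<subseteq> \<Union>A" if "A \<subseteq> E" "e \<in> E" for A e
  proof -
    have "?F e \<subseteq> f ` \<Union>A \<longleftrightarrow> (\<forall>x\<in>e. x \<in> \<Union>A)"
      using that inj_on_image_mem_iff[OF inj, of _ "\<Union>A"] by (subst image_subset_iff) blast
    also have "\<dots> \<longleftrightarrow> e \<subseteq> \<Union>A" by (rule subset_iff[symmetric, unfolded Ball_def[symmetric]])
    finally have "?F e \<subseteq> f ` \<Union>A \<longleftrightarrow> e \<subseteq> \<Union>A" .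
    then show ?thesis by (simp add: image_Union)
  qed
  have mem: "?F e \<in> ?F ` A \<longleftrightarrow> e \<in> A" if "A \<subseteq> E" "e \<in> E" for A e
    using inj_on_image_mem_iff[OF injF] that by blast
  have img: "{y \<in> ?F ` E - X. Q y} = ?F ` {e \<in> E. ?F e \<notin> X \<and> Q (?F e)}" for X Q
    by blast
  show ?thesis
    unfolding taylor_witness_def
  proof (intro conjI allI impI)
    fix A
    show "A \<subseteq> E" "card A = i" "card (\<Union>A) = j" if "?z A \<noteq> 0"
      using that D(1)[of "?F ` A"] card[of A] card_Union[of A] by (simp_all split: if_split_asm)
    show "A \<subseteq> E" "card A = i" if "?w A \<noteq> 0"
      using that D(2)[of "?F ` A"] card[of A] by (simp_all split: if_split_asm)
  next
    fix A assume A: "A \<subseteq> E"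
    have inj_A: "inj_on ?F {e \<in> E - A. e \<subseteq> \<Union>A}" by (rule inj_on_subset[OF injF]) auto
    have "{e \<in> ?F ` E - ?F ` A. e \<subseteq> \<Union>(?F ` A)} =
        ?F ` {e \<in> E. ?F e \<notin> ?F ` A \<and> ?F e \<subseteq> \<Union>(?F ` A)}" by (rule img)
    also have "{e \<in> E. ?F e \<notin> ?F ` A \<and> ?F e \<subseteq> \<Union>(?F ` A)} = {e \<in> E - A. e \<subseteq> \<Union>A}"
    proof (rule Collect_cong)
      show "e \<in> E \<and> ?F e \<notin> ?F ` A \<and> ?F e \<subseteq> \<Union>(?F ` A) \<longleftrightarrow> e \<in> E - A \<and> e \<subseteq> \<Union>A" for e
        by (cases "e \<in> E") (simp_all only: Diff_iff sub[OF A] mem[OF A] simp_thms)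
    qed
    finally have "0 = (\<Sum>e\<in>?F ` {e \<in> E - A. e \<subseteq> \<Union>A}. face_sign \<iota> (?F ` A) e * z (insert e (?F ` A)))"
      using D(3)[of "?F ` A"] A by (simp add: image_mono)
    also have "\<dots> = (\<Sum>e | e \<in> E - A \<and> e \<subseteq> \<Union>A. face_sign ?\<iota> A e * ?z (insert e A))"
      unfolding sum.reindex[OF inj_A] using A sign[OF A] by (intro sum.cong) auto
    finally show "(\<Sum>e | e \<in> E - A \<and> e \<subseteq> \<Union>A. face_sign ?\<iota> A e * ?z (insert e A)) = 0" by simp
    have inj_A: "inj_on ?F {e \<in> A. e \<subseteq> \<Union>(A - {e})}" using A by (intro inj_on_subset[OF injF]) auto
    have diff: "?F ` A - {?F e} = ?F ` (A - {e})" if "e \<in> A" for e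
      using inj_on_image_set_diff[OF injF, of A "{e}"] A that by auto
    have A_e: "A - {e} \<subseteq> E" for e using A by blast
    have sub_diff: "?F e \<subseteq> \<Union>(?F ` A - {?F e}) \<longleftrightarrow> e \<subseteq> \<Union>(A - {e})" if "e \<in> A" for e
      unfolding diff[OF that] using that A by (intro sub[OF A_e]) auto
    have "{y \<in> ?F ` A. Q y} = ?F ` {e \<in> A. Q (?F e)}" for Q by blast
    then have "{e \<in> ?F ` A. e \<subseteq> \<Union>(?F ` A - {e})} = ?F ` {e \<in> A. ?F e \<subseteq> \<Union>(?F ` A - {?F e})}" .
    also have "{e \<in> A. ?F e \<subseteq> \<Union>(?F ` A - {?F e})} = {e \<in> A. e \<subseteq> \<Union>(A - {e})}"
      by (intro Collect_cong conj_cong refl sub_diff)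
    finally have "0 = (\<Sum>e\<in>?F ` {e \<in> A. e \<subseteq> \<Union>(A - {e})}.
        face_sign \<iota> (?F ` A - {e}) e * w (?F ` A - {e}))"
      using D(4)[of "?F ` A"] A by (simp add: image_mono)
    also have "\<dots> = (\<Sum>e | e \<in> A \<and> e \<subseteq> \<Union>(A - {e}). face_sign ?\<iota> (A - {e}) e * ?w (A - {e}))"
      unfolding sum.reindex[OF inj_A] using A_e sign[OF A_e]
      by (intro sum.cong) (auto simp: diff)
    finally show "(\<Sum>e | e \<in> A \<and> e \<subseteq> \<Union>(A - {e}). face_sign ?\<iota> (A - {e}) e * ?w (A - {e})) = 0"
      by simp
  next
    have "Pow (?F ` E) = (`) ?F ` Pow E" by (rule image_Pow_surj[symmetric]) simp
    moreover have "inj_on ((`) ?F) (Pow E)" using injF by (rule inj_on_image_Pow)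
    ultimately have "(\<Sum>A\<in>Pow (?F ` E). w A * z A) = (\<Sum>A\<in>Pow E. ?w A * ?z A)"
      by (simp add: sum.reindex)
    then show "(\<Sum>A\<in>Pow E. ?w A * ?z A) \<noteq> 0" using D(5) by simp
  qed
qed

section \<open>Betti numbers under induced subgraphs, isomorphisms and disjoint unions\<close>

lemma simple_graph_induced: "simple_graph G \<Longrightarrow> W \<subseteq> verts G \<Longrightarrow> simple_graph (induced G W)"
  by (auto simp: simple_graph_def induced_def intro: finite_subset)

lemma betti_nonzero_induced:
  assumes G: "simple_graph G" and W: "W \<subseteq> verts G"
    and nz: "betti_nonzero TYPE('k::field) (induced G W) i j"
  shows "betti_nonzero TYPE('k) G i j"
proof -
  obtain \<iota> :: "_ \<Rightarrow> nat" where \<iota>: "inj_on \<iota> (edges G)" using graph_order_exists[OF G] .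
  then have "inj_on \<iota> (edges (induced G W))"
    by (rule inj_on_subset) (auto simp: induced_def)
  from nz[unfolded betti_nonzero_iff[OF simple_graph_induced[OF G W] this]]
  show ?thesis
    unfolding betti_nonzero_iff[OF G \<iota>] induced_def snd_conv
    using taylor_witness_induced[OF finite_edges[OF G]] by blast
qed

lemma betti_nonzero_iso:
  assumes G: "simple_graph G" and H: "simple_graph H" and iso: "graph_iso G H"
    and nz: "betti_nonzero TYPE('k::field) H i j"
  shows "betti_nonzero TYPE('k) G i j"
proof -
  obtain f where f: "bij_betw f (verts G) (verts H)" and E: "edges H = (`) f ` edges G"
    using iso by (auto simp: graph_iso_def)
  have inj: "inj_on f (\<Union>(edges G))"
  proof (rule inj_on_subset)
    show "inj_on f (verts G)" using f by (simp add: bij_betw_def)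
    show "\<Union>(edges G) \<subseteq> verts G" using G by (auto simp: simple_graph_def)
  qed
  obtain \<iota> :: "_ \<Rightarrow> nat" where \<iota>: "inj_on \<iota> (edges H)" using graph_order_exists[OF H] .
  have "inj_on (\<lambda>e. \<iota> (f ` e)) (edges G)"
    using comp_inj_on[OF inj_on_image[OF inj], of \<iota>] \<iota> by (simp add: E comp_def)
  note iff = betti_nonzero_iff[OF G this]
  show ?thesis
    using nz unfolding iff betti_nonzero_iff[OF H \<iota>] E
    using taylor_witness_image[OF finite_edges[OF G] inj] by blast
qed

lemma betti_nonzero_disjoint_Un:
  assumes G: "simple_graph G" and W: "W\<^sub>1 \<subseteq> verts G" "W\<^sub>2 \<subseteq> verts G" "W\<^sub>1 \<inter> W\<^sub>2 = {}"
    and no_edges: "\<And>e. e \<in> edges G \<Longrightarrow> e \<subseteq> W\<^sub>1 \<union> W\<^sub>2 \<Longrightarrow> e \<subseteq> W\<^sub>1 \<or> e \<subseteq> W\<^sub>2"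
    and nz: "betti_nonzero TYPE('k::field) (induced G W\<^sub>1) i\<^sub>1 j\<^sub>1"
      "betti_nonzero TYPE('k) (induced G W\<^sub>2) i\<^sub>2 j\<^sub>2"
  shows "betti_nonzero TYPE('k) (induced G (W\<^sub>1 \<union> W\<^sub>2)) (i\<^sub>1 + i\<^sub>2) (j\<^sub>1 + j\<^sub>2)"
proof -
  let ?E1 = "{e \<in> edges G. e \<subseteq> W\<^sub>1}" and ?E2 = "{e \<in> edges G. e \<subseteq> W\<^sub>2}"
  obtain \<kappa> :: "_ \<Rightarrow> nat" where \<kappa>: "inj_on \<kappa> (edges G)" using graph_order_exists[OF G] .
  \<comment> \<open>\<open>N\<close> exceeds all values of \<kappa>. Raising the edges outside the
    first part by \<open>N\<close> therefore puts that part in front and keeps the ordering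
    injective.\<close>
  define N where "N = Suc (\<Sum>e\<in>edges G. \<kappa> e)"
  have N: "\<kappa> e < N" if "e \<in> edges G" for e
    using member_le_sum[of e "edges G" \<kappa>] finite_edges[OF G] that by (simp add: N_def)
  define \<iota> where "\<iota> e = (if e \<subseteq> W\<^sub>1 then \<kappa> e else N + \<kappa> e)" for e
  have \<iota>: "inj_on \<iota> (edges G)"
    using N \<kappa> by (fastforce simp: inj_on_def \<iota>_def)
  have nonempty: "e \<noteq> {}" "finite e" if "e \<in> edges G" for e
    using G that by (auto simp: simple_graph_def intro: finite_subset)
  have order: "\<iota> e < \<iota> f" if "e \<in> ?E1" "f \<in> ?E2" for e f
  proof -
    have "\<not> f \<subseteq> W\<^sub>1" using that W(3) nonempty by blast
    then show ?thesis using that N[of e] by (simp add: \<iota>_def)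
  qed
  have inj: "inj_on \<iota> (edges (induced G W))" for W
    using \<iota> by (rule inj_on_subset) (auto simp: induced_def)
  obtain z\<^sub>1 and w\<^sub>1 :: "_ \<Rightarrow> 'k" where tw1: "taylor_witness ?E1 \<iota> i\<^sub>1 j\<^sub>1 z\<^sub>1 w\<^sub>1"
    using nz(1) betti_nonzero_iff[OF simple_graph_induced[OF G W(1)] inj, where 'k = 'k]
    by (auto simp: induced_def)
  obtain z\<^sub>2 and w\<^sub>2 :: "_ \<Rightarrow> 'k" where tw2: "taylor_witness ?E2 \<iota> i\<^sub>2 j\<^sub>2 z\<^sub>2 w\<^sub>2"
    using nz(2) betti_nonzero_iff[OF simple_graph_induced[OF G W(2)] inj, where 'k = 'k]
    by (auto simp: induced_def)
  have "edges (induced G (W\<^sub>1 \<union> W\<^sub>2)) = ?E1 \<union> ?E2"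
    using no_edges by (auto simp: induced_def)
  moreover have "\<exists>z w. taylor_witness (?E1 \<union> ?E2) \<iota> (i\<^sub>1 + i\<^sub>2) (j\<^sub>1 + j\<^sub>2) z (w :: _ \<Rightarrow> 'k)"
    by (intro exI, rule taylor_witness_disjoint_Un[OF _ _ _ _ _ order tw1 tw2])
      (use finite_edges[OF G] nonempty W(3) in auto)
  ultimately show ?thesis
    using betti_nonzero_iff[OF simple_graph_induced[OF G, of "W\<^sub>1 \<union> W\<^sub>2"] inj, where 'k = 'k] W by simp
qed

text \<open>The edge is not covered by the empty set, so it is a cycle and a cocycle at once. A
  constant ordering is injective on a single edge.\<close>

lemma betti_nonzero_single_edge:
  assumes G: "simple_graph G" and E: "edges G = {e}"
  shows "betti_nonzero TYPE('k::field) G 1 2"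
proof -
  have e: "card e = 2" "e \<noteq> {}" using G E by (auto simp: simple_graph_def)
  define z :: "'a set set \<Rightarrow> 'k" where "z A = (if A = {e} then 1 else 0)" for A
  have "taylor_witness {e} (\<lambda>_. 0) 1 2 z z"
    unfolding taylor_witness_def
  proof (intro conjI allI impI)
    fix A :: "'a set set" assume "A \<subseteq> {e}"
    then have A: "A = {} \<or> A = {e}" by blast
    then have "{f \<in> {e} - A. f \<subseteq> \<Union>A} = {}" "{f \<in> A. f \<subseteq> \<Union>(A - {f})} = {}" using e by auto
    then show "(\<Sum>f | f \<in> {e} - A \<and> f \<subseteq> \<Union>A. face_sign (\<lambda>_. 0) A f * z (insert f A)) = 0"
      "(\<Sum>f | f \<in> A \<and> f \<subseteq> \<Union>(A - {f}). face_sign (\<lambda>_. 0) (A - {f}) f * z (A - {f})) = 0"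
      by (simp_all only: sum.empty)
  next
    have "Pow {e} = {{}, {e}}" by blast
    then show "(\<Sum>A\<in>Pow {e}. z A * z A) \<noteq> 0" by (simp add: z_def)
  qed (use e in \<open>auto simp: z_def split: if_split_asm\<close>)
  moreover have inj: "inj_on (\<lambda>_. 0 :: nat) (edges G)" by (simp add: E)
  ultimately show ?thesis unfolding betti_nonzero_iff[OF G inj] E by blast
qed

section \<open>The five-cycle\<close>

lemma face_sign_empty: "face_sign \<iota> {} e = 1"
  by (simp add: face_sign_def)

lemma filter_insert_set:
  "{x \<in> insert a A. P x} = (if P a then insert a {x \<in> A. P x} else {x \<in> A. P x})"
  by auto

lemma edges_cycle_5: "edges (cycle_graph 5) = {{0, 1}, {1, 2}, {2, 3}, {3, 4}, {4, 0}}"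
proof -
  have "edges (cycle_graph 5) = (\<lambda>i. {i, Suc i mod 5}) ` {..<5}"
    unfolding cycle_graph_def snd_conv by blast
  also have "{..<5} = {0, 1, 2, 3, 4 :: nat}" by auto
  finally show ?thesis by (simp add: numeral_2_eq_2)
qed

lemma simple_graph_cycle_5: "simple_graph (cycle_graph 5)"
  unfolding simple_graph_def edges_cycle_5 by (auto simp: cycle_graph_def)

text \<open>For the cyclic order of the edges, all five covering sets of three edges have coefficient 1 in
  the cocycle.\<close>

lemma betti_nonzero_cycle_5: "betti_nonzero TYPE('k::field) (cycle_graph 5) 3 5"
proof -
  define E :: "nat set set" where "E = {{0, 1}, {1, 2}, {2, 3}, {3, 4}, {4, 0}}"
  \<comment> \<open>The values on {4,0}, {0,1}, {1,2}, {2,3}, {3,4} are 0, 3, 7, 11, 15, which is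
    the cyclic order of the edges.\<close>
  define \<iota> :: "nat set \<Rightarrow> nat" where "\<iota> e = 5 * Min e + (4 - Max e)" for e
  define w :: "nat set set \<Rightarrow> 'k" where
    "w A = (if A \<subseteq> E \<and> card A = 3 \<and> {0, 1, 2, 3, 4} \<subseteq> \<Union>A then 1 else 0)" for A
  \<comment> \<open>An irredundant cover: each of the three edges has a vertex of its own, so no
    edge can be removed without changing the union, and \<open>z\<close> is a cycle.\<close>
  define A0 :: "nat set set" where "A0 = {{0, 1}, {2, 3}, {3, 4}}"
  define z :: "nat set set \<Rightarrow> 'k" where "z A = (if A = A0 then 1 else 0)" for A
  have finE: "finite E" and cardE: "card E = 5"
    by (simp_all add: E_def doubleton_eq_iff)
  have A0: "A0 \<subseteq> E" "card A0 = 3" "\<Union>A0 = {0, 1, 2, 3, 4}"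
    by (auto simp: A0_def E_def doubleton_eq_iff)
  have inj: "inj_on \<iota> E"
    by (simp add: E_def \<iota>_def doubleton_eq_iff)
  have "taylor_witness E \<iota> 3 5 z w"
    unfolding taylor_witness_def
  proof (intro conjI allI impI)
    fix A
    show "A \<subseteq> E" "card A = 3" "card (\<Union>A) = 5" if "z A \<noteq> 0"
      using that A0 by (simp_all add: z_def split: if_split_asm)
    show "A \<subseteq> E" "card A = 3" if "w A \<noteq> 0"
      using that by (simp_all add: w_def split: if_split_asm)
  next
    fix A assume A: "A \<subseteq> E"
    have "z (insert e A) = 0" if e: "e \<in> E - A" "e \<subseteq> \<Union>A" for e
    proof (rule ccontr)
      assume "z (insert e A) \<noteq> 0"
      then have ins: "insert e A = A0" by (simp add: z_def split: if_split_asm)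
      then have A_eq: "A = A0 - {e}" and "e \<in> A0" using e by auto
      from \<open>e \<in> A0\<close> consider "e = {0, 1}" | "e = {2, 3}" | "e = {3, 4}"
        unfolding A0_def by blast
      then have "\<not> {0, 1, 2, 3, 4} \<subseteq> \<Union>A"
        unfolding A_eq A0_def by cases (simp_all add: insert_Diff_if doubleton_eq_iff)
      moreover have "{0, 1, 2, 3, 4} \<subseteq> \<Union>A"
        unfolding A0(3)[symmetric] ins[symmetric] using e by blast
      ultimately show False by (rule notE)
    qed
    then show "(\<Sum>e | e \<in> E - A \<and> e \<subseteq> \<Union>A. face_sign \<iota> A e * z (insert e A)) = 0"
      by (intro sum.neutral) auto
    \<comment> \<open>Nonzero terms need four edges, which form a path through all five vertices.
      Its union survives exactly the removal of one of the two middle edges. These are consecutive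
      in the cyclic order, hence neighbours in \<iota> or the first and last of four, and their
      signs are opposite in either case.\<close>
    show "(\<Sum>e | e \<in> A \<and> e \<subseteq> \<Union>(A - {e}). face_sign \<iota> (A - {e}) e * w (A - {e})) = 0"
    proof (cases "card A = 4")
      case True
      then have "card (E - A) = 1"
        using A cardE finE by (simp add: card_Diff_subset finite_subset)
      then obtain f where "E - A = {f}" by (auto simp: card_1_singleton_iff)
      then have f: "A = E - {f}" "f \<in> E" using A by auto
      then consider "f = {0, 1}" | "f = {1, 2}" | "f = {2, 3}" | "f = {3, 4}" | "f = {4, 0}"
        by (auto simp: E_def)
      then show ?thesis
      proof cases
        case 1
        have A: "A = {{1, 2}, {2, 3}, {3, 4}, {4, 0}}"
          unfolding f(1) E_def 1 by (simp add: insert_Diff_if doubleton_eq_iff)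
        show ?thesis
          unfolding A filter_insert_set
          by (simp add: insert_Diff_if doubleton_eq_iff face_sign_insert face_sign_empty w_def E_def \<iota>_def)
      next
        case 2
        have A: "A = {{0, 1}, {2, 3}, {3, 4}, {4, 0}}"
          unfolding f(1) E_def 2 by (simp add: insert_Diff_if doubleton_eq_iff)
        show ?thesis
          unfolding A filter_insert_set
          by (simp add: insert_Diff_if doubleton_eq_iff face_sign_insert face_sign_empty w_def E_def \<iota>_def)
      next
        case 3
        have A: "A = {{0, 1}, {1, 2}, {3, 4}, {4, 0}}"
          unfolding f(1) E_def 3 by (simp add: insert_Diff_if doubleton_eq_iff)
        show ?thesis
          unfolding A filter_insert_set
          by (simp add: insert_Diff_if doubleton_eq_iff face_sign_insert face_sign_empty w_def E_def \<iota>_def)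
      next
        case 4
        have A: "A = {{0, 1}, {1, 2}, {2, 3}, {4, 0}}"
          unfolding f(1) E_def 4 by (simp add: insert_Diff_if doubleton_eq_iff)
        show ?thesis
          unfolding A filter_insert_set
          by (simp add: insert_Diff_if doubleton_eq_iff face_sign_insert face_sign_empty w_def E_def \<iota>_def)
      next
        case 5
        have A: "A = {{0, 1}, {1, 2}, {2, 3}, {3, 4}}"
          unfolding f(1) E_def 5 by (simp add: insert_Diff_if doubleton_eq_iff)
        show ?thesis
          unfolding A filter_insert_set
          by (simp add: insert_Diff_if doubleton_eq_iff face_sign_insert face_sign_empty w_def E_def \<iota>_def)
      qed
    next
      case False
      then have "card (A - {e}) \<noteq> 3" if "e \<in> A" for e
        using card_Suc_Diff1[of A e] that A finE by (auto dest: finite_subset)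
      then show ?thesis by (intro sum.neutral) (auto simp: w_def)
    qed
  next
    have "(\<Sum>A\<in>Pow E. w A * z A) = (\<Sum>A\<in>{A0}. w A * z A)"
      using A0 finE by (intro sum.mono_neutral_right) (auto simp: z_def)
    then show "(\<Sum>A\<in>Pow E. w A * z A) \<noteq> 0" using A0 by (simp add: z_def w_def)
  qed
  moreover have "edges (cycle_graph 5) = E" by (simp only: edges_cycle_5 E_def)
  ultimately show ?thesis
    using betti_nonzero_iff[OF simple_graph_cycle_5, of \<iota>] inj by auto
qed

section \<open>Matchings and components\<close>

lemma finite_matchings: "simple_graph G \<Longrightarrow> finite {M. matching G M}"
  by (rule finite_subset[of _ "Pow (edges G)"]) (auto simp: matching_def finite_edges)

lemma match_ge: "simple_graph G \<Longrightarrow> matching G M \<Longrightarrow> card M \<le> match G"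
  using finite_matchings[of G] by (auto simp: match_def intro!: Max_ge)

lemma match_attained:
  assumes "simple_graph G"
  obtains M where "matching G M" "card M = match G"
proof -
  have "matching G {}" by (simp add: matching_def)
  then have "match G \<in> card ` {M. matching G M}"
    unfolding match_def using finite_matchings[OF assms] by (intro Max_in) auto
  then show thesis using that by auto
qed

text \<open>Disjoint edges use two vertices each. This bounds the matching numbers of K_2 and C_5
  without listing matchings.\<close>

lemma match_le_half:
  assumes G: "simple_graph G"
  shows "2 * match G \<le> card (verts G)"
proof -
  obtain M where M: "matching G M" "card M = match G" using match_attained[OF G] .
  have "card (\<Union>M) = (\<Sum>e\<in>M. card e)"
    using M(1) G by (intro card_Union_disjoint)
      (auto simp: matching_def simple_graph_def dest: finite_subset)
  also have "\<dots> = (\<Sum>e\<in>M. 2)"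
    using M(1) G by (intro sum.cong) (auto simp: matching_def simple_graph_def)
  finally have "card (\<Union>M) = 2 * match G" using M(2) by simp
  moreover have "\<Union>M \<subseteq> verts G" "finite (verts G)"
    using M(1) G by (auto simp: matching_def simple_graph_def)
  ultimately show ?thesis using card_mono by metis
qed

text \<open>An injective vertex map keeps disjoint edges disjoint. The inequality carries the bound
  from a member of the class to the component isomorphic to it.\<close>

lemma match_iso_le:
  assumes G: "simple_graph G" and H: "simple_graph H" and iso: "graph_iso G H"
  shows "match G \<le> match H"
proof -
  obtain f where f: "bij_betw f (verts G) (verts H)" and E: "edges H = (`) f ` edges G"
    using iso by (auto simp: graph_iso_def)
  obtain M where M: "matching G M" "card M = match G" using match_attained[OF G] .
  have sub: "e \<subseteq> verts G" if "e \<in> M" for e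
    using that M(1) G by (auto simp: matching_def simple_graph_def)
  have inj: "inj_on f (verts G)" using f by (simp add: bij_betw_def)
  then have "inj_on ((`) f) M"
    using sub by (intro inj_on_image inj_on_subset[OF inj]) auto
  then have "card ((`) f ` M) = match G" using M(2) by (simp add: card_image)
  moreover have "matching H ((`) f ` M)"
    unfolding matching_def
  proof
    show "(`) f ` M \<subseteq> edges H" using M(1) by (auto simp: E matching_def)
    show "pairwise disjnt ((`) f ` M)"
    proof (rule pairwiseI, clarify)
      fix a b assume ab: "a \<in> M" "b \<in> M" "f ` a \<noteq> f ` b"
      then have "a \<noteq> b" by blast
      then have "disjnt a b" using M(1) ab by (simp add: matching_def pairwise_def)
      then show "disjnt (f ` a) (f ` b)"
        using inj_on_image_Int[OF inj sub[OF ab(1)] sub[OF ab(2)]] by (simp add: disjnt_def)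
    qed
  qed
  ultimately show ?thesis using match_ge[OF H] by metis
qed

lemma reach_equiv: "equiv (verts G) (reach G)"
proof (rule equivI)
  let ?R = "{(u, v). {u, v} \<in> edges G}"
  have "sym ?R" by (auto simp: sym_def insert_commute)
  then have "sym (?R\<^sup>*)" by (rule sym_rtrancl)
  then show "sym (reach G)" by (auto simp: reach_def sym_def)
  show "trans (reach G)" unfolding reach_def trans_def by (blast intro: rtrancl_trans)
  show "refl_on (verts G) (reach G)" by (auto simp: reach_def refl_on_def)
  show "reach G \<subseteq> verts G \<times> verts G" by (auto simp: reach_def)
qed

lemma finite_components: "simple_graph G \<Longrightarrow> finite (verts G // reach G)"
  by (intro finite_quotient) (auto simp: simple_graph_def reach_def)

lemma edge_in_class:
  assumes G: "simple_graph G" and e: "e \<in> edges G"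
  obtains K where "K \<in> verts G // reach G" "e \<subseteq> K"
proof -
  have "card e = 2" "e \<subseteq> verts G" using G e by (auto simp: simple_graph_def)
  then obtain u v where uv: "e = {u, v}" "u \<in> verts G" "v \<in> verts G"
    by (auto simp: card_2_iff)
  then have "(u, v) \<in> reach G" "(u, u) \<in> reach G" using e by (auto simp: reach_def)
  then show thesis using uv by (intro that[of "reach G `` {u}"]) (auto intro: quotientI)
qed

text \<open>Every edge lies in one class of vertices, so the restrictions of a largest matching to
  the classes exhaust it.\<close>

lemma match_le_sum_components:
  assumes G: "simple_graph G"
  shows "match G \<le> (\<Sum>K\<in>verts G // reach G. match (induced G K))"
proof -
  let ?Q = "verts G // reach G"
  have Q: "finite ?Q" "\<And>K. K \<in> ?Q \<Longrightarrow> K \<subseteq> verts G"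
    using finite_components[OF G] Union_quotient[OF reach_equiv[of G]] by blast+
  obtain M where M: "matching G M" "card M = match G" using match_attained[OF G] .
  have "M = (\<Union>K\<in>?Q. {e \<in> M. e \<subseteq> K})"
  proof
    show "M \<subseteq> (\<Union>K\<in>?Q. {e \<in> M. e \<subseteq> K})"
    proof
      fix e assume e: "e \<in> M"
      then have "e \<in> edges G" using M(1) by (auto simp: matching_def)
      then obtain K where "K \<in> ?Q" "e \<subseteq> K" by (rule edge_in_class[OF G])
      then show "e \<in> (\<Union>K\<in>?Q. {e \<in> M. e \<subseteq> K})" using e by blast
    qed
  qed blast
  then have "match G = card (\<Union>K\<in>?Q. {e \<in> M. e \<subseteq> K})" using M(2) by simp
  also have "\<dots> \<le> (\<Sum>K\<in>?Q. card {e \<in> M. e \<subseteq> K})" by (rule card_UN_le[OF Q(1)])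
  also have "\<dots> \<le> (\<Sum>K\<in>?Q. match (induced G K))"
  proof (rule sum_mono)
    fix K assume "K \<in> ?Q"
    moreover have "matching (induced G K) {e \<in> M. e \<subseteq> K}"
      using M(1) by (auto simp: matching_def induced_def pairwise_def)
    ultimately show "card {e \<in> M. e \<subseteq> K} \<le> match (induced G K)"
      using match_ge simple_graph_induced[OF G] Q(2) by blast
  qed
  finally show ?thesis .
qed

text \<open>The induction adds one class at a time, and the unions of classes remain induced
  subgraphs of the same graph throughout. The empty collection is served by the graph without
  vertices in bidegree (0, 0).\<close>

lemma betti_nonzero_components:
  assumes G: "simple_graph G" and fin: "finite \<K>" and sub: "\<K> \<subseteq> verts G // reach G"
    and comp: "\<And>K. K \<in> \<K> \<Longrightarrow>
      \<exists>i j. betti_nonzero TYPE('k::field) (induced G K) i j \<and> int (m K) \<le> int j - int i"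
  shows "\<exists>i j. betti_nonzero TYPE('k) (induced G (\<Union>\<K>)) i j \<and> int (\<Sum>K\<in>\<K>. m K) \<le> int j - int i"
  using fin sub comp
proof (induction \<K> rule: finite_induct)
  case empty
  have "betti_nonzero TYPE('k) (induced G {}) 0 0"
    by (rule betti_nonzero_0[OF simple_graph_induced[OF G]]) simp
  then show ?case by auto
next
  case (insert K \<K>)
  let ?Q = "verts G // reach G"
  note disj = quotient_disj[OF reach_equiv[of G]]
  obtain i\<^sub>1 j\<^sub>1 where 1: "betti_nonzero TYPE('k) (induced G K) i\<^sub>1 j\<^sub>1" "int (m K) \<le> int j\<^sub>1 - int i\<^sub>1"
    using insert.prems(2)[of K] by auto
  obtain i\<^sub>2 j\<^sub>2 where 2: "betti_nonzero TYPE('k) (induced G (\<Union>\<K>)) i\<^sub>2 j\<^sub>2"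
    "int (\<Sum>K\<in>\<K>. m K) \<le> int j\<^sub>2 - int i\<^sub>2"
    using insert.IH insert.prems by auto
  have "betti_nonzero TYPE('k) (induced G (K \<union> \<Union>\<K>)) (i\<^sub>1 + i\<^sub>2) (j\<^sub>1 + j\<^sub>2)"
  proof (rule betti_nonzero_disjoint_Un[OF G _ _ _ _ 1(1) 2(1)])
    have "L \<subseteq> verts G" if "L \<in> ?Q" for L
      using that Union_quotient[OF reach_equiv[of G]] by blast
    then show "K \<subseteq> verts G" "\<Union>\<K> \<subseteq> verts G" using insert.prems(1) by blast+
    show "K \<inter> \<Union>\<K> = {}" using disj insert.prems(1) insert.hyps(2) by blast
    fix e assume e: "e \<in> edges G" "e \<subseteq> K \<union> \<Union>\<K>"
    \<comment> \<open>The edge lies in one class \<open>L\<close>, and it has a vertex in a member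
      of \<open>insert K \<K>\<close>; distinct classes being disjoint, \<open>L\<close> is that
      member.\<close>
    obtain L where L: "L \<in> ?Q" "e \<subseteq> L" using edge_in_class[OF G e(1)] .
    obtain x where x: "x \<in> e" using G e(1) by (fastforce simp: simple_graph_def)
    then obtain K' where K': "K' \<in> insert K \<K>" "x \<in> K'" using e(2) by blast
    then have "K' = L" using disj[of K' L] insert.prems(1) L x by blast
    then show "e \<subseteq> K \<or> e \<subseteq> \<Union>\<K>" using L(2) K'(1) by blast
  qed
  moreover have "int (\<Sum>K\<in>insert K \<K>. m K) \<le> int (j\<^sub>1 + j\<^sub>2) - int (i\<^sub>1 + i\<^sub>2)"
    using 1(2) 2(2) insert.hyps by simp
  ultimately show ?case unfolding Union_insert by blast
qed

section \<open>The graph K_2 and single edges as induced subgraphs\<close>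

lemma edges_complete_2: "edges (complete_graph 2) = {{0, 1}}"
proof (rule set_eqI)
  fix e :: "nat set"
  have "e \<in> edges (complete_graph 2) \<longleftrightarrow> (\<exists>i j. e = {i, j} \<and> i < 2 \<and> j < 2 \<and> i \<noteq> j)"
    by (simp add: complete_graph_def)
  also have "\<dots> \<longleftrightarrow> e = {0, 1}"
  proof
    assume "\<exists>i j. e = {i, j} \<and> i < 2 \<and> j < 2 \<and> i \<noteq> j"
    then show "e = {0, 1}" by (auto simp: less_2_cases_iff)
  next
    assume "e = {0, 1}"
    then show "\<exists>i j. e = {i, j} \<and> i < 2 \<and> j < 2 \<and> i \<noteq> j"
      by (intro exI[of _ 0] exI[of _ 1]) simp
  qed
  finally show "e \<in> edges (complete_graph 2) \<longleftrightarrow> e \<in> {{0, 1}}" by simp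
qed

lemma simple_graph_complete_2: "simple_graph (complete_graph 2)"
  unfolding simple_graph_def edges_complete_2 by (simp add: complete_graph_def)

lemma graph_iso_refl: "graph_iso G G"
  unfolding graph_iso_def by (rule exI[of _ id]) (simp add: image_id)

lemma graph_iso_trans:
  assumes "graph_iso G H" "graph_iso H K"
  shows "graph_iso G K"
proof -
  obtain f where f: "bij_betw f (verts G) (verts H)" "edges H = (`) f ` edges G"
    using assms(1) by (auto simp: graph_iso_def)
  obtain g where g: "bij_betw g (verts H) (verts K)" "edges K = (`) g ` edges H"
    using assms(2) by (auto simp: graph_iso_def)
  show ?thesis
    unfolding graph_iso_def
    by (rule exI[of _ "g \<circ> f"]) (use f g in \<open>auto intro: bij_betw_trans simp: image_image image_comp\<close>)
qed

lemma induced_verts: "simple_graph G \<Longrightarrow> induced G (verts G) = G"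
  by (cases G) (auto simp: induced_def simple_graph_def)

lemma induced_edge_iso:
  assumes G: "simple_graph G" and e: "e \<in> edges G"
  shows "graph_iso (induced G e) (complete_graph 2)"
proof -
  have card: "card e = 2" using G e by (auto simp: simple_graph_def)
  then obtain u v where uv: "e = {u, v}" "u \<noteq> v" by (auto simp: card_2_iff)
  have "f = e" if "f \<in> edges G" "f \<subseteq> e" for f
    using that G card card_subset_eq[of e f] uv by (auto simp: simple_graph_def)
  then have E: "edges (induced G e) = {e}" using e by (auto simp: induced_def)
  have "{..<2} = {0, 1 :: nat}" by auto
  then show ?thesis
    unfolding graph_iso_def E edges_complete_2
    by (intro exI[of _ "\<lambda>x. if x = u then 0 else 1"])
      (use uv in \<open>auto simp: bij_betw_def inj_on_def induced_def complete_graph_def\<close>)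
qed

lemma components_induced_edge:
  assumes G: "simple_graph G" and e: "e \<in> edges G"
  shows "components (induced G e) = {induced G e}"
proof -
  let ?H = "induced G e"
  have "card e = 2" using G e by (auto simp: simple_graph_def)
  then obtain u v where uv: "e = {u, v}" by (auto simp: card_2_iff)
  have "(x, y) \<in> reach ?H" if "x \<in> e" "y \<in> e" for x y
    using that e uv by (auto simp: reach_def induced_def insert_commute)
  then have "reach ?H = e \<times> e" by (auto simp: reach_def induced_def)
  then have "verts ?H // reach ?H = {e}"
    using uv by (auto simp: quotient_def induced_def)
  then show ?thesis by (auto simp: components_def induced_def)
qed

section \<open>The lower bound for the regularity\<close>

text \<open>The hypothesis asks for one nonzero Betti number with j - i at least the matching
  number, instead of for the regularity. Members of the given class provide it where their
  regularity is attained, and C_5 provides it by its class in bidegree (3, 5).\<close>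

lemma ind_match_le_reg:
  fixes G :: "'v graph"
  assumes \<H>: "\<And>H. H \<in> \<H> \<Longrightarrow> simple_graph H \<and>
      (\<exists>i j. betti_nonzero TYPE('k::field) H i j \<and> int (match H) \<le> int j - int i)"
    and K2: "iso_mem (complete_graph 2) \<H>" and G: "simple_graph G"
  shows "int (ind_match \<H> G) \<le> reg_edge TYPE('k) G"
proof (cases "edges G = {}")
  case True
  then show ?thesis
    using reg_edge_ge[OF G betti_nonzero_0[OF G]] by (simp add: ind_match_def)
next
  case False
  let ?S = "{match H | H. induced_H_subgraph \<H> H G}"
  have "finite ?S"
  proof (rule finite_subset)
    show "?S \<subseteq> (\<lambda>W. match (induced G W)) ` Pow (verts G)"
      by (force simp: induced_H_subgraph_def H_subgraph_def subgraph_of_def)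
    show "finite ((\<lambda>W. match (induced G W)) ` Pow (verts G))"
      using G by (simp add: simple_graph_def)
  qed
  \<comment> \<open>\<open>Max\<close> is attained only on a nonempty set; any single edge of the
    graph is an induced copy of K_2 and provides an element.\<close>
  moreover have "?S \<noteq> {}"
  proof -
    obtain e where e: "e \<in> edges G" using False by blast
    then have e': "e \<subseteq> verts G" "e \<noteq> {}" using G by (auto simp: simple_graph_def)
    have "iso_mem (induced G e) \<H>"
      using K2 graph_iso_trans[OF induced_edge_iso[OF G e]] by (auto simp: iso_mem_def)
    moreover have "subgraph_of (induced G e) G"
      using simple_graph_induced[OF G e'(1)] e'(1) by (auto simp: subgraph_of_def induced_def)
    ultimately have "induced_H_subgraph \<H> (induced G e) G"
      using e'(2) components_induced_edge[OF G e]
      by (simp add: induced_H_subgraph_def H_subgraph_def) (simp add: induced_def)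
    then show ?thesis by blast
  qed
  ultimately have "ind_match \<H> G \<in> ?S"
    unfolding ind_match_def using False by (simp only: if_False) (rule Max_in)
  then obtain H where H: "induced_H_subgraph \<H> H G" and match: "ind_match \<H> G = match H" by blast
  let ?Q = "verts H // reach H"
  have simple: "simple_graph H" and sub: "verts H \<subseteq> verts G" and ind: "H = induced G (verts H)"
    and comp: "\<And>K. K \<in> ?Q \<Longrightarrow> iso_mem (induced H K) \<H>"
    using H by (auto simp: induced_H_subgraph_def H_subgraph_def subgraph_of_def components_def)
  have Q: "\<Union>?Q = verts H" by (rule Union_quotient[OF reach_equiv])
  have fin: "finite ?Q" by (rule finite_components[OF simple])
  have "\<exists>i j. betti_nonzero TYPE('k) (induced H K) i j \<and> int (match (induced H K)) \<le> int j - int i"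
    if K: "K \<in> ?Q" for K
  proof -
    obtain H' where H': "H' \<in> \<H>" "graph_iso (induced H K) H'"
      using comp[OF K] by (auto simp: iso_mem_def)
    obtain i j where ij: "betti_nonzero TYPE('k) H' i j" "int (match H') \<le> int j - int i"
      and simple': "simple_graph H'"
      using \<H>[OF H'(1)] by blast
    have K_simple: "simple_graph (induced H K)"
      using simple_graph_induced[OF simple] K Q by blast
    show ?thesis
      using betti_nonzero_iso[OF K_simple simple' H'(2) ij(1)]
        match_iso_le[OF K_simple simple' H'(2)] ij(2) by force
  qed
  from betti_nonzero_components[OF simple fin subset_refl this] obtain i j where
    ij: "betti_nonzero TYPE('k) (induced H (\<Union>?Q)) i j"
      "int (\<Sum>K\<in>?Q. match (induced H K)) \<le> int j - int i" by blast
  have "betti_nonzero TYPE('k) (induced G (verts H)) i j"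
    using ij(1) induced_verts[OF simple] ind by (simp only: Q)
  then have "betti_nonzero TYPE('k) G i j"
    by (rule betti_nonzero_induced[OF G sub])
  then have "int j - int i \<le> reg_edge TYPE('k) G" by (rule reg_edge_ge[OF G])
  moreover have "int (match H) \<le> int (\<Sum>K\<in>?Q. match (induced H K))"
    using match_le_sum_components[OF simple] by (simp only: of_nat_le_iff)
  ultimately show ?thesis using ij(2) match by linarith
qed

theorem theorem3p5:
  shows "(\<forall>\<H> \<subseteq> reg_eq_match_graphs TYPE('k::field). iso_mem (complete_graph 2) \<H> \<longrightarrow>
            (\<forall>G :: 'v graph. simple_graph G \<longrightarrow>
               int (ind_match \<H> G) \<le> reg_edge TYPE('k) G)) \<and>
         (\<forall>G :: 'v graph. simple_graph G \<longrightarrow>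
            int (ind_match {complete_graph 2, cycle_graph 5} G) \<le> reg_edge TYPE('k) G)"
proof (intro conjI allI impI)
  fix \<H> and G :: "'v graph"
  assume \<H>: "\<H> \<subseteq> reg_eq_match_graphs TYPE('k)" and "iso_mem (complete_graph 2) \<H>" "simple_graph G"
  moreover have "simple_graph H \<and>
      (\<exists>i j. betti_nonzero TYPE('k) H i j \<and> int (match H) \<le> int j - int i)" if "H \<in> \<H>" for H
  proof -
    have H: "simple_graph H" "reg_edge TYPE('k) H = int (match H)"
      using that \<H> by (auto simp: reg_eq_match_graphs_def)
    obtain i j where "betti_nonzero TYPE('k) H i j" "reg_edge TYPE('k) H = int j - int i"
      using reg_edge_attained[OF H(1)] .
    then show ?thesis using H by auto
  qed
  ultimately show "int (ind_match \<H> G) \<le> reg_edge TYPE('k) G"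
    by (intro ind_match_le_reg)
next
  fix G :: "'v graph"
  assume G: "simple_graph G"
  let ?\<H> = "{complete_graph 2, cycle_graph 5}"
  have "betti_nonzero TYPE('k) (complete_graph 2) 1 2"
    by (rule betti_nonzero_single_edge[OF simple_graph_complete_2 edges_complete_2])
  moreover have "match (complete_graph 2) \<le> 1"
    using match_le_half[OF simple_graph_complete_2] by (simp add: complete_graph_def)
  \<comment> \<open>The class of C_5 contributes 5 - 3 = 2, just what five vertices allow for a
    matching.\<close>
  moreover have "match (cycle_graph 5) \<le> 2"
    using match_le_half[OF simple_graph_cycle_5] by (simp add: cycle_graph_def)
  ultimately have "simple_graph H \<and>
      (\<exists>i j. betti_nonzero TYPE('k) H i j \<and> int (match H) \<le> int j - int i)" if "H \<in> ?\<H>" for H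
    using that betti_nonzero_cycle_5[where 'k = 'k] simple_graph_complete_2 simple_graph_cycle_5
    by (elim insertE; force)
  moreover have "iso_mem (complete_graph 2) ?\<H>"
    by (simp add: iso_mem_def graph_iso_refl)
  ultimately show "int (ind_match ?\<H> G) \<le> reg_edge TYPE('k) G"
    using G by (intro ind_match_le_reg)
qed

end
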